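(* Let $U\subset\mathbb D$ be a connected open set and let $f:U\to\mathbb G_2$ be a map (no regularity assumed) satisfying \[ k_{\mathbb G_2}(f(\lambda_1),f(\lambda_2))=\rho(\lambda_1,\lambda_2)\qquad\text{for all }\lambda_1,\lambda_2\in U. \] Then $f$ is holomorphic on $U$ or anti-holomorphic on $U$.
   Context: $\mathbb D=\{\lambda\in\mathbb C:|\lambda|<1\}$ is the open unit disc. The symmetrized bidisc is the domain $\mathbb G_2=\{(z+w,zw):z,w\in\mathbb D\}\subset\mathbb C^2$. $\rho$ is the Poincaré distance on $\mathbb D$, normalized so that its infinitesimal metric is $|v|/(1-|\lambda|^2)$, i.e. $\rho(\lambda_1,\lambda_2)=\tanh^{-1}\left|\frac{\lambda_1-\lambda_2}{1-\overline{\lambda_2}\lambda_1}\right|$. $k_{\mathbb G_2}$ is the Kobayashi distance of $\mathbb G_2$ (with respect to this normalization of $\rho$): the largest pseudodistance $d$ on $\mathbb G_2$ such that $d(\varphi(\lambda),\varphi(\mu))\le\rho(\lambda,\mu)$ for every holomorphic $\varphi:\mathbb D\to\mathbb G_2$ and all $\lambda,\mu\in\mathbb D$. (It is known that on $\mathbb G_2$ it coincides with the Carathéodory distance $\sup\{\rho(F(z),F(w)):F:\mathbb G_2\to\mathbb D\text{ holomorphic}\}$.) A map $f=(f_1,f_2):U\to\mathbb C^2$ is anti-holomorphic if $\overline{f_1}$ and $\overline{f_2}$ are holomorphic. *)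

theory Defs
  imports "HOL-Complex_Analysis.Complex_Analysis"
begin

abbreviation unit_disc :: "complex set"
  where "unit_disc \<equiv> ball 0 1"

definition symmetrized_bidisc :: "(complex \<times> complex) set"
  where "symmetrized_bidisc = {(z + w, z * w) | z w. z \<in> unit_disc \<and> w \<in> unit_disc}"

definition poincare_dist :: "complex \<Rightarrow> complex \<Rightarrow> real"
  where "poincare_dist a b = artanh (cmod ((a - b) / (1 - cnj b * a)))"

definition holomorphic_map_on :: "(complex \<Rightarrow> complex \<times> complex) \<Rightarrow> complex set \<Rightarrow> bool"
  where "holomorphic_map_on f U \<longleftrightarrow>
    (\<lambda>z. fst (f z)) holomorphic_on U \<and> (\<lambda>z. snd (f z)) holomorphic_on U"

definition antiholomorphic_map_on :: "(complex \<Rightarrow> complex \<times> complex) \<Rightarrow> complex set \<Rightarrow> bool"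
  where "antiholomorphic_map_on f U \<longleftrightarrow>
    (\<lambda>z. cnj (fst (f z))) holomorphic_on U \<and> (\<lambda>z. cnj (snd (f z))) holomorphic_on U"

definition pseudodistance_on :: "'a set \<Rightarrow> ('a \<Rightarrow> 'a \<Rightarrow> real) \<Rightarrow> bool"
  where "pseudodistance_on S d \<longleftrightarrow>
    (\<forall>x\<in>S. \<forall>y\<in>S. 0 \<le> d x y) \<and>
    (\<forall>x\<in>S. d x x = 0) \<and>
    (\<forall>x\<in>S. \<forall>y\<in>S. d x y = d y x) \<and>
    (\<forall>x\<in>S. \<forall>y\<in>S. \<forall>z\<in>S. d x z \<le> d x y + d y z)"

definition disc_contractive ::
    "(complex \<times> complex) set \<Rightarrow> (complex \<times> complex \<Rightarrow> complex \<times> complex \<Rightarrow> real) \<Rightarrow> bool"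
  where "disc_contractive S d \<longleftrightarrow>
    (\<forall>\<phi>. holomorphic_map_on \<phi> unit_disc \<and> \<phi> ` unit_disc \<subseteq> S \<longrightarrow>
      (\<forall>a\<in>unit_disc. \<forall>b\<in>unit_disc. d (\<phi> a) (\<phi> b) \<le> poincare_dist a b))"

text \<open>
  The pointwise supremum is taken in the reals, so it is only meaningful where it is bounded above.
  On the symmetrized bidisc it is, and there it is indeed the largest disc-contractive
  pseudodistance; see \<open>kobayashi_dist_symmetrized_bidisc\<close> below.
\<close>

definition kobayashi_dist ::
    "(complex \<times> complex) set \<Rightarrow> complex \<times> complex \<Rightarrow> complex \<times> complex \<Rightarrow> real"
  where "kobayashi_dist S x y = (SUP d \<in> {d. pseudodistance_on S d \<and> disc_contractive S d}. d x y)"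

lemma symmetrized_bidisc_disc_through_origin:
  assumes "x \<in> symmetrized_bidisc"
  obtains \<phi> r where "holomorphic_map_on \<phi> unit_disc" "\<phi> ` unit_disc \<subseteq> symmetrized_bidisc"
    "r \<in> unit_disc" "\<phi> 0 = (0, 0)" "\<phi> r = x"
proof -
  obtain z w where x: "x = (z + w, z * w)" and zw: "cmod z < 1" "cmod w < 1"
    using assms by (auto simp: symmetrized_bidisc_def)
  obtain r where r: "max (cmod z) (cmod w) < r" "r < 1"
    using dense[of "max (cmod z) (cmod w)" 1] zw by auto
  have r0: "r > 0" using r norm_ge_zero[of z] by linarith
  define \<phi> where "\<phi> = (\<lambda>t::complex. (t * (z / of_real r) + t * (w / of_real r),
    (t * (z / of_real r)) * (t * (w / of_real r))))"
  have le: "cmod (t * (v / of_real r)) < 1" if "cmod t < 1" "cmod v < r" for t v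
  proof -
    have "cmod (v / of_real r) < 1" using that r0 by (simp add: norm_divide)
    then have "cmod t * cmod (v / of_real r) < 1 * 1"
      using that by (intro mult_strict_mono') auto
    then show ?thesis by (simp only: norm_mult)
  qed
  show ?thesis
  proof (rule that[of \<phi> "of_real r"])
    show "holomorphic_map_on \<phi> unit_disc"
      unfolding holomorphic_map_on_def \<phi>_def fst_conv snd_conv
      using r0 by (intro conjI holomorphic_intros) auto
    show "\<phi> ` unit_disc \<subseteq> symmetrized_bidisc"
      using le r unfolding symmetrized_bidisc_def \<phi>_def by fastforce
    show "of_real r \<in> unit_disc" using r r0 by simp
    show "\<phi> 0 = (0, 0)" by (simp add: \<phi>_def)
    show "\<phi> (of_real r) = x" using r0 by (simp add: \<phi>_def x)
  qed
qed

lemma kobayashi_dist_bdd_above: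
  assumes "x \<in> symmetrized_bidisc" "y \<in> symmetrized_bidisc"
  shows "bdd_above ((\<lambda>d. d x y) ` {d. pseudodistance_on symmetrized_bidisc d \<and>
    disc_contractive symmetrized_bidisc d})"
proof -
  obtain \<phi> r where \<phi>: "holomorphic_map_on \<phi> unit_disc" "\<phi> ` unit_disc \<subseteq> symmetrized_bidisc"
    "r \<in> unit_disc" "\<phi> 0 = (0, 0)" "\<phi> r = x"
    using symmetrized_bidisc_disc_through_origin[OF assms(1)] .
  obtain \<psi> s where \<psi>: "holomorphic_map_on \<psi> unit_disc" "\<psi> ` unit_disc \<subseteq> symmetrized_bidisc"
    "s \<in> unit_disc" "\<psi> 0 = (0, 0)" "\<psi> s = y"
    using symmetrized_bidisc_disc_through_origin[OF assms(2)] .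
  have o: "(0, 0) \<in> symmetrized_bidisc"
    unfolding symmetrized_bidisc_def by force
  have z: "(0::complex) \<in> unit_disc" by simp
  have "d x y \<le> poincare_dist r 0 + poincare_dist 0 s"
    if "pseudodistance_on symmetrized_bidisc d" "disc_contractive symmetrized_bidisc d" for d
  proof -
    have "d (\<phi> r) (\<phi> 0) \<le> poincare_dist r 0" "d (\<psi> 0) (\<psi> s) \<le> poincare_dist 0 s"
      using that(2) \<phi>(1,2,3) \<psi>(1,2,3) z unfolding disc_contractive_def by blast+
    moreover have "d x y \<le> d x (0, 0) + d (0, 0) y"
      using that(1) assms o unfolding pseudodistance_on_def by blast
    ultimately show ?thesis using \<phi>(4,5) \<psi>(4,5) by simp
  qed
  then show ?thesis by (intro bdd_aboveI) auto
qed

lemma poincare_dist_nonneg: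
  assumes "a \<in> unit_disc" "b \<in> unit_disc"
  shows "0 \<le> poincare_dist a b"
proof -
  have a: "cmod a < 1" "cmod b < 1" using assms by auto
  have "cmod (cnj b * a) < 1"
    using mult_strict_mono'[of "cmod b" 1 "cmod a" 1] a by (simp add: norm_mult)
  then have nz: "1 - cnj b * a \<noteq> 0" by auto
  have "(cmod (1 - cnj b * a))\<^sup>2 - (cmod (a - b))\<^sup>2 = (1 - (cmod a)\<^sup>2) * (1 - (cmod b)\<^sup>2)"
    unfolding cmod_power2 by (simp add: algebra_simps power2_eq_square)
  also have "\<dots> > 0"
    using a by (intro mult_pos_pos) (auto simp: power_less_one_iff abs_square_less_1)
  finally have "cmod (a - b) < cmod (1 - cnj b * a)"
    by (simp add: power_less_imp_less_base)
  then have "cmod ((a - b) / (1 - cnj b * a)) < 1"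
    using nz by (simp add: norm_divide)
  moreover have "0 \<le> artanh t" if "0 \<le> t" "t < 1" for t :: real
    using that by (simp add: artanh_def)
  ultimately show ?thesis unfolding poincare_dist_def by simp
qed

theorem kobayashi_dist_symmetrized_bidisc:
  shows "pseudodistance_on symmetrized_bidisc (kobayashi_dist symmetrized_bidisc)"
    and "disc_contractive symmetrized_bidisc (kobayashi_dist symmetrized_bidisc)"
    and "\<And>d x y. \<lbrakk>pseudodistance_on symmetrized_bidisc d; disc_contractive symmetrized_bidisc d;
           x \<in> symmetrized_bidisc; y \<in> symmetrized_bidisc\<rbrakk>
         \<Longrightarrow> d x y \<le> kobayashi_dist symmetrized_bidisc x y"
proof -
  let ?G = symmetrized_bidisc
  let ?k = "kobayashi_dist ?G"
  let ?D = "{d. pseudodistance_on ?G d \<and> disc_contractive ?G d}"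
  have zero: "(\<lambda>_ _. 0) \<in> ?D"
    by (auto simp: pseudodistance_on_def disc_contractive_def poincare_dist_nonneg)
  then have ne: "?D \<noteq> {}" by blast
  show upper: "d x y \<le> ?k x y"
    if "pseudodistance_on ?G d" "disc_contractive ?G d" "x \<in> ?G" "y \<in> ?G" for d x y
    unfolding kobayashi_dist_def
    using that by (intro cSUP_upper kobayashi_dist_bdd_above) auto
  have least: "?k x y \<le> c" if "\<And>d. d \<in> ?D \<Longrightarrow> d x y \<le> c" for x y c
    unfolding kobayashi_dist_def using that ne by (intro cSUP_least) auto
  show "disc_contractive ?G ?k"
    unfolding disc_contractive_def
    by (intro allI impI ballI least) (auto simp: disc_contractive_def)
  show "pseudodistance_on ?G ?k"
    unfolding pseudodistance_on_def
  proof (intro conjI ballI)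
    fix x y assume xy: "x \<in> ?G" "y \<in> ?G"
    show nonneg: "0 \<le> ?k x y"
      using upper[of "\<lambda>_ _. 0" x y] zero xy by simp
    have "(\<lambda>d. d x y) ` ?D = (\<lambda>d. d y x) ` ?D"
      using xy by (intro image_cong) (auto simp: pseudodistance_on_def)
    then show "?k x y = ?k y x" by (simp add: kobayashi_dist_def)
    fix z assume z: "z \<in> ?G"
    show "?k x z \<le> ?k x y + ?k y z"
    proof (rule least)
      fix d assume d: "d \<in> ?D"
      then have "d x z \<le> d x y + d y z"
        using xy z by (auto simp: pseudodistance_on_def)
      also have "\<dots> \<le> ?k x y + ?k y z"
        using d xy z by (intro add_mono upper) auto
      finally show "d x z \<le> ?k x y + ?k y z" .
    qed
  next
    fix x assume x: "x \<in> ?G"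
    show "?k x x = 0"
    proof (rule antisym)
      show "?k x x \<le> 0" by (rule least) (use x in \<open>auto simp: pseudodistance_on_def\<close>)
      show "0 \<le> ?k x x" using upper[of "\<lambda>_ _. 0" x x] zero x by simp
    qed
  qed
qed

end

theory Submission
  imports Defs "HOL-Real_Asymp.Real_Asymp"
begin

text \<open>
  Applying an automorphism of the symmetrized bidisc, assume \<open>f a = (0, p)\<close>; suppose first \<open>p \<noteq> 0\<close>, that is, \<open>f a\<close> is
  off the royal variety \<open>s\<^sup>2 = 4 p\<close>. The magic functions \<open>\<Phi>\<^sub>\<omega>(s, p) = (2 \<omega> p - s) / (2 - \<omega> s)\<close> make
  \<open>f\<close> locally Lipschitz, and extremal discs show that they compute the infinitesimal Kobayashi
  metric at \<open>(0, p)\<close> as a maximum of moduli of linear functionals. A blow-up of \<open>f\<close> near \<open>a\<close> is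
  then an isometric map from the plane into the tangent space with this norm. Because the
  functionals trace an ellipse that is not a circle, such a map is complex linear or conjugate
  linear. By continuity the same alternative holds for all small blow-ups near \<open>a\<close>, so Goursat's
  argument shows that \<open>f\<close> is holomorphic or antiholomorphic near \<open>a\<close>.

  If \<open>f\<close> is holomorphic near \<open>a\<close>, the equality case of the Schwarz lemma makes some \<open>\<Phi>\<^sub>\<omega> \<circ> f\<close> a disc
  automorphism. Holomorphy can fail to continue only at a point that \<open>f\<close> sends to the royal
  variety, where \<open>\<Phi>\<^sub>\<omega>\<close> does not depend on \<open>\<omega>\<close>. Stationarity in \<open>\<omega>\<close> allows at most one such point, and
  an isolated singularity of a continuous function is removable. If \<open>f\<close> has only royal values, it is
  \<open>(2 u, u\<^sup>2)\<close> with a hyperbolic isometry \<open>u\<close>.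
\<close>

section \<open>The pseudohyperbolic distance\<close>

text \<open>The obstacle is the royal variety. At (0, 0) the functionals
  \<open>mlin 0 \<omega>\<close> trace a circle and the maximum of their moduli is |snd x| + |fst x|
  / 2. For this norm h \<mapsto> (2 t h, (1 - t) \<open>cnj\<close> h) with 0 < t < 1 is isometric
  without being linear or conjugate linear, so a single blow-up decides nothing there. Local
  rigidity is therefore proved only at the other points, where p is the leading coefficient of a
  polynomial in \<omega> and cannot vanish; royal points are crossed by analytic continuation. No
  derivative of f is available at the start, and derivatives at single points would not compare the
  orientation at neighbouring points. The blow-ups therefore let base point and scale vary together,
  b n \<rightarrow> a and \<epsilon> n \<rightarrow> 0, so that statements uniform near a follow by
  compactness. The Kobayashi distance enters only through two comparisons: a function into the disc
  pulls the Poincare distance back to a competitor in the supremum, and an analytic disc through two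
  points bounds their distance from above. The isometry hypothesis makes both sharp to first
  order.\<close>

definition disc_aut :: "complex \<Rightarrow> complex \<Rightarrow> complex"
  where "disc_aut a z = (z - a) / (1 - cnj a * z)"

lemma poincare_dist_disc_aut: "poincare_dist a b = artanh (cmod (disc_aut b a))"
  by (simp add: poincare_dist_def disc_aut_def)

lemma one_minus_nonzero:
  assumes "cmod a < 1" "cmod b \<le> 1"
  shows "1 - a * b \<noteq> 0"
proof
  assume "1 - a * b = 0"
  then have "cmod a * cmod b = 1" by (metis eq_iff_diff_eq_0 norm_mult norm_one)
  moreover have "cmod a * cmod b \<le> cmod a * 1" using assms by (intro mult_left_mono) auto
  ultimately show False using assms by simp
qed

lemma one_minus_cnj_nonzero:
  assumes "cmod a < 1" "cmod b < 1"
  shows "1 - cnj a * b \<noteq> 0"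
  using one_minus_nonzero[of "cnj a" b] assms by simp

lemma of_real_cmod_power2: "complex_of_real ((cmod z)\<^sup>2) = z * cnj z"
  by (rule complex_norm_square)

lemma disc_aut_identity:
  assumes "cmod a < 1" "cmod z < 1"
  shows "1 - (cmod (disc_aut a z))\<^sup>2 = (1 - (cmod a)\<^sup>2) * (1 - (cmod z)\<^sup>2) / (cmod (1 - cnj a * z))\<^sup>2"
proof -
  have nz: "1 - cnj a * z \<noteq> 0" using one_minus_cnj_nonzero assms by auto
  have "complex_of_real ((cmod (1 - cnj a * z))\<^sup>2 - (cmod (z - a))\<^sup>2) =
        complex_of_real ((1 - (cmod a)\<^sup>2) * (1 - (cmod z)\<^sup>2))"
    unfolding of_real_diff of_real_mult of_real_1 of_real_cmod_power2 by (simp add: algebra_simps)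
  then have "(cmod (1 - cnj a * z))\<^sup>2 - (cmod (z - a))\<^sup>2 = (1 - (cmod a)\<^sup>2) * (1 - (cmod z)\<^sup>2)"
    by (rule of_real_eq_iff[THEN iffD1])
  then show ?thesis using nz
    by (simp add: disc_aut_def norm_divide power_divide field_simps)
qed

lemma disc_aut_less_1:
  assumes "cmod a < 1" "cmod z < 1"
  shows "cmod (disc_aut a z) < 1"
  using Moebius_function_norm_lt_1[OF assms, of 0]
  by (simp add: disc_aut_def Moebius_function_simple)

lemma disc_aut_inverse:
  assumes "cmod a < 1" "cmod z < 1"
  shows "disc_aut (- a) (disc_aut a z) = z"
  using Moebius_function_compose[of "-a" a z] assms
  by (simp add: disc_aut_def Moebius_function_simple)

lemma disc_aut_inverse':
  assumes "cmod a < 1" "cmod z < 1"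
  shows "disc_aut a (disc_aut (- a) z) = z"
  using disc_aut_inverse[of "-a" z] assms by simp

lemma disc_aut_0 [simp]: "disc_aut 0 z = z" "disc_aut a a = 0" "disc_aut a 0 = - a"
  by (simp_all add: disc_aut_def)

lemma disc_aut_holomorphic:
  assumes "cmod a < 1"
  shows "disc_aut a holomorphic_on unit_disc"
  unfolding disc_aut_def using one_minus_cnj_nonzero[OF assms]
  by (intro holomorphic_intros) auto

lemma cmod_disc_aut_commute: "cmod (disc_aut a b) = cmod (disc_aut b a)"
proof -
  have "cmod (1 - cnj a * b) = cmod (cnj (1 - cnj a * b))" by (simp only: complex_mod_cnj)
  then show ?thesis by (simp add: disc_aut_def norm_divide norm_minus_commute mult.commute)
qed

lemma disc_aut_diff:
  assumes "cmod c < 1" "cmod a < 1" "cmod b < 1"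
  shows "disc_aut c a - disc_aut c b =
    (1 - c * cnj c) * (a - b) / ((1 - cnj c * a) * (1 - cnj c * b))"
  using one_minus_cnj_nonzero assms by (simp add: disc_aut_def field_simps)

lemma cmod_disc_aut_invariant:
  assumes "cmod c < 1" "cmod a < 1" "cmod b < 1"
  shows "cmod (disc_aut (disc_aut c b) (disc_aut c a)) = cmod (disc_aut b a)"
proof -
  have nz: "1 - cnj c * a \<noteq> 0" "1 - cnj c * b \<noteq> 0" "1 - cnj b * a \<noteq> 0" "1 - c * cnj b \<noteq> 0"
    "1 - c * cnj c \<noteq> 0"
    using one_minus_cnj_nonzero[of c a] one_minus_cnj_nonzero[of c b] one_minus_cnj_nonzero[of b a]
      one_minus_nonzero[of c "cnj b"] one_minus_nonzero[of c "cnj c"] assms by auto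
  have d: "1 - cnj (disc_aut c b) * disc_aut c a =
    (1 - c * cnj c) * (1 - cnj b * a) / ((1 - cnj c * a) * (1 - c * cnj b))"
  proof -
    have "1 - cnj (disc_aut c b) * disc_aut c a =
      ((1 - c * cnj b) * (1 - cnj c * a) - (cnj b - cnj c) * (a - c)) / ((1 - cnj c * a) * (1 - c * cnj b))"
      unfolding diff_divide_distrib using nz by (simp add: disc_aut_def mult.commute)
    also have "(1 - c * cnj b) * (1 - cnj c * a) - (cnj b - cnj c) * (a - c) =
      (1 - c * cnj c) * (1 - cnj b * a)" by (simp add: algebra_simps)
    finally show ?thesis .
  qed
  have e: "cmod (1 - cnj c * b) = cmod (1 - c * cnj b)"
    using complex_mod_cnj[of "1 - cnj c * b"] by simp
  have "disc_aut (disc_aut c b) (disc_aut c a) =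
     ((1 - c * cnj c) * (a - b) / ((1 - cnj c * a) * (1 - cnj c * b))) /
     ((1 - c * cnj c) * (1 - cnj b * a) / ((1 - cnj c * a) * (1 - c * cnj b)))"
    by (subst disc_aut_def) (simp add: d disc_aut_diff assms)
  also have "\<dots> = (a - b) * (1 - c * cnj b) / ((1 - cnj c * b) * (1 - cnj b * a))"
    using nz by (simp add: divide_simps)
  finally show ?thesis using nz e
    by (simp add: norm_divide norm_mult disc_aut_def)
qed

lemma artanh_mono_real:
  assumes "0 \<le> x" "x < y" "y < (1::real)"
  shows "artanh x < artanh y"
proof -
  have "(1 + x) / (1 - x) < (1 + y) / (1 - y)" using assms by (simp add: field_simps)
  then show ?thesis using assms by (simp add: artanh_def)
qed

lemma artanh_le_iff_real:
  assumes "0 \<le> x" "x < 1" "0 \<le> y" "y < (1::real)"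
  shows "artanh x \<le> artanh y \<longleftrightarrow> x \<le> y"
  using artanh_mono_real[of x y] artanh_mono_real[of y x] assms by force

lemma artanh_add_real:
  assumes "0 \<le> x" "x < 1" "0 \<le> y" "y < (1::real)"
  shows "artanh x + artanh y = artanh ((x + y) / (1 + x * y))"
proof -
  have p: "1 + x * y > 0" using assms by (simp add: add_pos_nonneg)
  define A B where "A = (1 + x) / (1 - x)" and "B = (1 + y) / (1 - y)"
  have AB: "A > 0" "B > 0" using assms by (auto simp: A_def B_def)
  have n: "1 + (x + y) / (1 + x * y) = (1 + x) * (1 + y) / (1 + x * y)"
    "1 - (x + y) / (1 + x * y) = (1 - x) * (1 - y) / (1 + x * y)"
    using p by (simp_all add: field_simps)
  have "(1 + (x + y) / (1 + x * y)) / (1 - (x + y) / (1 + x * y)) = A * B"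
    unfolding n A_def B_def using p by simp
  then have "artanh ((x + y) / (1 + x * y)) = ln (A * B) / 2" by (simp only: artanh_def)
  also have "\<dots> = ln A / 2 + ln B / 2" using AB by (simp only: ln_mult_pos add_divide_distrib)
  finally show ?thesis by (simp only: artanh_def A_def B_def)
qed

lemma poincare_dist_le_iff:
  assumes "cmod a < 1" "cmod b < 1" "cmod c < 1" "cmod d < 1"
  shows "poincare_dist a b \<le> poincare_dist c d \<longleftrightarrow> cmod (disc_aut b a) \<le> cmod (disc_aut d c)"
  unfolding poincare_dist_disc_aut
  using disc_aut_less_1 assms by (intro artanh_le_iff_real) auto

text \<open>\<open>disc_aut c\<close> moves \<open>c\<close> to 0. Then the right side is artanh of
  (|u| + |v|) / (1 + |u| |v|), and \<open>disc_aut_identity\<close> reduces the claim to comparing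
  denominators: |1 - \<open>cnj v * u\<close>| \<le> 1 + |u| |v|.\<close>

lemma poincare_dist_triangle:
  assumes "cmod a < 1" "cmod b < 1" "cmod c < 1"
  shows "poincare_dist a b \<le> poincare_dist a c + poincare_dist c b"
proof -
  define u v where "u = disc_aut c a" and "v = disc_aut c b"
  have uv: "cmod u < 1" "cmod v < 1" unfolding u_def v_def using disc_aut_less_1 assms by auto
  let ?t = "(cmod u + cmod v) / (1 + cmod u * cmod v)"
  have p: "1 + cmod u * cmod v > 0" by (simp add: add_pos_nonneg)
  have "(1 - cmod u) * (1 - cmod v) > 0" using uv by simp
  then have "cmod u + cmod v < 1 + cmod u * cmod v" by (simp add: algebra_simps)
  then have t1: "0 \<le> ?t" "?t < 1" using p by simp_all
  have le: "cmod (1 - cnj v * u) \<le> 1 + cmod u * cmod v"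
    using norm_triangle_ineq4[of 1 "cnj v * u"] by (simp add: norm_mult mult.commute)
  have nz: "cmod (1 - cnj v * u) > 0" using one_minus_cnj_nonzero uv by auto
  have num: "0 \<le> (1 - (cmod v)\<^sup>2) * (1 - (cmod u)\<^sup>2)"
    using uv by (intro mult_nonneg_nonneg) (auto simp: power_le_one)
  have "1 - ?t\<^sup>2 = (1 - (cmod v)\<^sup>2) * (1 - (cmod u)\<^sup>2) / (1 + cmod u * cmod v)\<^sup>2"
  proof -
    have "1 - ?t\<^sup>2 = ((1 + cmod u * cmod v)\<^sup>2 - (cmod u + cmod v)\<^sup>2) / (1 + cmod u * cmod v)\<^sup>2"
      using p unfolding power_divide diff_divide_distrib by simp
    also have "(1 + cmod u * cmod v)\<^sup>2 - (cmod u + cmod v)\<^sup>2 = (1 - (cmod v)\<^sup>2) * (1 - (cmod u)\<^sup>2)"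
      by (simp add: power2_eq_square algebra_simps)
    finally show ?thesis .
  qed
  also have "\<dots> \<le> (1 - (cmod v)\<^sup>2) * (1 - (cmod u)\<^sup>2) / (cmod (1 - cnj v * u))\<^sup>2"
    using nz le num p by (intro divide_left_mono power_mono mult_pos_pos zero_less_power) simp_all
  also have "\<dots> = 1 - (cmod (disc_aut v u))\<^sup>2" using disc_aut_identity uv by auto
  finally have "(cmod (disc_aut v u))\<^sup>2 \<le> ?t\<^sup>2" by simp
  then have "cmod (disc_aut v u) \<le> ?t" using t1 power2_le_imp_le by blast
  then have "artanh (cmod (disc_aut v u)) \<le> artanh ?t"
    using artanh_le_iff_real[of "cmod (disc_aut v u)" ?t] t1 disc_aut_less_1[OF uv(2,1)] by auto
  also have "\<dots> = artanh (cmod u) + artanh (cmod v)"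
    using artanh_add_real[of "cmod u" "cmod v"] uv by simp
  finally show ?thesis
    unfolding poincare_dist_disc_aut u_def v_def
      cmod_disc_aut_invariant[OF assms(3,1,2)] cmod_disc_aut_commute[of c b] .
qed

lemma Schwarz_Pick:
  assumes h: "h holomorphic_on unit_disc" and hd: "\<And>z. cmod z < 1 \<Longrightarrow> cmod (h z) < 1"
    and ab: "cmod a < 1" "cmod b < 1"
  shows "cmod (disc_aut (h b) (h a)) \<le> cmod (disc_aut b a)"
proof -
  define g where "g = (\<lambda>z. disc_aut (h b) (h (disc_aut (- b) z)))"
  have b': "cmod (- b) < 1" using ab by simp
  have "(h \<circ> disc_aut (- b)) ` unit_disc \<subseteq> unit_disc"
    using disc_aut_less_1[OF b'] hd by (simp add: image_subset_iff)
  then have "disc_aut (h b) \<circ> (h \<circ> disc_aut (- b)) holomorphic_on unit_disc"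
    using disc_aut_less_1[OF b']
    by (intro holomorphic_on_compose_gen[of _ _ _ unit_disc] h
        disc_aut_holomorphic[OF hd[OF ab(2)]] disc_aut_holomorphic[OF b'])
      (simp_all add: image_subset_iff)
  then have "g holomorphic_on unit_disc" by (simp add: g_def comp_def)
  moreover have "g 0 = 0" by (simp add: g_def)
  moreover have "\<And>z. cmod z < 1 \<Longrightarrow> cmod (g z) < 1"
    unfolding g_def by (intro disc_aut_less_1 hd ab b')
  ultimately have "cmod (g (disc_aut b a)) \<le> cmod (disc_aut b a)"
    by (intro Schwarz_Lemma(1) disc_aut_less_1 ab)
  then show ?thesis by (simp only: g_def disc_aut_inverse[OF ab(2,1)])
qed

section \<open>The symmetrized bidisc and its Kobayashi distance\<close>

abbreviation G2 :: "(complex \<times> complex) set"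
  where "G2 \<equiv> symmetrized_bidisc"

lemma symmetrized_bidisc_identity:
  "(1 - (cmod (z * w))\<^sup>2)\<^sup>2 - (cmod ((z + w) - cnj (z + w) * (z * w)))\<^sup>2 =
   (1 - (cmod z)\<^sup>2) * (1 - (cmod w)\<^sup>2) * (cmod (1 - cnj z * w))\<^sup>2"
proof -
  have "complex_of_real ((1 - (cmod (z * w))\<^sup>2)\<^sup>2 - (cmod ((z + w) - cnj (z + w) * (z * w)))\<^sup>2) =
    complex_of_real ((1 - (cmod z)\<^sup>2) * (1 - (cmod w)\<^sup>2) * (cmod (1 - cnj z * w))\<^sup>2)"
    unfolding of_real_diff of_real_mult of_real_power[of "1 - _"] of_real_1 of_real_cmod_power2
    by (simp add: algebra_simps power2_eq_square)
  then show ?thesis by (rule of_real_eq_iff[THEN iffD1])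
qed

lemma root_pair_exists:
  obtains z w :: complex where "s = z + w" "p = z * w"
proof (rule that[of "(s + csqrt (s\<^sup>2 - 4 * p)) / 2" "(s - csqrt (s\<^sup>2 - 4 * p)) / 2"])
  have "csqrt (s\<^sup>2 - 4 * p) * csqrt (s\<^sup>2 - 4 * p) = s\<^sup>2 - 4 * p"
    by (metis power2_csqrt power2_eq_square)
  then show "p = (s + csqrt (s\<^sup>2 - 4 * p)) / 2 * ((s - csqrt (s\<^sup>2 - 4 * p)) / 2)"
    by (simp add: algebra_simps power2_eq_square)
qed (simp add: field_simps)

text \<open>For roots z, w the difference of the squares of the two sides is (1 - |z|^2) (1 - |w|^2)
  |1 - \<open>cnj z * w\<close>|^2. If it is positive, the first two factors have the same sign, and
  both negative is excluded by |p| = |z| |w| < 1. The criterion avoids the roots, which yields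
  openness of \<open>G2\<close> and the bound for \<open>magic\<close>.\<close>

lemma mem_G2_iff: "(s, p) \<in> G2 \<longleftrightarrow> cmod (s - cnj s * p) < 1 - (cmod p)\<^sup>2"
proof -
  obtain z w where zw: "s = z + w" "p = z * w" by (rule root_pair_exists)
  let ?R = "(1 - (cmod z)\<^sup>2) * (1 - (cmod w)\<^sup>2) * (cmod (1 - cnj z * w))\<^sup>2"
  have id: "(1 - (cmod p)\<^sup>2)\<^sup>2 - (cmod (s - cnj s * p))\<^sup>2 = ?R"
    unfolding zw by (rule symmetrized_bidisc_identity)
  show ?thesis
  proof
    assume "(s, p) \<in> G2"
    then obtain z' w' where *: "s = z' + w'" "p = z' * w'" "cmod z' < 1" "cmod w' < 1"
      by (auto simp: symmetrized_bidisc_def)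
    have "(1 - (cmod z')\<^sup>2) * (1 - (cmod w')\<^sup>2) * (cmod (1 - cnj z' * w'))\<^sup>2 > 0"
      using * one_minus_cnj_nonzero[of z' w'] by (intro mult_pos_pos) (auto simp: abs_square_less_1)
    then have "(cmod (s - cnj s * p))\<^sup>2 < (1 - (cmod p)\<^sup>2)\<^sup>2"
      using symmetrized_bidisc_identity[of z' w'] unfolding * by linarith
    moreover have "cmod p < 1"
      using * mult_strict_mono'[of "cmod z'" 1 "cmod w'" 1] by (simp add: norm_mult)
    then have "0 \<le> 1 - (cmod p)\<^sup>2" by (simp add: power_le_one)
    ultimately show "cmod (s - cnj s * p) < 1 - (cmod p)\<^sup>2"
      using power2_less_imp_less by blast
  next
    assume lt: "cmod (s - cnj s * p) < 1 - (cmod p)\<^sup>2"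
    then have "(cmod (s - cnj s * p))\<^sup>2 < (1 - (cmod p)\<^sup>2)\<^sup>2"
      by (intro power_strict_mono) auto
    then have R: "?R > 0" using id by linarith
    have nn: "(cmod (1 - cnj z * w))\<^sup>2 \<ge> 0" by simp
    have "0 < 1 - (cmod p)\<^sup>2" using lt norm_ge_zero[of "s - cnj s * p"] by linarith
    then have p1: "cmod z * cmod w < 1" by (simp add: zw norm_mult abs_square_less_1)
    have sgn: "(1 - (cmod z)\<^sup>2) * (1 - (cmod w)\<^sup>2) > 0"
      using R nn zero_less_mult_pos2 by (metis less_eq_real_def mult_zero_right less_irrefl)
    have "cmod z < 1"
    proof (rule ccontr)
      assume "\<not> cmod z < 1"
      then have z: "1 \<le> (cmod z)\<^sup>2" by simp
      then have w: "(cmod w)\<^sup>2 > 1" using sgn by (smt (verit) mult_nonneg_nonpos2 mult_nonneg_nonpos)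
      then have "cmod w > 1" by (metis norm_ge_zero one_power2 power2_less_imp_less)
      then have "cmod z * cmod w \<ge> 1 * 1" using \<open>\<not> cmod z < 1\<close> by (intro mult_mono) auto
      then show False using p1 by simp
    qed
    moreover have "cmod w < 1"
    proof -
      have "1 - (cmod z)\<^sup>2 > 0" using calculation by (simp add: abs_square_less_1)
      then have "1 - (cmod w)\<^sup>2 > 0" using sgn zero_less_mult_pos by blast
      then show ?thesis by (simp add: abs_square_less_1)
    qed
    ultimately show "(s, p) \<in> G2" using zw by (auto simp: symmetrized_bidisc_def)
  qed
qed

lemma open_G2: "open G2"
proof -
  have eq: "G2 = {x. cmod (fst x - cnj (fst x) * snd x) < 1 - (cmod (snd x))\<^sup>2}"
    using mem_G2_iff by auto
  show ?thesis unfolding eq by (intro open_Collect_less continuous_intros)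
qed

lemma G2_bounds:
  assumes "(s, p) \<in> G2"
  shows "cmod p < 1" "cmod s < 2"
proof -
  obtain z w where *: "s = z + w" "p = z * w" "cmod z < 1" "cmod w < 1"
    using assms by (auto simp: symmetrized_bidisc_def)
  show "cmod p < 1"
    using * mult_strict_mono'[of "cmod z" 1 "cmod w" 1] by (simp add: norm_mult)
  show "cmod s < 2" using norm_triangle_ineq[of z w] * by simp
qed

text \<open>For \<open>\<omega>\<close> on the unit circle these are the universal Caratheodory functions of Agler and Young.\<close>

definition magic :: "complex \<Rightarrow> complex \<times> complex \<Rightarrow> complex"
  where "magic \<omega> x = (2 * \<omega> * snd x - fst x) / (2 - \<omega> * fst x)"

lemma magic_denominator:
  assumes "x \<in> G2" "cmod \<omega> = 1"
  shows "2 - \<omega> * fst x \<noteq> 0"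
proof
  assume "2 - \<omega> * fst x = 0"
  then have "cmod \<omega> * cmod (fst x) = 2" by (metis eq_iff_diff_eq_0 norm_mult norm_numeral)
  then show False using assms G2_bounds(2)[of "fst x" "snd x"] by simp
qed

lemma cmod_diff_power2: "(cmod (a - b))\<^sup>2 = (cmod a)\<^sup>2 + (cmod b)\<^sup>2 - 2 * Re (a * cnj b)"
  unfolding cmod_power2 by (simp add: power2_eq_square algebra_simps)

lemma Re_2: "Re (2 * z) = 2 * Re z" by simp

lemma Re_2_cnj: "Re (2 * cnj z) = 2 * Re z" by simp

text \<open>|denominator|^2 - |numerator|^2 equals 4 (1 - |p|^2 - Re (\<omega> (s -
  \<open>cnj s * p\<close>))), which is positive by \<open>mem_G2_iff\<close>.\<close>

lemma magic_less_1:
  assumes "x \<in> G2" "cmod \<omega> = 1"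
  shows "cmod (magic \<omega> x) < 1"
proof -
  obtain s p where x: "x = (s, p)" by (cases x)
  define R where "R = Re (\<omega> * (s - cnj s * p))"
  have "R \<le> cmod (\<omega> * (s - cnj s * p))" unfolding R_def by (rule complex_Re_le_cmod)
  also have "\<dots> < 1 - (cmod p)\<^sup>2" using assms x mem_G2_iff by (simp add: norm_mult)
  finally have lt: "0 < 1 - (cmod p)\<^sup>2 - R" by simp
  have 1: "(cmod (2 - \<omega> * s))\<^sup>2 = 4 + (cmod s)\<^sup>2 - 4 * Re (\<omega> * s)"
    using assms(2) cmod_diff_power2[of 2 "\<omega> * s"] Re_2_cnj by (simp only: norm_mult) simp
  have 2: "(cmod (2 * \<omega> * p - s))\<^sup>2 = 4 * (cmod p)\<^sup>2 + (cmod s)\<^sup>2 - 4 * Re (\<omega> * (cnj s * p))"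
  proof -
    have "Re (2 * \<omega> * p * cnj s) = Re (2 * (\<omega> * (cnj s * p)))" by (simp only: mult_ac)
    also have "\<dots> = 2 * Re (\<omega> * (cnj s * p))" by (rule Re_2)
    finally have "Re (2 * \<omega> * p * cnj s) = 2 * Re (\<omega> * (cnj s * p))" .
    then show ?thesis
      using assms(2) cmod_diff_power2[of "2 * \<omega> * p" s] by (simp only: norm_mult) (simp add: power_mult_distrib)
  qed
  have 3: "Re (\<omega> * (s - cnj s * p)) = Re (\<omega> * s) - Re (\<omega> * (cnj s * p))"
    by (simp only: right_diff_distrib minus_complex.sel)
  have "(cmod (2 - \<omega> * s))\<^sup>2 - (cmod (2 * \<omega> * p - s))\<^sup>2 =
    4 * (1 - (cmod p)\<^sup>2 - R)"
    unfolding R_def 1 2 3 by (simp only: right_diff_distrib)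
  then have "0 < (cmod (2 - \<omega> * s))\<^sup>2 - (cmod (2 * \<omega> * p - s))\<^sup>2"
    using lt by (simp only: mult_pos_pos zero_less_numeral)
  then have "(cmod (2 * \<omega> * p - s))\<^sup>2 < (cmod (2 - \<omega> * s))\<^sup>2" by (simp only: diff_gt_0_iff_gt)
  then have "cmod (2 * \<omega> * p - s) < cmod (2 - \<omega> * s)" by (simp add: power_less_imp_less_base)
  then show ?thesis using magic_denominator[OF assms] x by (simp add: magic_def norm_divide)
qed

text \<open>By Schwarz-Pick the pullback of \<open>poincare_dist\<close> along \<open>F\<close> is
  one of the pseudodistances in the supremum. Holomorphy of \<open>F\<close> matters only along
  analytic discs and is required in this form, so no notion of holomorphy in two variables
  enters.\<close>

lemma kobayashi_lower_bound:
  assumes FD: "\<And>x. x \<in> G2 \<Longrightarrow> cmod (F x) < 1"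
    and hol: "\<And>\<phi>. holomorphic_map_on \<phi> unit_disc \<Longrightarrow> \<phi> ` unit_disc \<subseteq> G2 \<Longrightarrow>
                (\<lambda>z. F (\<phi> z)) holomorphic_on unit_disc"
    and xy: "x \<in> G2" "y \<in> G2"
  shows "poincare_dist (F x) (F y) \<le> kobayashi_dist G2 x y"
proof -
  define d where "d = (\<lambda>x y. poincare_dist (F x) (F y))"
  have "pseudodistance_on G2 d"
    unfolding pseudodistance_on_def d_def
  proof (intro conjI ballI)
    fix x y z assume G: "x \<in> G2" "y \<in> G2" "z \<in> G2"
    show "poincare_dist (F x) (F z) \<le> poincare_dist (F x) (F y) + poincare_dist (F y) (F z)"
      using poincare_dist_triangle FD G by blast
  next
    fix x y assume G: "x \<in> G2" "y \<in> G2"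
    show "0 \<le> poincare_dist (F x) (F y)" using poincare_dist_nonneg FD G by auto
    show "poincare_dist (F x) (F y) = poincare_dist (F y) (F x)"
      by (simp add: poincare_dist_disc_aut cmod_disc_aut_commute)
  qed (simp add: poincare_dist_disc_aut)
  moreover have "disc_contractive G2 d"
    unfolding disc_contractive_def d_def
  proof (intro allI impI ballI)
    fix \<phi> a b assume \<phi>: "holomorphic_map_on \<phi> unit_disc \<and> \<phi> ` unit_disc \<subseteq> G2"
      and ab: "a \<in> unit_disc" "b \<in> unit_disc"
    have *: "\<And>z. cmod z < 1 \<Longrightarrow> cmod (F (\<phi> z)) < 1" using FD \<phi> by (auto simp: image_subset_iff)
    show "poincare_dist (F (\<phi> a)) (F (\<phi> b)) \<le> poincare_dist a b"
    proof (subst poincare_dist_le_iff)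
      show "cmod (disc_aut (F (\<phi> b)) (F (\<phi> a))) \<le> cmod (disc_aut b a)"
        using ab by (intro Schwarz_Pick[of "\<lambda>z. F (\<phi> z)" a b] hol conjunct1[OF \<phi>] conjunct2[OF \<phi>] *) simp_all
    qed (use ab in \<open>simp_all add: *\<close>)
  qed
  ultimately show ?thesis
    using kobayashi_dist_symmetrized_bidisc(3)[of d x y] xy by (simp add: d_def)
qed

lemma kobayashi_upper_bound:
  assumes "holomorphic_map_on \<phi> unit_disc" "\<phi> ` unit_disc \<subseteq> G2" "cmod a < 1" "cmod b < 1"
  shows "kobayashi_dist G2 (\<phi> a) (\<phi> b) \<le> poincare_dist a b"
  using kobayashi_dist_symmetrized_bidisc(2) assms unfolding disc_contractive_def by auto

lemma kobayashi_magic_le: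
  assumes "x \<in> G2" "y \<in> G2" "cmod \<omega> = 1"
  shows "poincare_dist (magic \<omega> x) (magic \<omega> y) \<le> kobayashi_dist G2 x y"
proof (rule kobayashi_lower_bound)
  fix \<phi> assume \<phi>: "holomorphic_map_on \<phi> unit_disc" "\<phi> ` unit_disc \<subseteq> G2"
  have "2 - \<omega> * fst (\<phi> z) \<noteq> 0" if "z \<in> unit_disc" for z
    using magic_denominator[of "\<phi> z"] \<phi>(2) that assms(3) by blast
  then show "(\<lambda>z. magic \<omega> (\<phi> z)) holomorphic_on unit_disc"
    using \<phi>(1) unfolding magic_def holomorphic_map_on_def
    by (intro holomorphic_intros) blast+
qed (use assms magic_less_1 in auto)

section \<open>Isometric embeddings of the plane into the tangent space\<close>

text \<open>As \<omega> runs through the unit circle this traces an ellipse with semiaxes 1 - |p|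
  and 1 + |p|.\<close>

definition ell :: "complex \<Rightarrow> complex \<Rightarrow> complex"
  where "ell p \<omega> = cnj \<omega> - p * \<omega>"

text \<open>The tangent of the ellipse turned by a right angle: the derivative of
  \<open>ell p (\<omega> * cis \<theta>)\<close> in \<theta> at 0 is - \<i> times this
  number.\<close>

definition ell' :: "complex \<Rightarrow> complex \<Rightarrow> complex"
  where "ell' p \<omega> = cnj \<omega> + p * \<omega>"

text \<open>Up to the factor \<open>\<omega>\<close>, \<^term>\<open>mlin p \<omega>\<close> is the derivative of the magic function at \<open>(0, p)\<close>.\<close>

definition mlin :: "complex \<Rightarrow> complex \<Rightarrow> complex \<times> complex \<Rightarrow> complex"
  where "mlin p \<omega> x = snd x - fst x / 2 * ell p \<omega>"

lemma mlin_diff: "mlin p \<omega> (x - y) = mlin p \<omega> x - mlin p \<omega> y"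
  by (simp add: mlin_def algebra_simps diff_divide_distrib)

lemma mlin_0 [simp]: "mlin p \<omega> 0 = 0"
  by (simp add: mlin_def)

lemma unit_cnj: "cmod w = 1 \<Longrightarrow> w * cnj w = 1" "cmod w = 1 \<Longrightarrow> cnj w * w = 1"
  using complex_norm_square[of w] by (simp_all add: mult.commute)

lemma ell'_nonzero:
  assumes "cmod p < 1" "cmod \<omega> = 1"
  shows "ell' p \<omega> \<noteq> 0"
proof
  assume "ell' p \<omega> = 0"
  then have "cnj \<omega> = - (p * \<omega>)" by (simp add: ell'_def eq_neg_iff_add_eq_0)
  then have "cmod \<omega> = cmod p * cmod \<omega>" by (metis complex_mod_cnj norm_minus_cancel norm_mult)
  then show False using assms by simp
qed

lemma ell_inj:
  assumes "cmod p < 1" "ell p \<omega> = ell p \<omega>'"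
  shows "\<omega> = \<omega>'"
proof -
  have "cnj (\<omega> - \<omega>') = p * (\<omega> - \<omega>')" using assms(2) by (simp add: ell_def algebra_simps)
  then have "cmod (\<omega> - \<omega>') = cmod p * cmod (\<omega> - \<omega>')" by (metis complex_mod_cnj norm_mult)
  then show ?thesis using assms(1) by simp
qed

lemma mlin_rotate:
  "mlin p (\<omega> * cis \<theta>) x = snd x
    + (fst x / 2 * p * \<omega> - fst x / 2 * cnj \<omega>) * cos \<theta> + \<i> * (fst x / 2 * ell' p \<omega>) * sin \<theta>"
proof -
  have "cis \<theta> = complex_of_real (cos \<theta>) + \<i> * complex_of_real (sin \<theta>)"
    "cnj (cis \<theta>) = complex_of_real (cos \<theta>) - \<i> * complex_of_real (sin \<theta>)"
    by (simp_all add: complex_eq_iff)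
  then show ?thesis
    unfolding mlin_def ell_def ell'_def complex_cnj_mult by (simp add: algebra_simps)
qed

text \<open>The derivative of \<open>mlin p (\<omega> * cis \<theta>) x\<close> in \<theta> at 0 is
  \<i> times \<open>fst x / 2 * ell' p \<omega>\<close>. At a maximum of the modulus it is
  orthogonal to the value. This confines \<open>fst x\<close> to a real line once the phase of the
  maximal value is known.\<close>

lemma mlin_stationary:
  assumes \<omega>: "cmod \<omega> = 1"
    and max: "\<And>\<omega>'. cmod \<omega>' = 1 \<Longrightarrow> cmod (mlin p \<omega>' x) \<le> cmod (mlin p \<omega> x)"
  shows "Im (cnj (mlin p \<omega> x) * (fst x / 2 * ell' p \<omega>)) = 0"
proof -
  define P a b where "P = snd x" and "a = fst x / 2 * p * \<omega> - fst x / 2 * cnj \<omega>"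
    and "b = fst x / 2 * ell' p \<omega>"
  \<comment> \<open>The squared modulus in real coordinates, so that an ordinary real derivative can
    be taken.\<close>
  define u where "u = (\<lambda>\<theta>. (Re P + Re a * cos \<theta> - Im b * sin \<theta>)\<^sup>2 + (Im P + Im a * cos \<theta> + Re b * sin \<theta>)\<^sup>2)"
  have u: "u \<theta> = (cmod (mlin p (\<omega> * cis \<theta>) x))\<^sup>2" for \<theta>
    unfolding mlin_rotate u_def cmod_power2 P_def[symmetric] a_def[symmetric] b_def[symmetric] by simp
  have le: "u \<theta> \<le> u 0" for \<theta>
    unfolding u using max[of "\<omega> * cis \<theta>"] \<omega> by (simp add: norm_mult)
  have mp: "mlin p \<omega> x = P + a" using mlin_rotate[of p \<omega> 0 x] by (simp add: P_def a_def)
  have "(u has_real_derivative (- 2 * (Re P + Re a) * Im b + 2 * (Im P + Im a) * Re b)) (at 0)"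
    unfolding u_def by (auto intro!: derivative_eq_intros simp: algebra_simps)
  then have "- 2 * (Re P + Re a) * Im b + 2 * (Im P + Im a) * Re b = 0"
    using DERIV_local_max[of u _ 0 1] le by auto
  then show ?thesis unfolding mp b_def[symmetric] by (simp add: algebra_simps)
qed

lemma Re_Im_complex_of_real_mult:
  "Re (complex_of_real r * z) = r * Re z" "Im (complex_of_real r * z) = r * Im z"
  by simp_all

lemma eq_of_Re_cnj_mult:
  assumes "cmod \<tau> = 1" "Re (cnj \<tau> * D) = r" "cmod D \<le> \<bar>r\<bar>"
  shows "D = of_real r * \<tau>"
proof -
  define w where "w = cnj \<tau> * D"
  have D: "D = \<tau> * w" using unit_cnj[OF assms(1)] by (simp add: w_def mult.assoc[symmetric])
  have "(cmod w)\<^sup>2 \<le> \<bar>r\<bar>\<^sup>2" using assms by (intro power_mono) (simp_all add: w_def norm_mult)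
  then have "(Re w)\<^sup>2 + (Im w)\<^sup>2 \<le> r\<^sup>2" by (simp add: cmod_power2)
  moreover have Re: "Re w = r" using assms(2) by (simp add: w_def)
  ultimately have "Im w = 0" by simp
  then have "w = of_real r" using Re by (simp add: complex_eq_iff)
  then show ?thesis using D by simp
qed

lemma real_multiple_of_Im_cnj:
  assumes "cmod \<tau> = 1" "Im (cnj \<tau> * D) = 0"
  shows "D = of_real (Re (cnj \<tau> * D)) * \<tau>"
proof -
  have "cnj \<tau> * D = of_real (Re (cnj \<tau> * D))" using assms(2) by (simp add: complex_eq_iff)
  then have "\<tau> * (cnj \<tau> * D) = of_real (Re (cnj \<tau> * D)) * \<tau>" by (metis mult.commute)
  then show ?thesis using unit_cnj(1)[OF assms(1)] by (metis mult.assoc mult_1)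
qed

lemma zero_of_Re_cnj_mult:
  assumes "Re (cnj v * w) = 0" "Re (cnj v' * w) = 0" "Im (cnj v * v') \<noteq> 0"
  shows "w = 0"
proof -
  have 1: "Re v * Re w + Im v * Im w = 0" and 2: "Re v' * Re w + Im v' * Im w = 0"
    and 3: "Re v * Im v' - Im v * Re v' \<noteq> 0" using assms by simp_all
  have "(Re v * Im v' - Im v * Re v') * Re w =
      Im v' * (Re v * Re w + Im v * Im w) - Im v * (Re v' * Re w + Im v' * Im w)"
    "(Re v * Im v' - Im v * Re v') * Im w =
      Re v * (Re v' * Re w + Im v' * Im w) - Re v' * (Re v * Re w + Im v * Im w)"
    by (simp_all add: algebra_simps)
  then have "(Re v * Im v' - Im v * Re v') * Re w = 0" "(Re v * Im v' - Im v * Re v') * Im w = 0"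
    using 1 2 by simp_all
  then show ?thesis using 3 by (simp add: complex_eq_iff)
qed

text \<open>The parallelogram law: two points of a disc of radius r at distance 2 r are the ends of
  a diameter.\<close>

lemma antipodal_of_cmod_diff:
  assumes "cmod a \<le> r" "cmod b \<le> r" "cmod (a - b) = 2 * r"
  shows "b = - a" "cmod a = r"
proof -
  have par: "(cmod (a + b))\<^sup>2 + (cmod (a - b))\<^sup>2 = 2 * (cmod a)\<^sup>2 + 2 * (cmod b)\<^sup>2"
    unfolding cmod_power2 by (simp add: power2_eq_square algebra_simps)
  have r: "0 \<le> r" using assms(1) norm_ge_zero[of a] by linarith
  have "(cmod a)\<^sup>2 \<le> r\<^sup>2" "(cmod b)\<^sup>2 \<le> r\<^sup>2" using assms by (auto intro: power_mono)
  moreover have "(cmod (a - b))\<^sup>2 = 4 * r\<^sup>2" by (simp add: assms(3) power_mult_distrib)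
  ultimately have "(cmod (a + b))\<^sup>2 \<le> 0" using par by linarith
  then have "a + b = 0" by simp
  then show b: "b = - a" by (simp add: eq_neg_iff_add_eq_0 add.commute)
  have "cmod (a - b) = 2 * cmod a" unfolding b by (metis diff_minus_eq_add mult_2 norm_mult norm_numeral)
  then show "cmod a = r" using assms(3) by simp
qed

text \<open>
  A function that is contractive and takes antipodal values at \<open>\<plusminus>n v\<close> is, up to an error that
  vanishes as \<open>n\<close> grows, determined in the direction of these values (as for Busemann functions).
\<close>

lemma Busemann_estimate:
  assumes n: "n > 0" and N: "N > 0" and v: "cmod v = 1" and \<tau>: "cmod \<tau> = 1"
    and le: "cmod (g - of_real (n * N) * \<tau>) \<le> N * cmod (h - of_real n * v)"
      "cmod (g + of_real (n * N) * \<tau>) \<le> N * cmod (h + of_real n * v)"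
  shows "\<bar>Re (cnj \<tau> * g) - N * Re (cnj v * h)\<bar> \<le> N * (cmod h)\<^sup>2 / (2 * n)"
proof -
  have ex: "(cmod (x + of_real s * w))\<^sup>2 = (cmod x)\<^sup>2 + 2 * s * Re (cnj w * x) + s\<^sup>2" if "cmod w = 1" for x w s
  proof -
    have "(Re w)\<^sup>2 + (Im w)\<^sup>2 = 1" using that cmod_power2[of w] by simp
    moreover have "(cmod (x + of_real s * w))\<^sup>2 = (cmod x)\<^sup>2 + 2 * s * Re (cnj w * x) + s\<^sup>2 * ((Re w)\<^sup>2 + (Im w)\<^sup>2)"
      unfolding cmod_power2 by (simp add: power2_eq_square algebra_simps)
    ultimately show ?thesis by simp
  qed
  define A B where "A = Re (cnj \<tau> * g)" and "B = Re (cnj v * h)"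
  \<comment> \<open>After squaring, the terms n^2 N^2 on the two sides cancel and the next ones are
    linear in n. Division by \<open>n * N\<close> therefore leaves an error of order 1 / n.\<close>
  have "(cmod (g - of_real (n * N) * \<tau>))\<^sup>2 \<le> (N * cmod (h - of_real n * v))\<^sup>2"
    "(cmod (g + of_real (n * N) * \<tau>))\<^sup>2 \<le> (N * cmod (h + of_real n * v))\<^sup>2"
    using le by (auto intro: power_mono)
  then have 1: "(cmod g)\<^sup>2 - 2 * (n * N) * A + (n * N)\<^sup>2 \<le> N\<^sup>2 * ((cmod h)\<^sup>2 - 2 * n * B + n\<^sup>2)"
    and 2: "(cmod g)\<^sup>2 + 2 * (n * N) * A + (n * N)\<^sup>2 \<le> N\<^sup>2 * ((cmod h)\<^sup>2 + 2 * n * B + n\<^sup>2)"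
    using ex[OF \<tau>, of g "n * N"] ex[OF \<tau>, of g "- (n * N)"] ex[OF v, of h n] ex[OF v, of h "- n"]
    by (simp_all add: power_mult_distrib A_def B_def)
  have g0: "0 \<le> (cmod g)\<^sup>2" by simp
  have h: "n * N * (N * (cmod h)\<^sup>2 / n) = N\<^sup>2 * (cmod h)\<^sup>2" using n by (simp add: power2_eq_square)
  have i: "(n * N)\<^sup>2 = N\<^sup>2 * n\<^sup>2" by (simp add: power_mult_distrib)
  have "n * N * (2 * (N * B - A)) = N\<^sup>2 * (2 * n * B) - 2 * (n * N) * A"
    by (simp add: power2_eq_square algebra_simps)
  also have "\<dots> \<le> N\<^sup>2 * (cmod h)\<^sup>2" using 1 g0 unfolding i right_diff_distrib distrib_left by linarith
  finally have "n * N * (2 * (N * B - A)) \<le> n * N * (N * (cmod h)\<^sup>2 / n)" unfolding h .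
  then have a: "2 * (N * B - A) \<le> N * (cmod h)\<^sup>2 / n" using n N mult_le_cancel_left_pos[of "n * N"] by (metis mult_pos_pos)
  have "n * N * (2 * (A - N * B)) = 2 * (n * N) * A - N\<^sup>2 * (2 * n * B)"
    by (simp add: power2_eq_square algebra_simps)
  also have "\<dots> \<le> N\<^sup>2 * (cmod h)\<^sup>2" using 2 g0 unfolding i right_diff_distrib distrib_left by linarith
  finally have "n * N * (2 * (A - N * B)) \<le> n * N * (N * (cmod h)\<^sup>2 / n)" unfolding h .
  then have b: "2 * (A - N * B) \<le> N * (cmod h)\<^sup>2 / n" using n N mult_le_cancel_left_pos[of "n * N"] by (metis mult_pos_pos)
  have "N * (cmod h)\<^sup>2 / (2 * n) = (N * (cmod h)\<^sup>2 / n) / 2" by simp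
  moreover have "x \<le> c / 2" if "2 * x \<le> c" for x c :: real using that by linarith
  ultimately have "A - N * B \<le> N * (cmod h)\<^sup>2 / (2 * n)" "N * B - A \<le> N * (cmod h)\<^sup>2 / (2 * n)"
    using a b by presburger+
  then show ?thesis unfolding A_def[symmetric] B_def[symmetric] by (simp only: abs_le_iff minus_diff_eq)
qed

section \<open>Identities on infinitely many points of the unit circle as polynomial
  identities\<close>

lemma infinite_quartic_roots:
  fixes c0 :: complex
  assumes "infinite W" "\<And>\<omega>. \<omega> \<in> W \<Longrightarrow> c0 + c1 * \<omega> + c2 * \<omega>^2 + c3 * \<omega>^3 + c4 * \<omega>^4 = 0"
  shows "c0 = 0" "c1 = 0" "c2 = 0" "c3 = 0" "c4 = 0"
proof -
  let ?q = "[:c0, c1, c2, c3, c4:]"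
  have "W \<subseteq> {\<omega>. poly ?q \<omega> = 0}"
    using assms(2) by (auto simp: algebra_simps power2_eq_square power3_eq_cube power4_eq_xxxx)
  then have "?q = 0" using assms(1) poly_roots_finite finite_subset by blast
  then show "c0 = 0" "c1 = 0" "c2 = 0" "c3 = 0" "c4 = 0" by simp_all
qed

text \<open>On the unit circle \<open>cnj \<omega>\<close> is the inverse of \<omega>, so the factor
  \<open>\<omega>\<^sup>2\<close> turns expressions in \<open>ell p \<omega>\<close> and its
  conjugate into polynomials of degree at most 4. An identity on infinitely many \<omega> can then
  be read off coefficientwise.\<close>

lemma ell_quartic:
  assumes w: "cmod \<omega> = 1"
  shows "\<omega>\<^sup>2 * ell p \<omega> = \<omega> - p * \<omega>^3"
    "\<omega>\<^sup>2 * cnj (ell p \<omega>) = \<omega>^3 - cnj p * \<omega>"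
    "\<omega>\<^sup>2 * (ell p \<omega> * cnj (ell p \<omega>)) = (1 + p * cnj p) * \<omega>\<^sup>2 - cnj p - p * \<omega>^4"
proof -
  define u where "u = cnj \<omega>"
  have c: "\<omega> * u = 1" unfolding u_def by (rule unit_cnj[OF w])
  have l: "ell p \<omega> = u - p * \<omega>" "cnj (ell p \<omega>) = \<omega> - cnj p * u" by (simp_all add: ell_def u_def)
  show "\<omega>\<^sup>2 * ell p \<omega> = \<omega> - p * \<omega>^3" "\<omega>\<^sup>2 * cnj (ell p \<omega>) = \<omega>^3 - cnj p * \<omega>"
    "\<omega>\<^sup>2 * (ell p \<omega> * cnj (ell p \<omega>)) = (1 + p * cnj p) * \<omega>\<^sup>2 - cnj p - p * \<omega>^4"
    unfolding l(2) unfolding l(1) using c by algebra+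
qed

text \<open>The ellipse traced by \<^term>\<open>ell p\<close> is not a circle, as \<open>p \<noteq> 0\<close>; so the inscribed angle
  over a chord is not constant on any infinite set of points.\<close>

lemma inscribed_angle_not_constant:
  assumes p: "cmod p < 1" "p \<noteq> 0" and K: "K \<noteq> 0" and E: "E1 \<noteq> E2"
    and W: "infinite W" "\<And>\<omega>. \<omega> \<in> W \<Longrightarrow> cmod \<omega> = 1"
    and Im: "\<And>\<omega>. \<omega> \<in> W \<Longrightarrow> Im (K * (ell p \<omega> - E1) * cnj (E2 - ell p \<omega>)) = 0"
  shows False
proof -
  \<comment> \<open>The coefficients of \<open>ell p \<omega>\<close>, of its conjugate and of 1
    when twice the imaginary part in question is expanded.\<close>
  define u w where "u = K * cnj E2 - cnj K * cnj E1" and "w = K * E1 - cnj K * E2"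
  define c where "c = cnj K * cnj E1 * E2 - K * E1 * cnj E2"
  have eq: "(K - cnj K) * cnj p + (u - cnj p * w) * \<omega> + (c - (K - cnj K) * (1 + p * cnj p)) * \<omega>^2
     + (w - p * u) * \<omega>^3 + (K - cnj K) * p * \<omega>^4 = 0" if "\<omega> \<in> W" for \<omega>
  proof -
    define X where "X = K * (ell p \<omega> - E1) * cnj (E2 - ell p \<omega>)"
    have "Im X = 0" unfolding X_def by (rule Im[OF that])
    then have "X - cnj X = 0" by (simp add: complex_eq_iff)
    moreover have "X - cnj X = ell p \<omega> * u + cnj (ell p \<omega>) * w - (K - cnj K) * (ell p \<omega> * cnj (ell p \<omega>)) + c"
      unfolding X_def u_def w_def c_def by (simp add: algebra_simps)
    ultimately have "\<omega>\<^sup>2 * (ell p \<omega> * u + cnj (ell p \<omega>) * w - (K - cnj K) * (ell p \<omega> * cnj (ell p \<omega>)) + c) = 0"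
      by simp
    also have "\<omega>\<^sup>2 * (ell p \<omega> * u + cnj (ell p \<omega>) * w - (K - cnj K) * (ell p \<omega> * cnj (ell p \<omega>)) + c) =
      (\<omega>\<^sup>2 * ell p \<omega>) * u + (\<omega>\<^sup>2 * cnj (ell p \<omega>)) * w
      - (K - cnj K) * (\<omega>\<^sup>2 * (ell p \<omega> * cnj (ell p \<omega>))) + \<omega>\<^sup>2 * c"
      by (simp add: algebra_simps)
    finally show ?thesis unfolding ell_quartic[OF W(2)[OF that]] by (simp add: algebra_simps)
  qed
  \<comment> \<open>The leading coefficient makes \<open>K\<close> real. Then the cubic one says E1
    - E2 = - p \<open>cnj\<close> (E1 - E2), impossible for E1 \<noteq> E2 since |p| < 1.\<close>
  have *: "(K - cnj K) * p = 0" "w - p * u = 0"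
    using infinite_quartic_roots(5)[OF W(1) eq] infinite_quartic_roots(4)[OF W(1) eq] by simp_all
  then have "cnj K = K" using p by simp
  then have "K * ((E1 - E2) + p * cnj (E1 - E2)) = w - p * u" by (simp add: u_def w_def algebra_simps)
  then have "E1 - E2 = - (p * cnj (E1 - E2))" using * K by (simp add: eq_neg_iff_add_eq_0)
  then have "cmod (E1 - E2) = cmod p * cmod (E1 - E2)" by (metis complex_mod_cnj norm_minus_cancel norm_mult)
  then show False using p E by simp
qed

text \<open>Squaring twice removes the moduli: a + b = N implies (a^2 - b^2 + N^2)^2 = 4 N^2 a^2.
  Multiplied by \<omega>^4, the sides become the polynomials \<open>R\<^sup>2\<close> and
  \<open>T\<close>. The degree of \<open>T\<close> is at most 6, so the coefficient p (|c2|^2 -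
  |c1|^2) of \<omega>^4 in \<open>R\<close> must vanish.\<close>

lemma sum_moduli_constant_imp:
  assumes p: "p \<noteq> 0" and N: "N \<noteq> 0"
    and W: "infinite W" "\<And>\<omega>. \<omega> \<in> W \<Longrightarrow> cmod \<omega> = 1"
    and sum: "\<And>\<omega>. \<omega> \<in> W \<Longrightarrow> cmod (P1 - c1 * ell p \<omega>) + cmod (P2 - c2 * ell p \<omega>) = N"
  shows "cmod c1 = cmod c2"
proof -
  \<comment> \<open>The polynomial whose value on the unit circle is \<open>\<omega>\<^sup>2\<close>
    times |P - c \<open>ell p \<omega>\<close>|^2.\<close>
  define Q where "Q = (\<lambda>P c. [: - (cnj p * (c * cnj c)), P * cnj c * cnj p - c * cnj P,
    P * cnj P + c * cnj c * (1 + p * cnj p), c * cnj P * p - P * cnj c, - (p * (c * cnj c)) :])"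
  have Q: "poly (Q P c) \<omega> = \<omega>\<^sup>2 * of_real ((cmod (P - c * ell p \<omega>))\<^sup>2)" if "cmod \<omega> = 1" for \<omega> P c
  proof -
    have "\<omega>\<^sup>2 * of_real ((cmod (P - c * ell p \<omega>))\<^sup>2) = \<omega>\<^sup>2 * ((P - c * ell p \<omega>) * cnj (P - c * ell p \<omega>))"
      by (simp only: complex_norm_square)
    also have "\<dots> = \<omega>\<^sup>2 * (P * cnj P) - P * cnj c * (\<omega>\<^sup>2 * cnj (ell p \<omega>)) - c * cnj P * (\<omega>\<^sup>2 * ell p \<omega>)
       + c * cnj c * (\<omega>\<^sup>2 * (ell p \<omega> * cnj (ell p \<omega>)))"
      by (simp add: algebra_simps)
    also have "\<dots> = poly (Q P c) \<omega>"
      unfolding ell_quartic[OF that] Q_def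
      by (simp add: algebra_simps power2_eq_square power3_eq_cube power4_eq_xxxx)
    finally show ?thesis by simp
  qed
  define R where "R = Q P1 c1 - Q P2 c2 + [:0, 0, of_real (N\<^sup>2):]"
  define T where "T = smult (of_real (4 * N\<^sup>2)) (monom 1 2 * Q P1 c1)"
  have "poly (R\<^sup>2 - T) \<omega> = 0" if "\<omega> \<in> W" for \<omega>
  proof -
    define a b where "a = cmod (P1 - c1 * ell p \<omega>)" and "b = cmod (P2 - c2 * ell p \<omega>)"
    have b: "b = N - a" using sum[OF that] by (simp add: a_def b_def)
    have R: "poly R \<omega> = \<omega>\<^sup>2 * of_real (a\<^sup>2 - b\<^sup>2 + N\<^sup>2)"
      using Q[OF W(2)[OF that]] by (simp add: R_def a_def b_def algebra_simps power2_eq_square)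
    have T: "poly T \<omega> = \<omega>\<^sup>2 * \<omega>\<^sup>2 * of_real (4 * N\<^sup>2 * a\<^sup>2)"
      using Q[OF W(2)[OF that]] by (simp add: T_def a_def poly_monom)
    have "(a\<^sup>2 - b\<^sup>2 + N\<^sup>2)\<^sup>2 = 4 * N\<^sup>2 * a\<^sup>2" unfolding b by (simp add: power2_eq_square algebra_simps)
    then have "(of_real (a\<^sup>2 - b\<^sup>2 + N\<^sup>2) :: complex)\<^sup>2 = of_real (4 * N\<^sup>2 * a\<^sup>2)"
      by (metis of_real_power)
    then show ?thesis unfolding poly_diff poly_power R T power_mult_distrib by (simp add: power2_eq_square)
  qed
  then have "W \<subseteq> {\<omega>. poly (R\<^sup>2 - T) \<omega> = 0}" by auto
  then have RT: "R\<^sup>2 = T" using W(1) poly_roots_finite[of "R\<^sup>2 - T"] finite_subset by auto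
  have "coeff R 4 = p * (c2 * cnj c2 - c1 * cnj c1)"
    by (simp add: R_def Q_def eval_nat_numeral algebra_simps)
  moreover have "coeff R 4 = 0"
  proof (rule ccontr)
    assume nz: "coeff R 4 \<noteq> 0"
    have "degree R \<ge> 4" using nz le_degree by blast
    then have "degree (R\<^sup>2) \<ge> 8" using nz by (cases "R = 0") (simp_all add: degree_power_eq)
    moreover have "degree T \<le> 6"
    proof -
      have "degree (Q P1 c1) \<le> 4" by (rule degree_le) (simp add: Q_def coeff_pCons split: nat.splits)
      moreover have "degree (monom (1::complex) 2) \<le> 2" by (rule degree_monom_le)
      moreover have "degree (monom 1 2 * Q P1 c1) \<le> degree (monom (1::complex) 2) + degree (Q P1 c1)"
        by (rule degree_mult_le)
      moreover have "degree T \<le> degree (monom 1 2 * Q P1 c1)" unfolding T_def by (rule degree_smult_le)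
      ultimately show ?thesis by linarith
    qed
    ultimately show False using RT by simp
  qed
  ultimately have "c1 * cnj c1 = c2 * cnj c2" using p by simp
  then have "(cmod c1)\<^sup>2 = (cmod c2)\<^sup>2" by (metis complex_norm_square of_real_eq_iff)
  then show ?thesis by simp
qed

section \<open>Isometric maps of the plane are linear or conjugate linear\<close>

text \<open>Together the last two assumptions say that \<open>F\<close> is isometric up to the
  factor \<open>N\<close> for the norm max |\<open>mlin p \<omega>\<close>|. They are separate
  because the magic functions provide the first and the extremal discs the second. No linearity of
  \<open>F\<close> is assumed.\<close>

locale tangent_isometry =
  fixes p :: complex and N :: real and F :: "complex \<Rightarrow> complex \<times> complex"
  assumes p: "cmod p < 1" and N: "N > 0" and F0: "F 0 = 0"
    and contractive: "\<And>\<omega> h h'. cmod \<omega> = 1 \<Longrightarrow> cmod (mlin p \<omega> (F h - F h')) \<le> N * cmod (h - h')"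
    and attained: "\<And>h h'. \<exists>\<omega>. cmod \<omega> = 1 \<and> cmod (mlin p \<omega> (F h - F h')) = N * cmod (h - h')"
begin

text \<open>The functional of parameter \<omega> and phase \<tau> norms all segments of the image in
  direction \<open>v\<close>: composed with it, \<open>F\<close> becomes the real linear function N
  Re (\<open>cnj v * h\<close>), although \<open>F\<close> itself is not yet known to be
  linear.\<close>

definition supporting :: "complex \<Rightarrow> complex \<Rightarrow> complex \<Rightarrow> bool"
  where "supporting v \<omega> \<tau> \<longleftrightarrow> cmod v = 1 \<and> cmod \<omega> = 1 \<and> cmod \<tau> = 1 \<and>
    (\<forall>h. Re (cnj \<tau> * mlin p \<omega> (F h)) = N * Re (cnj v * h))"

lemma contractive0: "cmod \<omega> = 1 \<Longrightarrow> cmod (mlin p \<omega> (F h)) \<le> N * cmod h"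
  using contractive[of \<omega> h 0] F0 by simp

lemma approximately_supporting:
  assumes n: "n > 0" and v: "cmod v = 1" and \<omega>: "cmod \<omega> = 1" and \<tau>: "cmod \<tau> = 1"
    and val: "mlin p \<omega> (F (of_real n * v)) = of_real (n * N) * \<tau>"
      "mlin p \<omega> (F (- (of_real n * v))) = - (of_real (n * N) * \<tau>)"
  shows "\<bar>Re (cnj \<tau> * mlin p \<omega> (F h)) - N * Re (cnj v * h)\<bar> \<le> N * (cmod h)\<^sup>2 / (2 * n)"
proof (rule Busemann_estimate[OF n N v \<tau>])
  show "cmod (mlin p \<omega> (F h) - of_real (n * N) * \<tau>) \<le> N * cmod (h - of_real n * v)"
    using contractive[OF \<omega>, of h "of_real n * v"] by (simp only: mlin_diff val)
  show "cmod (mlin p \<omega> (F h) + of_real (n * N) * \<tau>) \<le> N * cmod (h + of_real n * v)"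
    using contractive[OF \<omega>, of h "- (of_real n * v)"] by (simp only: mlin_diff val diff_minus_eq_add)
qed

text \<open>If the line in direction \<open>v\<close> is traversed at full speed by one functional,
  then \<open>approximately_supporting\<close> applies at every distance n, and the error tends to
  0.\<close>

lemma supportingI:
  assumes v: "cmod v = 1" and \<omega>: "cmod \<omega> = 1" and \<tau>: "cmod \<tau> = 1"
    and val: "\<And>t. mlin p \<omega> (F (of_real t * v)) = of_real (t * N) * \<tau>"
  shows "supporting v \<omega> \<tau>"
proof -
  have "Re (cnj \<tau> * mlin p \<omega> (F h)) = N * Re (cnj v * h)" for h
  proof -
    let ?d = "\<bar>Re (cnj \<tau> * mlin p \<omega> (F h)) - N * Re (cnj v * h)\<bar>"
    have "?d \<le> N * (cmod h)\<^sup>2 / (2 * real (Suc n))" for n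
    proof (rule approximately_supporting[OF _ v \<omega> \<tau> val])
      have "- (complex_of_real (real (Suc n)) * v) = of_real (- real (Suc n)) * v" by (simp only: of_real_minus mult_minus_left)
      then show "mlin p \<omega> (F (- (complex_of_real (real (Suc n)) * v))) = - (complex_of_real (real (Suc n) * N) * \<tau>)"
        using val[of "- real (Suc n)"] by (simp only: of_real_minus mult_minus_left)
    qed simp
    moreover have "(\<lambda>n. N * (cmod h)\<^sup>2 / (2 * real (Suc n))) \<longlonglongrightarrow> 0"
      by real_asymp
    ultimately have "?d \<le> 0" by (intro LIMSEQ_le_const) auto
    then show ?thesis by simp
  qed
  then show ?thesis using v \<omega> \<tau> by (simp add: supporting_def)
qed

text \<open>A functional that norms F (m v) - F (- m v) takes antipodal values at the two ends,
  because the contraction bound leaves no other possibility. So it supports \<open>v\<close> up to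
  an error of order 1 / m. Its parameters lie on compact circles, and a limit point as m grows is an
  exact supporting functional.\<close>

lemma supporting_exists:
  assumes v: "cmod v = 1"
  shows "\<exists>\<omega> \<tau>. supporting v \<omega> \<tau>"
proof -
  define P where "P = (\<lambda>n x. cmod (fst x) = 1 \<and> cmod (snd x) = 1 \<and>
    (\<forall>h. \<bar>Re (cnj (snd x) * mlin p (fst x) (F h)) - N * Re (cnj v * h)\<bar> \<le> N * (cmod h)\<^sup>2 / (2 * real (Suc n))))"
  have "\<exists>x. P n x" for n
  proof -
    define m where "m = real (Suc n)"
    have m: "m > 0" by (simp add: m_def)
    define k where "k = of_real m * v"
    obtain \<omega> where \<omega>: "cmod \<omega> = 1" "cmod (mlin p \<omega> (F k - F (- k))) = N * cmod (k - (- k))"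
      using attained by blast
    have ck: "cmod k = m" using v m by (simp add: k_def norm_mult)
    have "cmod (k - (- k)) = 2 * m" using ck by (metis diff_minus_eq_add mult_2 norm_mult norm_numeral)
    then have d: "cmod (mlin p \<omega> (F k) - mlin p \<omega> (F (- k))) = 2 * (m * N)"
      using \<omega>(2) by (simp add: mlin_diff)
    have c: "cmod (mlin p \<omega> (F k)) \<le> m * N" "cmod (mlin p \<omega> (F (- k))) \<le> m * N"
      using contractive0[OF \<omega>(1)] ck by (metis mult.commute, metis mult.commute norm_minus_cancel)
    note anti = antipodal_of_cmod_diff[OF c d]
    define \<tau> where "\<tau> = mlin p \<omega> (F k) / of_real (m * N)"
    have \<tau>: "cmod \<tau> = 1" using anti(2) m N by (simp add: \<tau>_def norm_divide norm_mult)
    have val: "mlin p \<omega> (F k) = of_real (m * N) * \<tau>" using m N by (simp add: \<tau>_def)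
    have "P n (\<omega>, \<tau>)"
      unfolding P_def fst_conv snd_conv
      using approximately_supporting[OF m v \<omega>(1) \<tau>] val anti(1) \<omega>(1) \<tau>
      by (simp add: k_def m_def)
    then show ?thesis by blast
  qed
  then obtain X where X: "\<And>n. P n (X n)" by metis
  have "\<And>n. X n \<in> sphere 0 1 \<times> sphere 0 1" using X by (auto simp: P_def mem_Times_iff)
  moreover have "seq_compact (sphere (0::complex) 1 \<times> sphere (0::complex) 1)"
    by (simp add: compact_Times compact_imp_seq_compact)
  ultimately obtain x r where x: "x \<in> sphere 0 1 \<times> sphere 0 1" and r: "strict_mono r" and
    lim: "(X \<circ> r) \<longlonglongrightarrow> x" by (meson seq_compactE)
  have "Re (cnj (snd x) * mlin p (fst x) (F h)) = N * Re (cnj v * h)" for h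
  proof -
    have "(\<lambda>n. \<bar>Re (cnj (snd (X (r n))) * mlin p (fst (X (r n))) (F h)) - N * Re (cnj v * h)\<bar>)
      \<longlonglongrightarrow> \<bar>Re (cnj (snd x) * mlin p (fst x) (F h)) - N * Re (cnj v * h)\<bar>"
      using lim unfolding mlin_def ell_def comp_def by (intro tendsto_intros)
    moreover have "(\<lambda>n. N * (cmod h)\<^sup>2 / (2 * real (Suc (r n)))) \<longlonglongrightarrow> 0"
    proof -
      have "(\<lambda>n. N * (cmod h)\<^sup>2 / (2 * real (Suc n))) \<longlonglongrightarrow> 0" by real_asymp
      then show ?thesis using LIMSEQ_subseq_LIMSEQ[OF _ r] by (simp add: comp_def)
    qed
    ultimately have "\<bar>Re (cnj (snd x) * mlin p (fst x) (F h)) - N * Re (cnj v * h)\<bar> \<le> 0"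
      using X unfolding P_def by (intro LIMSEQ_le) auto
    then show ?thesis by simp
  qed
  then have "supporting v (fst x) (snd x)"
    using x v by (auto simp: supporting_def mem_Times_iff)
  then show ?thesis by blast
qed

text \<open>The component along \<tau> is N t already, and contractivity leaves no room for an
  orthogonal component.\<close>

lemma supporting_increment:
  assumes "supporting v \<omega> \<tau>"
  shows "mlin p \<omega> (F (h + of_real t * v) - F h) = of_real (N * t) * \<tau>"
proof (rule eq_of_Re_cnj_mult)
  have v: "cmod v = 1" and \<omega>: "cmod \<omega> = 1" using assms by (simp_all add: supporting_def)
  show "cmod \<tau> = 1" using assms by (simp add: supporting_def)
  have "Re (cnj \<tau> * mlin p \<omega> (F (h + of_real t * v) - F h)) =
     N * Re (cnj v * (h + of_real t * v)) - N * Re (cnj v * h)"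
    unfolding mlin_diff right_diff_distrib minus_complex.sel
    by (metis assms supporting_def)
  also have "\<dots> = N * Re (of_real t * (cnj v * v))" by (simp add: algebra_simps)
  finally show "Re (cnj \<tau> * mlin p \<omega> (F (h + of_real t * v) - F h)) = N * t"
    unfolding unit_cnj(2)[OF v] by simp
  show "cmod (mlin p \<omega> (F (h + of_real t * v) - F h)) \<le> \<bar>N * t\<bar>"
    using contractive[OF \<omega>, of "h + of_real t * v" h] N v by (simp add: norm_mult abs_mult)
qed

text \<open>Since \<omega> norms every increment in direction \<open>v\<close>, stationarity fixes
  the phase of the first component. One real number \<rho> is all that remains free, and the
  supporting value then determines the second component.\<close>

lemma supporting_parametrization:
  assumes "supporting v \<omega> \<tau>"
  obtains \<rho> where "fst (F (h + of_real t * v) - F h) / 2 = of_real \<rho> * (\<tau> / ell' p \<omega>)"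
    "snd (F (h + of_real t * v) - F h) = of_real (N * t) * \<tau> + of_real \<rho> * (\<tau> / ell' p \<omega>) * ell p \<omega>"
proof -
  define D where "D = F (h + of_real t * v) - F h"
  have v: "cmod v = 1" and \<omega>: "cmod \<omega> = 1" and \<tau>: "cmod \<tau> = 1"
    using assms by (simp_all add: supporting_def)
  have nz: "ell' p \<omega> \<noteq> 0" using ell'_nonzero p \<omega> by blast
  have D: "mlin p \<omega> D = of_real (N * t) * \<tau>" unfolding D_def by (rule supporting_increment[OF assms])
  have snd: "snd D = of_real (N * t) * \<tau> + fst D / 2 * ell p \<omega>" using D by (simp add: mlin_def algebra_simps)
  show ?thesis
  \<comment> \<open>For t = 0 the value of the functional vanishes and stationarity says nothing,
    but then the increment itself is 0.\<close>
  proof (cases "t = 0")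
    case True
    then show ?thesis using that[of 0] by simp
  next
    case False
    have "Im (cnj (mlin p \<omega> D) * (fst D / 2 * ell' p \<omega>)) = 0"
    proof (rule mlin_stationary[OF \<omega>])
      fix \<omega>' :: complex assume "cmod \<omega>' = 1"
      then have "cmod (mlin p \<omega>' D) \<le> N * \<bar>t\<bar>"
        using contractive[of \<omega>' "h + of_real t * v" h] v by (simp add: D_def norm_mult)
      then show "cmod (mlin p \<omega>' D) \<le> cmod (mlin p \<omega> D)" unfolding D using N \<tau> by (simp add: norm_mult)
    qed
    moreover have "cnj (mlin p \<omega> D) * (fst D / 2 * ell' p \<omega>) =
      of_real (N * t) * (cnj \<tau> * (fst D / 2 * ell' p \<omega>))" by (simp add: D)
    ultimately have "Im (cnj \<tau> * (fst D / 2 * ell' p \<omega>)) = 0"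
      using N False by (simp only: Re_Im_complex_of_real_mult(2)) simp
    then have "fst D / 2 * ell' p \<omega> = of_real (Re (cnj \<tau> * (fst D / 2 * ell' p \<omega>))) * \<tau>"
      by (rule real_multiple_of_Im_cnj[OF \<tau>])
    then have "fst D / 2 = of_real (Re (cnj \<tau> * (fst D / 2 * ell' p \<omega>))) * (\<tau> / ell' p \<omega>)"
      using nz by (metis nonzero_eq_divide_eq times_divide_eq_right)
    then show ?thesis using that snd unfolding D_def by metis
  qed
qed

text \<open>Two independent directions determine \<open>mlin p \<omega> (F h)\<close>, and equal
  orientation makes it N \<mu> h with |\<mu>| = 1. Hence the same \<omega> norms every difference F
  h - F h', and stationarity holds for all pairs. That forces the first component to be complex
  linear too.\<close>

lemma complex_linear_if_same_orientation:
  assumes g1: "supporting v1 \<omega> \<tau>1" and g2: "supporting v2 \<omega> \<tau>2" and np: "Im (cnj v1 * v2) \<noteq> 0"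
    and or: "cnj \<tau>1 * \<tau>2 = cnj v1 * v2"
  shows "\<exists>T. \<forall>h. F h = (h * fst T, h * snd T)"
proof -
  have u: "cmod v1 = 1" "cmod v2 = 1" "cmod \<omega> = 1" "cmod \<tau>1 = 1" "cmod \<tau>2 = 1"
    using g1 g2 by (simp_all add: supporting_def)
  define \<mu> where "\<mu> = \<tau>1 * cnj v1"
  have \<mu>2: "\<mu> = \<tau>2 * cnj v2"
  proof -
    have "\<tau>1 * (cnj \<tau>1 * \<tau>2) * cnj v2 = \<tau>1 * (cnj v1 * v2) * cnj v2" by (simp only: or)
    then have "(\<tau>1 * cnj \<tau>1) * (\<tau>2 * cnj v2) = (\<tau>1 * cnj v1) * (v2 * cnj v2)" by (simp only: mult_ac)
    then show ?thesis by (simp add: unit_cnj u \<mu>_def)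
  qed
  have \<mu>: "cmod \<mu> = 1" by (simp add: \<mu>_def norm_mult u)
  have L: "mlin p \<omega> (F h) = of_real N * \<mu> * h" for h
  proof -
    define w where "w = cnj \<mu> * mlin p \<omega> (F h) - of_real N * h"
    have a: "cnj v1 * w = cnj \<tau>1 * mlin p \<omega> (F h) - of_real N * (cnj v1 * h)"
    proof -
      have "cnj v1 * w = (cnj v1 * v1) * (cnj \<tau>1 * mlin p \<omega> (F h)) - of_real N * (cnj v1 * h)"
        by (simp add: w_def \<mu>_def algebra_simps)
      then show ?thesis by (simp add: unit_cnj u)
    qed
    have b: "cnj v2 * w = cnj \<tau>2 * mlin p \<omega> (F h) - of_real N * (cnj v2 * h)"
    proof -
      have "cnj v2 * w = (cnj v2 * v2) * (cnj \<tau>2 * mlin p \<omega> (F h)) - of_real N * (cnj v2 * h)"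
        by (simp add: w_def \<mu>2 algebra_simps)
      then show ?thesis by (simp add: unit_cnj u)
    qed
    have "Re (cnj v1 * w) = 0" "Re (cnj v2 * w) = 0"
      using g1 g2 unfolding a b supporting_def minus_complex.sel Re_Im_complex_of_real_mult(1) by simp_all
    then have "w = 0" using zero_of_Re_cnj_mult np by blast
    then have "\<mu> * (cnj \<mu> * mlin p \<omega> (F h)) = of_real N * \<mu> * h" by (simp add: w_def algebra_simps)
    then show ?thesis by (simp add: unit_cnj[OF \<mu>] mult.assoc[symmetric])
  qed
  have nz: "ell' p \<omega> \<noteq> 0" using ell'_nonzero p u by blast
  \<comment> \<open>The first component with its phase divided out: stationarity now reads that C h
    - C h' is a real multiple of h - h'.\<close>
  define C where "C = (\<lambda>h. fst (F h) / 2 * ell' p \<omega> * cnj \<mu>)"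
  have C: "Im (cnj (h - h') * (C h - C h')) = 0" for h h'
  proof -
    define D where "D = F h - F h'"
    have D: "mlin p \<omega> D = of_real N * (\<mu> * (h - h'))" by (simp add: D_def mlin_diff L algebra_simps)
    have "Im (cnj (mlin p \<omega> D) * (fst D / 2 * ell' p \<omega>)) = 0"
    proof (rule mlin_stationary[OF u(3)])
      fix \<omega>' :: complex assume "cmod \<omega>' = 1"
      then show "cmod (mlin p \<omega>' D) \<le> cmod (mlin p \<omega> D)"
        unfolding D using contractive[of \<omega>' h h'] \<mu> N by (simp add: D_def norm_mult)
    qed
    moreover have "cnj (mlin p \<omega> D) * (fst D / 2 * ell' p \<omega>) = of_real N * (cnj (h - h') * (C h - C h'))"
    proof -
      have "C h - C h' = cnj \<mu> * (fst D / 2 * ell' p \<omega>)"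
        by (simp add: C_def D_def algebra_simps diff_divide_distrib)
      then show ?thesis by (simp add: D)
    qed
    ultimately show ?thesis using N by (simp only: Re_Im_complex_of_real_mult(2)) simp
  qed
  have "\<exists>\<alpha>::real. C h = of_real \<alpha> * h" if "h \<noteq> 0" for h
  proof -
    have "Im (cnj h * C h) = 0" using C[of h 0] F0 by (simp add: C_def)
    then have e: "cnj h * C h = of_real (Re (cnj h * C h))" by (simp add: complex_eq_iff)
    have "of_real ((cmod h)\<^sup>2) * C h = h * (cnj h * C h)"
      by (simp only: complex_norm_square mult.assoc)
    also have "\<dots> = of_real (Re (cnj h * C h)) * h" by (subst e) (simp only: mult.commute)
    finally have "C h = of_real (Re (cnj h * C h) / (cmod h)\<^sup>2) * h"
      using that by (simp add: field_simps)
    then show ?thesis by blast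
  qed
  then obtain \<alpha> where \<alpha>: "\<And>h. h \<noteq> 0 \<Longrightarrow> C h = of_real (\<alpha> h :: real) * h" by metis
  \<comment> \<open>For independent h and k, \<alpha> h h - \<alpha> k k is parallel to h - k only
    if the factors agree. Real h are compared with 1 by way of \<i>.\<close>
  have eq: "\<alpha> h = \<alpha> k" if "Im (cnj h * k) \<noteq> 0" for h k
  proof -
    have hk: "h \<noteq> 0" "k \<noteq> 0" using that by auto
    have "cnj (h - k) * (C h - C k) = of_real (\<alpha> h) * (cnj h * h) + of_real (\<alpha> k) * (cnj k * k)
      - of_real (\<alpha> k) * (cnj h * k) - of_real (\<alpha> h) * cnj (cnj h * k)"
      by (simp add: \<alpha>[OF hk(1)] \<alpha>[OF hk(2)] algebra_simps)
    then have "Im (of_real (\<alpha> h) * (cnj h * h) + of_real (\<alpha> k) * (cnj k * k)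
      - of_real (\<alpha> k) * (cnj h * k) - of_real (\<alpha> h) * cnj (cnj h * k)) = 0" using C[of h k] by metis
    moreover have "Im (cnj z * z) = 0" for z by simp
    ultimately have "(\<alpha> h - \<alpha> k) * Im (cnj h * k) = 0"
      unfolding minus_complex.sel plus_complex.sel Re_Im_complex_of_real_mult(2) cnj.sel by (simp add: algebra_simps)
    then show ?thesis using that by simp
  qed
  have Ch: "C h = of_real (\<alpha> 1) * h" for h
  proof (cases "h = 0")
    case True then show ?thesis by (simp add: C_def F0)
  next
    case False
    have "\<alpha> h = \<alpha> 1"
    proof (cases "Im h = 0")
      case True
      then have "Re h \<noteq> 0" using False by (simp add: complex_eq_iff)
      then have "\<alpha> h = \<alpha> \<i>" using True by (intro eq) simp
      also have "\<alpha> \<i> = \<alpha> 1" by (intro eq) simp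
      finally show ?thesis .
    next
      assume "Im h \<noteq> 0"
      then show ?thesis by (intro eq) simp
    qed
    then show ?thesis using \<alpha>[OF False] by simp
  qed
  have f: "fst (F h) = h * (of_real (\<alpha> 1) * \<mu> / ell' p \<omega> * 2)" for h
  proof -
    have "fst (F h) / 2 * ell' p \<omega> * (cnj \<mu> * \<mu>) = of_real (\<alpha> 1) * h * \<mu>"
      using Ch[of h] by (simp add: C_def mult.assoc[symmetric])
    then show ?thesis using nz by (simp add: unit_cnj[OF \<mu>] field_simps)
  qed
  have s: "snd (F h) = h * (of_real N * \<mu> + of_real (\<alpha> 1) * \<mu> / ell' p \<omega> * ell p \<omega>)" for h
    using L[of h] f[of h] by (simp add: mlin_def algebra_simps)
  show ?thesis
    by (rule exI[of _ "(of_real (\<alpha> 1) * \<mu> / ell' p \<omega> * 2, of_real N * \<mu> + of_real (\<alpha> 1) * \<mu> / ell' p \<omega> * ell p \<omega>)"])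
      (metis f s fst_conv snd_conv prod.collapse)
qed

lemma tangent_isometry_cnj: "tangent_isometry p N (\<lambda>h. F (cnj h))"
proof
  fix \<omega> h h' assume "cmod \<omega> = 1"
  then show "cmod (mlin p \<omega> (F (cnj h) - F (cnj h'))) \<le> N * cmod (h - h')"
    using contractive[of \<omega> "cnj h" "cnj h'"] by (metis complex_cnj_diff complex_mod_cnj)
next
  fix h h'
  show "\<exists>\<omega>. cmod \<omega> = 1 \<and> cmod (mlin p \<omega> (F (cnj h) - F (cnj h'))) = N * cmod (h - h')"
    using attained[of "cnj h" "cnj h'"] by (metis complex_cnj_diff complex_mod_cnj)
qed (use p N F0 in auto)

lemma supporting_cnj:
  assumes "supporting v \<omega> \<tau>"
  shows "tangent_isometry.supporting p N (\<lambda>h. F (cnj h)) (cnj v) \<omega> \<tau>"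
proof -
  have "Re (cnj v * cnj h) = Re (v * h)" for h by simp
  then show ?thesis
    using assms unfolding tangent_isometry.supporting_def[OF tangent_isometry_cnj] supporting_def by simp
qed

text \<open>Evaluating the functional of \<open>v1\<close> at F v2 gives Re
  (\<open>cnj \<tau>1 * \<tau>2\<close>) = Re (\<open>cnj v1 * v2\<close>). Both numbers have
  modulus 1, so they are equal or conjugate; the conjugate case is the equal one for h \<mapsto> F
  (\<open>cnj h\<close>).\<close>

lemma linear_if_common_support:
  assumes g1: "supporting v1 \<omega> \<tau>1" and g2: "supporting v2 \<omega> \<tau>2" and np: "Im (cnj v1 * v2) \<noteq> 0"
  shows "\<exists>T. (\<forall>h. F h = (h * fst T, h * snd T)) \<or> (\<forall>h. F h = (cnj h * fst T, cnj h * snd T))"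
proof -
  have u: "cmod v1 = 1" "cmod v2 = 1" "cmod \<tau>1 = 1" "cmod \<tau>2 = 1"
    using g1 g2 by (simp_all add: supporting_def)
  have "mlin p \<omega> (F v2) = of_real N * \<tau>2" using supporting_increment[OF g2, of 0 1] F0 by simp
  then have "cnj \<tau>1 * mlin p \<omega> (F v2) = of_real N * (cnj \<tau>1 * \<tau>2)" by simp
  then have "N * Re (cnj \<tau>1 * \<tau>2) = N * Re (cnj v1 * v2)"
    using g1 unfolding supporting_def by (metis Re_Im_complex_of_real_mult(1))
  then have Re: "Re (cnj \<tau>1 * \<tau>2) = Re (cnj v1 * v2)" using N by simp
  have "cmod (cnj \<tau>1 * \<tau>2) = cmod (cnj v1 * v2)" by (simp add: norm_mult u)
  then have "(Im (cnj \<tau>1 * \<tau>2))\<^sup>2 = (Im (cnj v1 * v2))\<^sup>2"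
    using Re cmod_power2[of "cnj \<tau>1 * \<tau>2"] cmod_power2[of "cnj v1 * v2"] by (metis add_left_cancel)
  then consider "Im (cnj \<tau>1 * \<tau>2) = Im (cnj v1 * v2)" | "Im (cnj \<tau>1 * \<tau>2) = - Im (cnj v1 * v2)"
    using power2_eq_iff by blast
  then show ?thesis
  proof cases
    case 1
    then have "cnj \<tau>1 * \<tau>2 = cnj v1 * v2" using Re complex_eq_iff by blast
    then show ?thesis using complex_linear_if_same_orientation[OF g1 g2 np] by blast
  next
    case 2
    then have e: "cnj \<tau>1 * \<tau>2 = cnj (cnj v1 * v2)" using Re by (intro complex_eqI) simp_all
    interpret c: tangent_isometry p N "\<lambda>h. F (cnj h)" by (rule tangent_isometry_cnj)
    have "\<exists>T. \<forall>h. F (cnj h) = (h * fst T, h * snd T)"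
      using e np by (intro c.complex_linear_if_same_orientation[OF supporting_cnj[OF g1] supporting_cnj[OF g2]])
        (simp_all add: algebra_simps)
    then show ?thesis by (metis complex_cnj_cnj)
  qed
qed

text \<open>Suppose that independent directions never share a parameter \<omega>. Then infinitely
  many \<omega> occur. Increments of \<open>F\<close> around triangles of fixed shape have to
  cancel, and by the inscribed angle lemma this leaves no freedom in their real parameters, so
  \<open>F\<close> is real linear. With infinitely many norming \<omega>, its first component must
  then vanish along some line. On that line \<open>mlin\<close> does not depend on \<omega>, so any
  \<omega> that supports another direction supports this one as well, a contradiction.\<close>

lemma common_support_exists:
  assumes p0: "p \<noteq> 0"
  shows "\<exists>v1 v2 \<omega> \<tau>1 \<tau>2. supporting v1 \<omega> \<tau>1 \<and> supporting v2 \<omega> \<tau>2 \<and> Im (cnj v1 * v2) \<noteq> 0"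
proof (rule ccontr)
  assume "\<not> ?thesis"
  then have no: "Im (cnj v1 * v2) = 0" if "supporting v1 \<omega> \<tau>1" "supporting v2 \<omega> \<tau>2" for v1 v2 \<omega> \<tau>1 \<tau>2
    using that by blast
  have "\<exists>f. \<forall>\<theta>. supporting (cis \<theta>) (fst (f \<theta>)) (snd (f \<theta>))"
    using supporting_exists[OF norm_cis] by (intro choice) (metis fst_conv snd_conv)
  then obtain f where f: "\<And>\<theta>. supporting (cis \<theta>) (fst (f \<theta>)) (snd (f \<theta>))" by blast
  define \<omega> \<tau> where "\<omega> = (\<lambda>\<theta>. fst (f \<theta>))" and "\<tau> = (\<lambda>\<theta>. snd (f \<theta>))"
  have sup: "\<And>\<theta>. supporting (cis \<theta>) (\<omega> \<theta>) (\<tau> \<theta>)" unfolding \<omega>_def \<tau>_def by (rule f)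
  have u: "cmod (\<omega> \<theta>) = 1" "cmod (\<tau> \<theta>) = 1" for \<theta> using sup by (simp_all add: supporting_def)
  \<comment> \<open>In the half-open interval of length \<open>pi\<close> different angles give
    independent directions.\<close>
  have inj: "a = b" if "\<omega> a = \<omega> b" "a \<in> {0..<pi}" "b \<in> {0..<pi}" for a b
  proof -
    have "Im (cnj (cis a) * cis b) = 0" using no sup that(1) by metis
    then have "sin (b - a) = 0" by (simp add: sin_diff mult.commute)
    then show ?thesis using sin_eq_0_pi[of "b - a"] that by auto
  qed
  have sub: "{0<..<pi/2} \<subseteq> {0..<pi}" by auto
  then have W: "infinite (\<omega> ` {0<..<pi/2})"
    using inj pi_half_gt_zero by (subst finite_image_iff) (auto intro!: inj_onI infinite_Ioo)
  \<comment> \<open>By \<open>supporting_parametrization\<close> the increments in direction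
    \<open>cis \<theta>\<close> are free exactly in the real direction of the vector (2 d, d
    E).\<close>
  define d where "d = (\<lambda>\<theta>. \<tau> \<theta> / ell' p (\<omega> \<theta>))"
  define E where "E = (\<lambda>\<theta>. ell p (\<omega> \<theta>))"
  have d: "d \<theta> \<noteq> 0" for \<theta> using ell'_nonzero[OF p u(1)] u(2)[of \<theta>] by (auto simp: d_def)
  have "E 0 \<noteq> E (pi/2)"
  proof
    assume "E 0 = E (pi/2)"
    then have "\<omega> 0 = \<omega> (pi/2)" unfolding E_def by (rule ell_inj[OF p])
    then have "(0::real) = pi/2" by (rule inj) simp_all
    then show False by simp
  qed
  \<comment> \<open>Chooses the third side so that the point \<open>E \<theta>\<close> of the
    ellipse does not see the chord from \<open>E 0\<close> to \<open>E (pi/2)\<close> under the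
    exceptional angle fixed by the phases of \<open>d\<close>.\<close>
  have "\<exists>\<theta>\<in>{0<..<pi/2}. Im (d 0 * cnj (d (pi/2)) * (E \<theta> - E 0) * cnj (E (pi/2) - E \<theta>)) \<noteq> 0"
  proof (rule ccontr)
    assume n: "\<not> ?thesis"
    have "Im (d 0 * cnj (d (pi/2)) * (ell p w - E 0) * cnj (E (pi/2) - ell p w)) = 0"
      if "w \<in> \<omega> ` {0<..<pi/2}" for w
      using that n unfolding E_def by blast
    moreover have "cmod w = 1" if "w \<in> \<omega> ` {0<..<pi/2}" for w using that u by blast
    moreover have "d 0 * cnj (d (pi/2)) \<noteq> 0" using d by simp
    ultimately show False using inscribed_angle_not_constant[OF p p0 _ \<open>E 0 \<noteq> E (pi/2)\<close> W] by blast
  qed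
  then obtain \<theta> where \<theta>: "\<theta> \<in> {0<..<pi/2}"
    and Z: "Im (d 0 * cnj (d (pi/2)) * (E \<theta> - E 0) * cnj (E (pi/2) - E \<theta>)) \<noteq> 0" by blast
  have trig: "cos \<theta> > 0" "sin \<theta> > 0" using \<theta> by (auto intro: cos_gt_zero sin_gt_zero)
  define q where "q = sin \<theta> / cos \<theta>"
  have q: "q > 0" using trig by (simp add: q_def)
  \<comment> \<open>Eliminating \<delta>3 leaves \<delta>1 d 0 (E \<theta> - E 0) = \<delta>2 d
    (pi/2) (E (pi/2) - E \<theta>). By the choice of \<theta> the two complex numbers are
    independent over the reals.\<close>
  have uniq: "\<delta>1 = 0 \<and> \<delta>2 = 0"
    if "of_real \<delta>1 * d 0 + of_real \<delta>2 * d (pi/2) + of_real \<delta>3 * d \<theta> = 0"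
      "of_real \<delta>1 * d 0 * E 0 + of_real \<delta>2 * d (pi/2) * E (pi/2) + of_real \<delta>3 * d \<theta> * E \<theta> = 0" for \<delta>1 \<delta>2 \<delta>3
  proof -
    define Y where "Y = d (pi/2) * (E (pi/2) - E \<theta>)"
    define Q where "Q = d 0 * cnj (d (pi/2)) * (E \<theta> - E 0) * cnj (E (pi/2) - E \<theta>)"
    have "of_real \<delta>1 * (d 0 * (E \<theta> - E 0)) = of_real \<delta>2 * Y"
      unfolding Y_def using that by algebra
    then have "of_real \<delta>1 * (d 0 * (E \<theta> - E 0)) * cnj Y = of_real \<delta>2 * (Y * cnj Y)" by (simp only: mult.assoc)
    moreover have "of_real \<delta>1 * (d 0 * (E \<theta> - E 0)) * cnj Y = of_real \<delta>1 * Q"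
      by (simp add: Y_def Q_def)
    ultimately have e: "of_real \<delta>1 * Q = of_real (\<delta>2 * (cmod Y)\<^sup>2)"
      by (simp only: complex_norm_square of_real_mult)
    have "Im (of_real \<delta>1 * Q) = 0" unfolding e by simp
    then have "\<delta>1 = 0" using Z unfolding Q_def[symmetric] Re_Im_complex_of_real_mult by simp
    moreover have "Y \<noteq> 0" using Z unfolding Y_def by auto
    ultimately show ?thesis using e by (simp flip: of_real_power of_real_mult)
  qed
  \<comment> \<open>The increment over length t in direction \<open>cis \<theta>\<close> with free
    real parameter \<rho>.\<close>
  define e where "e = (\<lambda>\<theta> t \<rho>. (2 * (of_real \<rho> * d \<theta>), of_real (N * t) * \<tau> \<theta> + of_real \<rho> * d \<theta> * E \<theta>))"
  have edge: "\<exists>\<rho>. F (h + of_real t * cis \<theta>') - F h = e \<theta>' t \<rho>" for h t \<theta>'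
    using supporting_parametrization[OF sup[of \<theta>'], of h t] unfolding e_def d_def E_def
    by (metis nonzero_mult_div_cancel_left prod.collapse times_divide_eq_right zero_neq_numeral)
  \<comment> \<open>The path runs from h by s, then by \<i> s q, and back. As q is the tangent of
    \<theta>, the closing side has direction \<open>cis \<theta>\<close> and signed length - s / cos
    \<theta>.\<close>
  have triangle: "\<exists>\<rho>1 \<rho>2 \<rho>3. F (h + of_real s) - F h = e 0 s \<rho>1 \<and>
      F (h + of_real s + of_real (s * q) * \<i>) - F (h + of_real s) = e (pi/2) (s * q) \<rho>2 \<and>
      e 0 s \<rho>1 + e (pi/2) (s * q) \<rho>2 + e \<theta> (- s / cos \<theta>) \<rho>3 = 0" for h s
  proof -
    define k1 k2 where "k1 = h + of_real s" and "k2 = k1 + of_real (s * q) * \<i>"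
    have k: "k2 + of_real (- s / cos \<theta>) * cis \<theta> = h"
      using trig by (simp add: k1_def k2_def q_def complex_eq_iff)
    obtain \<rho>1 where 1: "F k1 - F h = e 0 s \<rho>1" using edge[of h s 0] by (auto simp: k1_def)
    obtain \<rho>2 where 2: "F k2 - F k1 = e (pi/2) (s * q) \<rho>2" using edge[of k1 "s * q" "pi/2"] by (auto simp: k2_def)
    obtain \<rho>3 where 3: "F h - F k2 = e \<theta> (- s / cos \<theta>) \<rho>3"
      using edge[of k2 "- s / cos \<theta>" \<theta>] unfolding k by blast
    have sum: "e 0 s \<rho>1 + e (pi/2) (s * q) \<rho>2 + e \<theta> (- s / cos \<theta>) \<rho>3 = 0"
      unfolding 1[symmetric] 2[symmetric] 3[symmetric] by simp
    show ?thesis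
      by (rule exI[of _ \<rho>1], rule exI[of _ \<rho>2], rule exI[of _ \<rho>3], intro conjI sum)
        (use 1 2 in \<open>simp_all only: k1_def k2_def\<close>)
  qed
  obtain r1 r2 r3 where r: "F (0 + of_real 1) - F 0 = e 0 1 r1"
      "F (0 + of_real 1 + of_real (1 * q) * \<i>) - F (0 + of_real 1) = e (pi/2) (1 * q) r2"
      "e 0 1 r1 + e (pi/2) (1 * q) r2 + e \<theta> (- 1 / cos \<theta>) r3 = 0"
    using triangle[of 0 1] by (elim exE conjE) (rule that)
  \<comment> \<open>The unit triangle at 0 scaled by s solves the same closing condition, and
    \<open>uniq\<close> makes the solution unique. So the increments along the legs are homogeneous
    in s and do not depend on the base point h.\<close>
  have inc: "F (h + of_real s) - F h = e 0 s (s * r1)"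
    "F (h + of_real s + of_real (s * q) * \<i>) - F (h + of_real s) = e (pi/2) (s * q) (s * r2)" for h s
  proof -
    obtain \<rho>1 \<rho>2 \<rho>3 where \<rho>: "F (h + of_real s) - F h = e 0 s \<rho>1"
      "F (h + of_real s + of_real (s * q) * \<i>) - F (h + of_real s) = e (pi/2) (s * q) \<rho>2"
      "e 0 s \<rho>1 + e (pi/2) (s * q) \<rho>2 + e \<theta> (- s / cos \<theta>) \<rho>3 = 0"
      using triangle[of h s] by (elim exE conjE) (rule that)
    have "\<rho>1 - s * r1 = 0 \<and> \<rho>2 - s * r2 = 0"
    proof (rule uniq[of _ _ "\<rho>3 - s * r3"])
      have a: "of_real \<rho>1 * d 0 + of_real \<rho>2 * d (pi/2) + of_real \<rho>3 * d \<theta> = 0"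
        "of_real r1 * d 0 + of_real r2 * d (pi/2) + of_real r3 * d \<theta> = 0"
      proof -
        have half: "x + y + z = 0" if "2 * x + 2 * y + 2 * z = 0" for x y z :: complex
          using that by algebra
        have "2 * (of_real \<rho>1 * d 0) + 2 * (of_real \<rho>2 * d (pi/2)) + 2 * (of_real \<rho>3 * d \<theta>) = 0"
          "2 * (of_real r1 * d 0) + 2 * (of_real r2 * d (pi/2)) + 2 * (of_real r3 * d \<theta>) = 0"
          using \<rho>(3) r(3) unfolding e_def prod_eq_iff fst_add fst_conv fst_zero by blast+
        then show "of_real \<rho>1 * d 0 + of_real \<rho>2 * d (pi/2) + of_real \<rho>3 * d \<theta> = 0"
          "of_real r1 * d 0 + of_real r2 * d (pi/2) + of_real r3 * d \<theta> = 0"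
          using half by blast+
      qed
      show "of_real (\<rho>1 - s * r1) * d 0 + of_real (\<rho>2 - s * r2) * d (pi/2) + of_real (\<rho>3 - s * r3) * d \<theta> = 0"
        unfolding of_real_diff of_real_mult using a by algebra
      have b: "(of_real (N * s) * \<tau> 0 + of_real \<rho>1 * d 0 * E 0) + (of_real (N * (s * q)) * \<tau> (pi/2) + of_real \<rho>2 * d (pi/2) * E (pi/2))
         + (of_real (N * (- s / cos \<theta>)) * \<tau> \<theta> + of_real \<rho>3 * d \<theta> * E \<theta>) = 0"
         "(of_real (N * 1) * \<tau> 0 + of_real r1 * d 0 * E 0) + (of_real (N * (1 * q)) * \<tau> (pi/2) + of_real r2 * d (pi/2) * E (pi/2))
         + (of_real (N * (- 1 / cos \<theta>)) * \<tau> \<theta> + of_real r3 * d \<theta> * E \<theta>) = 0"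
        using \<rho>(3) r(3) unfolding e_def prod_eq_iff snd_add snd_conv snd_zero by blast+
      have c: "of_real (- s / cos \<theta>) = of_real s * (of_real (- 1 / cos \<theta>) :: complex)" by simp
      show "of_real (\<rho>1 - s * r1) * d 0 * E 0 + of_real (\<rho>2 - s * r2) * d (pi/2) * E (pi/2) + of_real (\<rho>3 - s * r3) * d \<theta> * E \<theta> = 0"
        using b unfolding of_real_diff of_real_mult of_real_1 c by algebra
    qed
    then show "F (h + of_real s) - F h = e 0 s (s * r1)"
      "F (h + of_real s + of_real (s * q) * \<i>) - F (h + of_real s) = e (pi/2) (s * q) (s * r2)"
      using \<rho> by auto
  qed
  define A B where "A = e 0 1 r1" and "B = e (pi/2) 1 (r2 / q)"
  have e_scale: "e \<phi> s (s * \<rho>) = (of_real s * fst (e \<phi> 1 \<rho>), of_real s * snd (e \<phi> 1 \<rho>))" for \<phi> s \<rho>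
    by (simp add: e_def algebra_simps)
  have Fh: "F h = (of_real (Re h) * fst A + of_real (Im h) * fst B, of_real (Re h) * snd A + of_real (Im h) * snd B)" for h
  proof -
    have 1: "F (of_real (Re h)) = e 0 (Re h) (Re h * r1)" using inc(1)[of 0 "Re h"] F0 by simp
    define k where "k = of_real (Re h) - complex_of_real (Im h / q)"
    have "F (k + of_real (Im h / q) + of_real (Im h / q * q) * \<i>) - F (k + of_real (Im h / q)) =
      e (pi/2) (Im h / q * q) (Im h / q * r2)" by (rule inc(2))
    moreover have "k + of_real (Im h / q) = of_real (Re h)" by (simp add: k_def)
    moreover have "of_real (Re h) + of_real (Im h) * \<i> = h" by (simp add: complex_eq_iff)
    moreover have "Im h / q * q = Im h" "Im h / q * r2 = Im h * (r2 / q)" using q by simp_all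
    ultimately have 2: "F h - F (of_real (Re h)) = e (pi/2) (Im h) (Im h * (r2 / q))" by metis
    have "F h = e 0 (Re h) (Re h * r1) + e (pi/2) (Im h) (Im h * (r2 / q))"
      using 1 2 by (metis add.commute diff_add_cancel)
    then show ?thesis unfolding e_scale A_def B_def by simp
  qed
  \<comment> \<open>The coefficients of h and \<open>cnj h\<close> in the real linear map
    \<open>F\<close>, whose first component is halved as in \<open>mlin\<close>.\<close>
  define c1 c2 P1 P2 where "c1 = (fst A - \<i> * fst B) / 4" and "c2 = (fst A + \<i> * fst B) / 4"
    and "P1 = (snd A - \<i> * snd B) / 2" and "P2 = (snd A + \<i> * snd B) / 2"
  have ReIm: "of_real (Re h) * x + of_real (Im h) * y = h * ((x - \<i> * y) / 2) + cnj h * ((x + \<i> * y) / 2)" for h x y :: complex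
    by (simp add: complex_eq_iff algebra_simps add_divide_distrib diff_divide_distrib)
  have fstF: "fst (F h) / 2 = c1 * h + c2 * cnj h" and sndF: "snd (F h) = P1 * h + P2 * cnj h" for h
    unfolding Fh ReIm fst_conv snd_conv c1_def c2_def P1_def P2_def by (simp_all add: field_simps)
  have L: "mlin p \<omega>' (F h) = (P1 - c1 * ell p \<omega>') * h + (P2 - c2 * ell p \<omega>') * cnj h" for \<omega>' h
    unfolding mlin_def fstF sndF by (simp add: algebra_simps)
  \<comment> \<open>The maximum of |A h + B \<open>cnj h\<close>| over |h| = 1 is |A| + |B|. It is
    at most N by contractivity, and N is attained in the direction that w supports.\<close>
  have sum: "cmod (P1 - c1 * ell p w) + cmod (P2 - c2 * ell p w) = N" if w: "w \<in> \<omega> ` {0<..<pi/2}" for w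
  proof (rule antisym)
    obtain \<phi> where \<phi>: "w = \<omega> \<phi>" using w by blast
    let ?A = "P1 - c1 * ell p w" and ?B = "P2 - c2 * ell p w"
    have "mlin p w (F (cis \<phi>)) = of_real N * \<tau> \<phi>"
      using supporting_increment[OF sup[of \<phi>], of 0 1] F0 by (simp add: \<phi>)
    then have "N = cmod (?A * cis \<phi> + ?B * cnj (cis \<phi>))" using N u by (metis L abs_of_pos mult.right_neutral norm_mult norm_of_real)
    also have "\<dots> \<le> cmod ?A + cmod ?B"
      using norm_triangle_ineq[of "?A * cis \<phi>" "?B * cnj (cis \<phi>)"] by (simp add: norm_mult)
    finally show "N \<le> cmod ?A + cmod ?B" .
    show "cmod ?A + cmod ?B \<le> N"
    proof (cases "?A = 0 \<or> ?B = 0")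
      case True
      then show ?thesis using contractive0[of w 1] u by (auto simp: L \<phi>)
    next
      case False
      \<comment> \<open>This square root turns the terms A h and B \<open>cnj h\<close> into the
        same direction, so that their moduli add up.\<close>
      define h where "h = csqrt (sgn ?B / sgn ?A)"
      have nn: "sgn ?A \<noteq> 0" "sgn ?B \<noteq> 0" using False by (auto simp: sgn_zero_iff)
      have h2: "h * h = sgn ?B / sgn ?A" by (simp add: h_def flip: power2_eq_square)
      have h1: "cmod h = 1" using False by (simp add: h_def norm_divide norm_sgn)
      have "?A * h + ?B * cnj h = (?A * (h * h) + ?B) * cnj h"
        using unit_cnj(1)[OF h1] by (simp add: algebra_simps)
      also have "?A * (h * h) + ?B = of_real (cmod ?A + cmod ?B) * sgn ?B"
      proof -
        have sg: "z = of_real (cmod z) * sgn z" for z :: complex by (simp add: sgn_eq)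
        have "?A * (h * h) = of_real (cmod ?A) * (sgn ?A * (sgn ?B / sgn ?A))"
          unfolding h2 by (subst sg[of ?A]) (rule mult.assoc)
        also have "sgn ?A * (sgn ?B / sgn ?A) = sgn ?B" using nn by simp
        finally have "?A * (h * h) = of_real (cmod ?A) * sgn ?B" .
        then show ?thesis using sg[of ?B] by (simp only: distrib_right of_real_add)
      qed
      finally have "cmod (mlin p w (F h)) = cmod ?A + cmod ?B"
        unfolding L using h1 False by (simp add: norm_mult norm_sgn flip: of_real_add)
      then show ?thesis using contractive0[of w h] h1 u by (simp add: \<phi>)
    qed
  qed
  have "cmod c1 = cmod c2"
    using u N by (intro sum_moduli_constant_imp[OF p0 _ W _ sum]) auto
  \<comment> \<open>Equal moduli of the coefficients give the first component a real kernel: c1 h^2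
    = - c2 has a solution with |h| = 1.\<close>
  then obtain h where h: "cmod h = 1" "c1 * h + c2 * cnj h = 0"
  proof (cases "c1 = 0")
    case True
    then show ?thesis using that[of 1] \<open>cmod c1 = cmod c2\<close> by simp
  next
    case False
    define h where "h = csqrt (- c2 / c1)"
    have "c2 \<noteq> 0" using False \<open>cmod c1 = cmod c2\<close> by (metis norm_eq_zero)
    then have h1: "cmod h = 1" using False \<open>cmod c1 = cmod c2\<close> by (simp add: h_def norm_divide)
    have "h * h = - c2 / c1" by (simp add: h_def flip: power2_eq_square)
    then have "(c1 * (h * h) + c2) * cnj h = 0" using False by simp
    moreover have "(c1 * (h * h) + c2) * cnj h = c1 * h * (h * cnj h) + c2 * cnj h" by (simp add: algebra_simps)
    ultimately show ?thesis using that[of h] h1 unit_cnj(1)[OF h1] by simp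
  qed
  \<comment> \<open>The parameter w supports \<i> h. As the first component vanishes along h, every
    parameter sees the same values there, so w supports h as well, although h and \<i> h are
    independent.\<close>
  obtain w t where wt: "supporting (\<i> * h) w t" using supporting_exists[of "\<i> * h"] h(1) by (auto simp: norm_mult)
  then have w: "cmod w = 1" by (simp add: supporting_def)
  obtain w' where w': "cmod w' = 1" "cmod (mlin p w' (F h)) = N" using attained[of h 0] F0 h(1) by auto
  have all: "mlin p \<omega>' (F (of_real t * h)) = of_real t * snd (F h)" for \<omega>' t
  proof -
    have "fst (F (of_real t * h)) / 2 = of_real t * (c1 * h + c2 * cnj h)"
      unfolding fstF by (simp add: algebra_simps)
    then have "fst (F (of_real t * h)) / 2 = 0" using h(2) by simp
    then show ?thesis unfolding mlin_def sndF by (simp add: algebra_simps)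
  qed
  have sN: "cmod (snd (F h)) = N" using w'(2) all[of w' 1] by simp
  have "supporting h w (snd (F h) / of_real N)"
    using sN N by (intro supportingI h w) (simp_all add: all norm_divide)
  then have "Im (cnj h * (\<i> * h)) = 0" using no wt by blast
  moreover have "cnj h * (\<i> * h) = \<i>" using unit_cnj(2)[OF h(1)] by (simp add: mult.left_commute)
  ultimately show False by simp
qed

theorem linear_or_conjugate_linear:
  assumes "p \<noteq> 0"
  shows "\<exists>T. (\<forall>h. F h = (h * fst T, h * snd T)) \<or> (\<forall>h. F h = (cnj h * fst T, cnj h * snd T))"
  using common_support_exists[OF assms] linear_if_common_support by blast

end

section \<open>Automorphisms and linear fractional maps\<close>

text \<open>The action of \<open>disc_aut \<alpha>\<close> on both roots z and w, written in z + w
  and z w. In this form it is linear fractional with one common denominator, which makes holomorphy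
  and difference quotients accessible without choosing roots.\<close>

definition G2_aut :: "complex \<Rightarrow> complex \<times> complex \<Rightarrow> complex \<times> complex"
  where "G2_aut \<alpha> x =
    (((1 + \<alpha> * cnj \<alpha>) * fst x - 2 * cnj \<alpha> * snd x - 2 * \<alpha>) / (1 - cnj \<alpha> * fst x + (cnj \<alpha>)\<^sup>2 * snd x),
     (snd x - \<alpha> * fst x + \<alpha>\<^sup>2) / (1 - cnj \<alpha> * fst x + (cnj \<alpha>)\<^sup>2 * snd x))"

lemma G2_pair:
  assumes "x \<in> G2"
  obtains z w where "x = (z + w, z * w)" "cmod z < 1" "cmod w < 1"
  using assms by (auto simp: symmetrized_bidisc_def)

lemma G2_pairI: "cmod z < 1 \<Longrightarrow> cmod w < 1 \<Longrightarrow> (z + w, z * w) \<in> G2"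
  by (auto simp: symmetrized_bidisc_def)

lemma G2_aut_denominator:
  assumes "cmod \<alpha> < 1" "x \<in> G2"
  shows "1 - cnj \<alpha> * fst x + (cnj \<alpha>)\<^sup>2 * snd x \<noteq> 0"
proof -
  obtain z w where x: "x = (z + w, z * w)" "cmod z < 1" "cmod w < 1" using assms(2) by (rule G2_pair)
  have "1 - cnj \<alpha> * fst x + (cnj \<alpha>)\<^sup>2 * snd x = (1 - cnj \<alpha> * z) * (1 - cnj \<alpha> * w)"
    by (simp add: x power2_eq_square algebra_simps)
  then show ?thesis using one_minus_cnj_nonzero assms(1) x(2,3) by simp
qed

lemma G2_aut_pair:
  assumes "cmod \<alpha> < 1" "cmod z < 1" "cmod w < 1"
  shows "G2_aut \<alpha> (z + w, z * w) = (disc_aut \<alpha> z + disc_aut \<alpha> w, disc_aut \<alpha> z * disc_aut \<alpha> w)"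
proof -
  have nz: "1 - cnj \<alpha> * z \<noteq> 0" "1 - cnj \<alpha> * w \<noteq> 0" using one_minus_cnj_nonzero assms by auto
  have den: "1 - cnj \<alpha> * (z + w) + (cnj \<alpha>)\<^sup>2 * (z * w) = (1 - cnj \<alpha> * z) * (1 - cnj \<alpha> * w)"
    by (simp add: power2_eq_square algebra_simps)
  have s: "(1 + \<alpha> * cnj \<alpha>) * (z + w) - 2 * cnj \<alpha> * (z * w) - 2 * \<alpha> =
    (z - \<alpha>) * (1 - cnj \<alpha> * w) + (w - \<alpha>) * (1 - cnj \<alpha> * z)"
    by (simp add: algebra_simps)
  have p: "z * w - \<alpha> * (z + w) + \<alpha>\<^sup>2 = (z - \<alpha>) * (w - \<alpha>)"
    by (simp add: power2_eq_square algebra_simps)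
  show ?thesis
    unfolding G2_aut_def fst_conv snd_conv den s p disc_aut_def using nz
    by (simp add: add_frac_eq mult.commute)
qed

lemma G2_aut_in:
  assumes "cmod \<alpha> < 1" "x \<in> G2"
  shows "G2_aut \<alpha> x \<in> G2"
proof -
  obtain z w where x: "x = (z + w, z * w)" "cmod z < 1" "cmod w < 1" using assms(2) by (rule G2_pair)
  show ?thesis
    unfolding x(1) G2_aut_pair[OF assms(1) x(2,3)]
    using disc_aut_less_1[OF assms(1) x(2)] disc_aut_less_1[OF assms(1) x(3)] by (rule G2_pairI)
qed

lemma G2_aut_inverse:
  assumes "cmod \<alpha> < 1" "x \<in> G2"
  shows "G2_aut (- \<alpha>) (G2_aut \<alpha> x) = x"
proof -
  obtain z w where x: "x = (z + w, z * w)" "cmod z < 1" "cmod w < 1" using assms(2) by (rule G2_pair)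
  have m: "cmod (- \<alpha>) < 1" using assms(1) by simp
  show ?thesis
    unfolding x(1) G2_aut_pair[OF assms(1) x(2,3)]
      G2_aut_pair[OF m disc_aut_less_1[OF assms(1) x(2)] disc_aut_less_1[OF assms(1) x(3)]]
      disc_aut_inverse[OF assms(1) x(2)] disc_aut_inverse[OF assms(1) x(3)] ..
qed

lemma G2_aut_holomorphic:
  assumes "cmod \<alpha> < 1" "holomorphic_map_on f S" "f ` S \<subseteq> G2"
  shows "holomorphic_map_on (\<lambda>z. G2_aut \<alpha> (f z)) S"
proof -
  have "1 - cnj \<alpha> * fst (f z) + (cnj \<alpha>)\<^sup>2 * snd (f z) \<noteq> 0" if "z \<in> S" for z
    using G2_aut_denominator[OF assms(1)] assms(3) that by blast
  then show ?thesis
    using assms(2) unfolding holomorphic_map_on_def G2_aut_def fst_conv snd_conv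
    by (elim conjE, intro conjI holomorphic_intros) blast+
qed

text \<open>The distance pulled back by the automorphism is again a disc-contractive pseudodistance,
  hence at most the largest one.\<close>

lemma kobayashi_G2_aut_le:
  assumes \<alpha>: "cmod \<alpha> < 1" and xy: "x \<in> G2" "y \<in> G2"
  shows "kobayashi_dist G2 (G2_aut \<alpha> x) (G2_aut \<alpha> y) \<le> kobayashi_dist G2 x y"
proof -
  define d where "d = (\<lambda>x y. kobayashi_dist G2 (G2_aut \<alpha> x) (G2_aut \<alpha> y))"
  have "pseudodistance_on G2 d"
    using kobayashi_dist_symmetrized_bidisc(1) G2_aut_in[OF \<alpha>]
    unfolding pseudodistance_on_def d_def by blast
  moreover have "disc_contractive G2 d"
    unfolding disc_contractive_def d_def
  proof (intro allI impI ballI)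
    fix \<phi> a b assume \<phi>: "holomorphic_map_on \<phi> unit_disc \<and> \<phi> ` unit_disc \<subseteq> G2"
      and ab: "a \<in> unit_disc" "b \<in> unit_disc"
    have "(\<lambda>z. G2_aut \<alpha> (\<phi> z)) ` unit_disc \<subseteq> G2" using \<phi> G2_aut_in[OF \<alpha>] by blast
    then show "kobayashi_dist G2 (G2_aut \<alpha> (\<phi> a)) (G2_aut \<alpha> (\<phi> b)) \<le> poincare_dist a b"
      using kobayashi_upper_bound[of "\<lambda>z. G2_aut \<alpha> (\<phi> z)" a b] G2_aut_holomorphic[OF \<alpha>] \<phi> ab by simp
  qed
  ultimately show ?thesis
    using kobayashi_dist_symmetrized_bidisc(3)[of d x y] xy by (simp add: d_def)
qed

lemma kobayashi_G2_aut:
  assumes \<alpha>: "cmod \<alpha> < 1" and xy: "x \<in> G2" "y \<in> G2"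
  shows "kobayashi_dist G2 (G2_aut \<alpha> x) (G2_aut \<alpha> y) = kobayashi_dist G2 x y"
proof (rule antisym)
  show "kobayashi_dist G2 (G2_aut \<alpha> x) (G2_aut \<alpha> y) \<le> kobayashi_dist G2 x y"
    by (rule kobayashi_G2_aut_le[OF assms])
  show "kobayashi_dist G2 x y \<le> kobayashi_dist G2 (G2_aut \<alpha> x) (G2_aut \<alpha> y)"
    using kobayashi_G2_aut_le[of "- \<alpha>" "G2_aut \<alpha> x" "G2_aut \<alpha> y"] \<alpha>
    by (simp add: G2_aut_in G2_aut_inverse xy)
qed

lemma G2_aut_royal_iff:
  assumes "cmod \<alpha> < 1" "x \<in> G2"
  shows "(fst (G2_aut \<alpha> x))\<^sup>2 = 4 * snd (G2_aut \<alpha> x) \<longleftrightarrow> (fst x)\<^sup>2 = 4 * snd x"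
proof -
  have *: "(a + b)\<^sup>2 = 4 * (a * b) \<longleftrightarrow> a = b" for a b :: complex
  proof -
    have "(a + b)\<^sup>2 - 4 * (a * b) = (a - b)\<^sup>2" by (simp add: power2_eq_square algebra_simps)
    then show ?thesis by (metis eq_iff_diff_eq_0 power2_eq_iff zero_power2 power_eq_0_iff)
  qed
  obtain z w where x: "x = (z + w, z * w)" "cmod z < 1" "cmod w < 1" using assms(2) by (rule G2_pair)
  have "disc_aut \<alpha> z = disc_aut \<alpha> w \<longleftrightarrow> z = w"
    using disc_aut_inverse[OF assms(1) x(2)] disc_aut_inverse[OF assms(1) x(3)] by metis
  then show ?thesis unfolding x(1) G2_aut_pair[OF assms(1) x(2,3)] fst_conv snd_conv * .
qed

text \<open>The new first coordinate vanishes if s = \<beta> + \<open>cnj \<beta> * p\<close> with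
  \<beta> = 2 \<alpha> / (1 + |\<alpha>|^2). Solving for \<beta> gives |\<beta>| < 1 precisely by
  the membership criterion, and \<alpha> = \<beta> / (1 + sqrt (1 - |\<beta>|^2)) is the root inside
  the disc. It is the hyperbolic midpoint of the two roots z and w.\<close>

lemma G2_center_exists:
  assumes "x \<in> G2"
  obtains \<alpha> where "cmod \<alpha> < 1" "fst (G2_aut \<alpha> x) = 0"
proof -
  obtain s p where x: "x = (s, p)" by (cases x)
  define \<beta> where "\<beta> = (s - cnj s * p) / of_real (1 - (cmod p)\<^sup>2)"
  have pos: "1 - (cmod p)\<^sup>2 > 0" using assms G2_bounds[of s p] by (simp add: x abs_square_less_1)
  have \<beta>: "cmod \<beta> < 1"
    using assms pos unfolding x mem_G2_iff \<beta>_def by (simp add: norm_divide del: of_real_diff)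
  have s: "s = \<beta> + cnj \<beta> * p"
  proof -
    have "\<beta> + cnj \<beta> * p = (s - cnj s * p + (cnj s - s * cnj p) * p) / of_real (1 - (cmod p)\<^sup>2)"
      by (simp add: \<beta>_def add_divide_distrib)
    also have "s - cnj s * p + (cnj s - s * cnj p) * p = s * of_real (1 - (cmod p)\<^sup>2)"
      unfolding of_real_diff of_real_cmod_power2 by (simp add: algebra_simps)
    finally show ?thesis using pos by (simp del: of_real_diff)
  qed
  define r where "r = sqrt (1 - (cmod \<beta>)\<^sup>2)"
  have r: "r > 0" "r\<^sup>2 = 1 - (cmod \<beta>)\<^sup>2" using \<beta> by (simp_all add: r_def abs_square_less_1 power_le_one)
  define \<alpha> where "\<alpha> = \<beta> / of_real (1 + r)"
  have \<alpha>: "cmod \<alpha> < 1"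
  proof -
    have "cmod \<alpha> = cmod \<beta> / (1 + r)" using r by (simp add: \<alpha>_def norm_divide del: of_real_add)
    then show ?thesis using \<beta> r by simp
  qed
  have "\<beta> * (1 + \<alpha> * cnj \<alpha>) = 2 * \<alpha>"
  proof -
    have "1 + \<alpha> * cnj \<alpha> = of_real (1 + (cmod \<beta>)\<^sup>2 / (1 + r)\<^sup>2)"
    proof -
      have "cmod \<alpha> = cmod \<beta> / (1 + r)" using r by (simp add: \<alpha>_def norm_divide del: of_real_add)
      then have "(cmod \<alpha>)\<^sup>2 = (cmod \<beta>)\<^sup>2 / (1 + r)\<^sup>2" by (simp only: power_divide)
      then show ?thesis unfolding complex_norm_square[symmetric] by (simp only: of_real_add of_real_1)
    qed
    also have "1 + (cmod \<beta>)\<^sup>2 / (1 + r)\<^sup>2 = 2 / (1 + r)"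
    proof -
      have "(cmod \<beta>)\<^sup>2 = (1 - r) * (1 + r)" using r(2) by (simp add: power2_eq_square algebra_simps)
      then have "(cmod \<beta>)\<^sup>2 / (1 + r)\<^sup>2 = (1 - r) / (1 + r)"
        using r(1) by (simp add: power2_eq_square)
      then show ?thesis using r(1) by (simp add: field_simps)
    qed
    finally show ?thesis by (simp add: \<alpha>_def)
  qed
  note b1 = this
  then have "cnj (\<beta> * (1 + \<alpha> * cnj \<alpha>)) = cnj (2 * \<alpha>)" by (rule arg_cong)
  then have "cnj \<beta> * (1 + cnj \<alpha> * \<alpha>) = 2 * cnj \<alpha>" by simp
  then have "cnj \<beta> * (1 + \<alpha> * cnj \<alpha>) = 2 * cnj \<alpha>" by (simp only: mult.commute[of "cnj \<alpha>" \<alpha>])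
  note b = b1 this
  have "(1 + \<alpha> * cnj \<alpha>) * s = \<beta> * (1 + \<alpha> * cnj \<alpha>) + (cnj \<beta> * (1 + \<alpha> * cnj \<alpha>)) * p"
    unfolding s by (simp add: algebra_simps)
  then have "(1 + \<alpha> * cnj \<alpha>) * s - 2 * cnj \<alpha> * p - 2 * \<alpha> = 0" unfolding b by simp
  then show ?thesis using that[of \<alpha>] \<alpha> by (simp add: G2_aut_def x)
qed

text \<open>Both points move, so this is strict differentiability: N (Y n) - N (X n) equals a form
  linear in Y n - X n over the product of the two denominators, and each ingredient
  converges.\<close>

lemma linear_fractional_difference_quotient:
  fixes X Y :: "'n \<Rightarrow> complex \<times> complex" and \<epsilon> :: "'n \<Rightarrow> real"
  assumes X: "(X \<longlongrightarrow> x) F" and Y: "(Y \<longlongrightarrow> x) F"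
    and V: "((\<lambda>n. (Y n - X n) /\<^sub>R \<epsilon> n) \<longlongrightarrow> V) F"
    and D: "a' * fst x + b' * snd x + c' \<noteq> 0"
    and N': "\<And>y. N y = (a * fst y + b * snd y + c) / (a' * fst y + b' * snd y + c')"
  shows "((\<lambda>n. (N (Y n) - N (X n)) /\<^sub>R \<epsilon> n) \<longlongrightarrow>
    ((a * fst V + b * snd V) * (a' * fst x + b' * snd x + c') -
     (a * fst x + b * snd x + c) * (a' * fst V + b' * snd V)) / (a' * fst x + b' * snd x + c')\<^sup>2) F"
proof -
  define D where "D = (\<lambda>y :: complex \<times> complex. a' * fst y + b' * snd y + c')"
  define A where "A = (\<lambda>y :: complex \<times> complex. a * fst y + b * snd y + c)"
  define W where "W = (\<lambda>n. (Y n - X n) /\<^sub>R \<epsilon> n)"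
  have DX: "((\<lambda>n. D (X n)) \<longlongrightarrow> D x) F" and DY: "((\<lambda>n. D (Y n)) \<longlongrightarrow> D x) F"
    and AX: "((\<lambda>n. A (X n)) \<longlongrightarrow> A x) F"
    unfolding D_def A_def by (intro tendsto_intros X Y)+
  have ne: "\<forall>\<^sub>F n in F. D (X n) \<noteq> 0" "\<forall>\<^sub>F n in F. D (Y n) \<noteq> 0"
    using tendsto_imp_eventually_ne[OF DX] tendsto_imp_eventually_ne[OF DY] assms(4) by (auto simp: D_def)
  have Wl: "(W \<longlongrightarrow> V) F" using V by (simp add: W_def)
  have "((\<lambda>n. ((a * fst (W n) + b * snd (W n)) * D (X n) - A (X n) * (a' * fst (W n) + b' * snd (W n))) / (D (X n) * D (Y n)))
    \<longlongrightarrow> ((a * fst V + b * snd V) * D x - A x * (a' * fst V + b' * snd V)) / (D x * D x)) F"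
    using assms(4) unfolding D_def[symmetric] by (intro tendsto_intros Wl DX DY AX) (simp add: D_def)
  moreover have "\<forall>\<^sub>F n in F. ((a * fst (W n) + b * snd (W n)) * D (X n) - A (X n) * (a' * fst (W n) + b' * snd (W n))) / (D (X n) * D (Y n))
     = (N (Y n) - N (X n)) /\<^sub>R \<epsilon> n"
    using ne
  proof eventually_elim
    fix n assume nz: "D (X n) \<noteq> 0" "D (Y n) \<noteq> 0"
    have "N (Y n) - N (X n) = (A (Y n) * D (X n) - A (X n) * D (Y n)) / (D (X n) * D (Y n))"
    proof -
      have "N (Y n) = A (Y n) / D (Y n)" "N (X n) = A (X n) / D (X n)" by (simp_all only: N' A_def D_def)
      then show ?thesis using nz by (simp add: diff_frac_eq mult.commute)
    qed
    moreover have "A (Y n) * D (X n) - A (X n) * D (Y n) =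
      (a * fst (Y n - X n) + b * snd (Y n - X n)) * D (X n) - A (X n) * (a' * fst (Y n - X n) + b' * snd (Y n - X n))"
      unfolding A_def D_def fst_diff snd_diff by (simp add: algebra_simps)
    ultimately have "(N (Y n) - N (X n)) /\<^sub>R \<epsilon> n =
      of_real (inverse (\<epsilon> n)) * (((a * fst (Y n - X n) + b * snd (Y n - X n)) * D (X n) - A (X n) * (a' * fst (Y n - X n) + b' * snd (Y n - X n))) / (D (X n) * D (Y n)))"
      by (simp only: scaleR_conv_of_real)
    also have "\<dots> = ((a * fst (W n) + b * snd (W n)) * D (X n) - A (X n) * (a' * fst (W n) + b' * snd (W n))) / (D (X n) * D (Y n))"
      unfolding W_def fst_scaleR snd_scaleR scaleR_conv_of_real by (simp add: algebra_simps)
    finally show "((a * fst (W n) + b * snd (W n)) * D (X n) - A (X n) * (a' * fst (W n) + b' * snd (W n))) / (D (X n) * D (Y n))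
     = (N (Y n) - N (X n)) /\<^sub>R \<epsilon> n" by simp
  qed
  ultimately have "((\<lambda>n. (N (Y n) - N (X n)) /\<^sub>R \<epsilon> n) \<longlongrightarrow>
      ((a * fst V + b * snd V) * D x - A x * (a' * fst V + b' * snd V)) / (D x * D x)) F"
    by (rule Lim_transform_eventually)
  then show ?thesis by (simp only: D_def A_def power2_eq_square)
qed

lemma magic_difference_quotient:
  assumes X: "(X \<longlongrightarrow> (0, p)) F" and Y: "(Y \<longlongrightarrow> (0, p)) F"
    and V: "((\<lambda>n. (Y n - X n) /\<^sub>R \<epsilon> n) \<longlongrightarrow> V) F" and \<omega>: "cmod \<omega> = 1"
  shows "((\<lambda>n. (magic \<omega> (Y n) - magic \<omega> (X n)) /\<^sub>R \<epsilon> n) \<longlongrightarrow> \<omega> * mlin p \<omega> V) F"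
proof -
  have "((- 1 * fst V + 2 * \<omega> * snd V) * (- \<omega> * fst (0, p) + 0 * snd (0, p) + 2) -
     (- 1 * fst (0, p) + 2 * \<omega> * snd (0, p) + 0) * (- \<omega> * fst V + 0 * snd V)) / (- \<omega> * fst (0, p) + 0 * snd (0, p) + 2)\<^sup>2
     = \<omega> * mlin p \<omega> V"
  proof -
    have "\<omega> * mlin p \<omega> V = \<omega> * snd V - fst V / 2 * (\<omega> * cnj \<omega>) + fst V / 2 * p * \<omega> * \<omega>"
      by (simp add: mlin_def ell_def algebra_simps add_divide_distrib diff_divide_distrib)
    then show ?thesis unfolding unit_cnj[OF \<omega>] by (simp add: algebra_simps add_divide_distrib diff_divide_distrib)
  qed
  moreover have "magic \<omega> y = (- 1 * fst y + 2 * \<omega> * snd y + 0) / (- \<omega> * fst y + 0 * snd y + 2)" for y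
    by (simp add: magic_def)
  ultimately show ?thesis
    using linear_fractional_difference_quotient[OF X Y V, of "- \<omega>" 0 2 "magic \<omega>" "- 1" "2 * \<omega>" 0] by simp
qed

text \<open>Kept in the unsimplified shape produced by
  \<open>linear_fractional_difference_quotient\<close>. Only homogeneity and the value at 0 are ever
  read off from the formula.\<close>

definition G2_aut_deriv :: "complex \<Rightarrow> complex \<times> complex \<Rightarrow> complex \<times> complex \<Rightarrow> complex \<times> complex"
  where "G2_aut_deriv \<alpha> x V =
    ((((1 + \<alpha> * cnj \<alpha>) * fst V + - 2 * cnj \<alpha> * snd V) * (- cnj \<alpha> * fst x + (cnj \<alpha>)\<^sup>2 * snd x + 1) -
     ((1 + \<alpha> * cnj \<alpha>) * fst x + - 2 * cnj \<alpha> * snd x + - 2 * \<alpha>) * (- cnj \<alpha> * fst V + (cnj \<alpha>)\<^sup>2 * snd V)) /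
       (- cnj \<alpha> * fst x + (cnj \<alpha>)\<^sup>2 * snd x + 1)\<^sup>2,
     ((- \<alpha> * fst V + 1 * snd V) * (- cnj \<alpha> * fst x + (cnj \<alpha>)\<^sup>2 * snd x + 1) -
     (- \<alpha> * fst x + 1 * snd x + \<alpha>\<^sup>2) * (- cnj \<alpha> * fst V + (cnj \<alpha>)\<^sup>2 * snd V)) /
       (- cnj \<alpha> * fst x + (cnj \<alpha>)\<^sup>2 * snd x + 1)\<^sup>2)"

lemma G2_aut_deriv_cmult:
  "G2_aut_deriv \<alpha> x (h * u, h * v) = (h * fst (G2_aut_deriv \<alpha> x (u, v)), h * snd (G2_aut_deriv \<alpha> x (u, v)))"
  unfolding G2_aut_deriv_def fst_conv snd_conv times_divide_eq_right
  by (intro arg_cong2[of _ _ _ _ Pair] arg_cong2[of _ _ _ _ "(/)"]) (simp_all add: algebra_simps)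

lemma G2_aut_difference_quotient:
  assumes X: "(X \<longlongrightarrow> x) F" and Y: "(Y \<longlongrightarrow> x) F"
    and V: "((\<lambda>n. (Y n - X n) /\<^sub>R \<epsilon> n) \<longlongrightarrow> V) F" and \<alpha>: "cmod \<alpha> < 1" and x: "x \<in> G2"
  shows "((\<lambda>n. (G2_aut \<alpha> (Y n) - G2_aut \<alpha> (X n)) /\<^sub>R \<epsilon> n) \<longlongrightarrow> G2_aut_deriv \<alpha> x V) F"
proof -
  have nz: "- cnj \<alpha> * fst x + (cnj \<alpha>)\<^sup>2 * snd x + 1 \<noteq> 0"
    using G2_aut_denominator[OF \<alpha> x] by (simp add: algebra_simps)
  have e: "1 - cnj \<alpha> * s + (cnj \<alpha>)\<^sup>2 * p = - cnj \<alpha> * s + (cnj \<alpha>)\<^sup>2 * p + 1" for s p by simp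
  have 1: "fst (G2_aut \<alpha> y) = ((1 + \<alpha> * cnj \<alpha>) * fst y + - 2 * cnj \<alpha> * snd y + - 2 * \<alpha>) /
      (- cnj \<alpha> * fst y + (cnj \<alpha>)\<^sup>2 * snd y + 1)" for y
    unfolding G2_aut_def fst_conv e by simp
  have 2: "snd (G2_aut \<alpha> y) = (- \<alpha> * fst y + 1 * snd y + \<alpha>\<^sup>2) /
      (- cnj \<alpha> * fst y + (cnj \<alpha>)\<^sup>2 * snd y + 1)" for y
    unfolding G2_aut_def snd_conv e by simp
  have "((\<lambda>n. ((fst (G2_aut \<alpha> (Y n)) - fst (G2_aut \<alpha> (X n))) /\<^sub>R \<epsilon> n,
    (snd (G2_aut \<alpha> (Y n)) - snd (G2_aut \<alpha> (X n))) /\<^sub>R \<epsilon> n)) \<longlongrightarrow> G2_aut_deriv \<alpha> x V) F"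
    unfolding G2_aut_deriv_def
    by (intro tendsto_Pair linear_fractional_difference_quotient[OF X Y V nz 1]
        linear_fractional_difference_quotient[OF X Y V nz 2])
  then show ?thesis by (simp add: scaleR_prod_def minus_prod_def)
qed

section \<open>Upper bound of the Kobayashi distance at nearby points\<close>

text \<open>The given disc passes through X n and Y n only to first order. Shrinking its parameter
  by r keeps the image at positive distance from the boundary of \<open>G2\<close>, which leaves
  room for a small affine correction making it pass through both points. The price is the factor 1 /
  r, and r may be taken close to 1.\<close>

lemma kobayashi_local_upper_bound:
  fixes X Y :: "'n \<Rightarrow> complex \<times> complex" and \<epsilon> :: "'n \<Rightarrow> real"
  assumes \<phi>: "holomorphic_map_on \<phi> unit_disc" "\<phi> ` unit_disc \<subseteq> G2"
    and d\<phi>: "((\<lambda>z. fst (\<phi> z)) has_field_derivative A) (at 0)" "((\<lambda>z. snd (\<phi> z)) has_field_derivative B) (at 0)"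
    and q: "q > 0" and r: "0 < r" "r < 1"
    and \<epsilon>: "(\<epsilon> \<longlongrightarrow> 0) F" "\<forall>\<^sub>F n in F. \<epsilon> n > 0"
    and X: "(X \<longlongrightarrow> \<phi> 0) F" and V: "((\<lambda>n. (Y n - X n) /\<^sub>R \<epsilon> n) \<longlongrightarrow> (of_real q * A, of_real q * B)) F"
  shows "\<forall>\<^sub>F n in F. \<epsilon> n * q / r < 1 \<and> kobayashi_dist G2 (X n) (Y n) \<le> artanh (\<epsilon> n * q / r)"
proof -
  have cont: "continuous_on unit_disc \<phi>"
    using \<phi>(1) unfolding holomorphic_map_on_def
    by (metis (no_types, lifting) continuous_on_Pair continuous_on_cong holomorphic_on_imp_continuous_on prod.collapse)
  have sub: "cball 0 r \<subseteq> unit_disc" using r by auto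
  have "compact (\<phi> ` cball 0 r)"
    using cont sub by (intro compact_continuous_image) (auto intro: continuous_on_subset)
  moreover have "\<phi> ` cball 0 r \<subseteq> G2" using \<phi>(2) sub by blast
  ultimately obtain e where e: "e > 0" "(\<Union>x\<in>\<phi> ` cball 0 r. ball x e) \<subseteq> G2"
    using compact_subset_open_imp_ball_epsilon_subset[OF _ open_G2] by metis
  define t where "t = (\<lambda>n. \<epsilon> n * q / r)"
  \<comment> \<open>The slope of the correction: it is chosen so that the corrected disc takes the
    value Y n at t n. It tends to 0 because both difference quotients have the same limit.\<close>
  define E where "E = (\<lambda>n. (Y n - X n - (\<phi> (of_real (\<epsilon> n * q)) - \<phi> 0)) /\<^sub>R t n)"
  have \<epsilon>q: "((\<lambda>n. complex_of_real (\<epsilon> n * q)) \<longlongrightarrow> 0) F" using \<epsilon>(1) by (auto intro!: tendsto_eq_intros)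
  have quot: "((\<lambda>n. (g (of_real (\<epsilon> n * q)) - g 0) /\<^sub>R \<epsilon> n) \<longlongrightarrow> of_real q * C) F"
    if "(g has_field_derivative C) (at 0)" for g :: "complex \<Rightarrow> complex" and C
  proof -
    have 1: "filterlim (\<lambda>n. complex_of_real (\<epsilon> n * q)) (at 0) F"
      using \<epsilon>q \<epsilon>(2) q by (intro filterlim_atI) (auto elim!: eventually_mono)
    have 2: "((\<lambda>z. (g z - g 0) / z) \<longlongrightarrow> C) (at 0)" using that by (simp add: has_field_derivative_iff)
    have "((\<lambda>n. (g (of_real (\<epsilon> n * q)) - g 0) / of_real (\<epsilon> n * q)) \<longlongrightarrow> C) F"
      by (rule filterlim_compose[OF 2 1])
    then have "((\<lambda>n. of_real q * ((g (of_real (\<epsilon> n * q)) - g 0) / of_real (\<epsilon> n * q))) \<longlongrightarrow> of_real q * C) F"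
      by (intro tendsto_intros)
    moreover have "of_real q * (d / of_real (\<epsilon> n * q)) = d /\<^sub>R \<epsilon> n" for d :: complex and n
      using q by (simp add: scaleR_conv_of_real divide_inverse)
    ultimately show ?thesis by simp
  qed
  have "((\<lambda>n. ((fst (\<phi> (of_real (\<epsilon> n * q))) - fst (\<phi> 0)) /\<^sub>R \<epsilon> n, (snd (\<phi> (of_real (\<epsilon> n * q))) - snd (\<phi> 0)) /\<^sub>R \<epsilon> n))
    \<longlongrightarrow> (of_real q * A, of_real q * B)) F"
    by (intro tendsto_Pair quot d\<phi>)
  then have "((\<lambda>n. (\<phi> (of_real (\<epsilon> n * q)) - \<phi> 0) /\<^sub>R \<epsilon> n) \<longlongrightarrow> (of_real q * A, of_real q * B)) F"
    by (simp add: scaleR_prod_def minus_prod_def)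
  then have "((\<lambda>n. (r / q) *\<^sub>R ((Y n - X n) /\<^sub>R \<epsilon> n - (\<phi> (of_real (\<epsilon> n * q)) - \<phi> 0) /\<^sub>R \<epsilon> n)) \<longlongrightarrow>
     (r / q) *\<^sub>R ((of_real q * A, of_real q * B) - (of_real q * A, of_real q * B))) F"
    by (intro tendsto_intros V)
  moreover have "(r / q) *\<^sub>R ((Y n - X n) /\<^sub>R \<epsilon> n - (\<phi> (of_real (\<epsilon> n * q)) - \<phi> 0) /\<^sub>R \<epsilon> n) = E n" for n
    by (simp add: E_def t_def scaleR_right_diff_distrib[symmetric] divide_inverse mult_ac)
  ultimately have E: "(E \<longlongrightarrow> 0) F" by simp
  have "(t \<longlongrightarrow> 0) F" unfolding t_def using \<epsilon>(1) r by (auto intro!: tendsto_eq_intros)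
  then have t1: "\<forall>\<^sub>F n in F. t n < 1" by (rule order_tendstoD) simp
  have t0: "\<forall>\<^sub>F n in F. t n > 0" using \<epsilon>(2) q r by (auto elim!: eventually_mono simp: t_def)
  have X': "\<forall>\<^sub>F n in F. dist (X n) (\<phi> 0) < e / 2" using X e(1) by (intro tendstoD) auto
  have E': "\<forall>\<^sub>F n in F. dist (E n) 0 < e / 4" using E e(1) by (intro tendstoD) auto
  show ?thesis using t1 t0 X' E'
  proof eventually_elim
    case (elim n)
    define \<psi> where "\<psi> = (\<lambda>z. (fst (\<phi> (of_real r * z)) + fst (X n - \<phi> 0) + z * fst (E n),
       snd (\<phi> (of_real r * z)) + snd (X n - \<phi> 0) + z * snd (E n)))"
    have rz: "of_real r * z \<in> unit_disc" "of_real r * z \<in> cball 0 r" if "z \<in> unit_disc" for z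
    proof -
      have le: "r * cmod z \<le> r * 1" using that r by (intro mult_left_mono) auto
      have "cmod (of_real r * z) = r * cmod z" using r by (simp add: norm_mult)
      then show "of_real r * z \<in> unit_disc" "of_real r * z \<in> cball 0 r"
        using le r unfolding mem_ball_0 mem_cball_0 by linarith+
    qed
    have comp: "(\<lambda>z. g (of_real r * z)) holomorphic_on unit_disc" if "g holomorphic_on unit_disc" for g
    proof -
      have "(\<lambda>z. of_real r * z) ` unit_disc \<subseteq> unit_disc" using rz(1) by blast
      moreover have "(\<lambda>z. of_real r * z) holomorphic_on unit_disc" by (intro holomorphic_intros)
      ultimately have "g \<circ> (\<lambda>z. of_real r * z) holomorphic_on unit_disc"
        using that by (intro holomorphic_on_compose_gen)
      then show ?thesis by (simp only: comp_def)
    qed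
    have "holomorphic_map_on \<psi> unit_disc"
      using \<phi>(1) unfolding holomorphic_map_on_def \<psi>_def fst_conv snd_conv
      by (intro conjI holomorphic_intros comp) auto
    moreover have "\<psi> ` unit_disc \<subseteq> G2"
    proof
      fix y assume "y \<in> \<psi> ` unit_disc"
      then obtain z where z: "z \<in> unit_disc" "y = \<psi> z" by blast
      have y: "y - \<phi> (of_real r * z) = (X n - \<phi> 0) + (z * fst (E n), z * snd (E n))"
        by (simp add: z \<psi>_def prod_eq_iff)
      have "cmod (z * fst (E n)) \<le> 1 * cmod (fst (E n))" "cmod (z * snd (E n)) \<le> 1 * cmod (snd (E n))"
        unfolding norm_mult using z by (intro mult_right_mono; simp)+
      moreover have "cmod (fst (E n)) \<le> norm (E n)" "cmod (snd (E n)) \<le> norm (E n)"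
        using norm_fst_le[of "fst (E n)" "snd (E n)"] norm_snd_le[of "snd (E n)" "fst (E n)"] by simp_all
      moreover have "norm (z * fst (E n), z * snd (E n)) \<le> cmod (z * fst (E n)) + cmod (z * snd (E n))"
        by (rule norm_Pair_le)
      ultimately have "norm (z * fst (E n), z * snd (E n)) \<le> 2 * norm (E n)" by linarith
      then have "norm (y - \<phi> (of_real r * z)) < e"
        unfolding y using norm_triangle_ineq[of "X n - \<phi> 0" "(z * fst (E n), z * snd (E n))"] elim(3,4)
        by (simp add: dist_norm)
      then have "y \<in> ball (\<phi> (of_real r * z)) e" by (simp add: dist_norm norm_minus_commute)
      then show "y \<in> G2" using e(2) rz(2)[OF z(1)] by blast
    qed
    ultimately have "kobayashi_dist G2 (\<psi> 0) (\<psi> (of_real (t n))) \<le> poincare_dist 0 (of_real (t n))"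
      using elim by (intro kobayashi_upper_bound) auto
    moreover have "\<psi> 0 = X n" by (simp add: \<psi>_def)
    moreover have "\<psi> (of_real (t n)) = Y n"
    proof -
      have "of_real r * of_real (t n) = (of_real (\<epsilon> n * q) :: complex)" using r by (simp add: t_def)
      moreover have "t n *\<^sub>R E n = Y n - X n - (\<phi> (of_real (\<epsilon> n * q)) - \<phi> 0)" using elim by (simp add: E_def)
      then have "of_real (t n) * fst (E n) = fst (Y n - X n - (\<phi> (of_real (\<epsilon> n * q)) - \<phi> 0))"
        "of_real (t n) * snd (E n) = snd (Y n - X n - (\<phi> (of_real (\<epsilon> n * q)) - \<phi> 0))"
        by (metis fst_scaleR scaleR_conv_of_real, metis snd_scaleR scaleR_conv_of_real)
      ultimately show ?thesis unfolding \<psi>_def by (simp add: prod_eq_iff)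
    qed
    moreover have "poincare_dist 0 (of_real (t n)) = artanh (t n)" using elim by (simp add: poincare_dist_def)
    ultimately show ?case using elim unfolding t_def by simp
  qed
qed

section \<open>Extremal discs\<close>

lemma nonneg_quadratic_imp:
  fixes A B C :: real
  assumes nn: "\<And>x. 0 \<le> A * x\<^sup>2 + B * x + C"
  shows "0 \<le> A" "B\<^sup>2 \<le> 4 * A * C"
proof -
  have C: "0 \<le> C" using nn[of 0] by simp
  show A: "0 \<le> A"
  proof (rule ccontr)
    assume "\<not> 0 \<le> A"
    then have A: "A < 0" by simp
    define x where "x = sqrt ((C + 1) / (- A))"
    have "0 \<le> (C + 1) / (- A)" using A C by (intro divide_nonneg_nonneg) auto
    then have x2: "x\<^sup>2 = (C + 1) / (- A)" by (simp add: x_def)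
    have "A * x\<^sup>2 = - (C + 1)" unfolding x2 using A by simp
    then show False using nn[of x] nn[of "- x"] by simp
  qed
  show "B\<^sup>2 \<le> 4 * A * C"
  proof (cases "A = 0")
    case True
    have "B = 0"
    proof (rule ccontr)
      assume "B \<noteq> 0"
      then show False using nn[of "- (C + 1) / B"] True by simp
    qed
    then show ?thesis using True by simp
  next
    case False
    then have "A > 0" using A by simp
    have "A * (- B / (2 * A))\<^sup>2 + B * (- B / (2 * A)) + C = C - B\<^sup>2 / (4 * A)"
      using False by (simp add: field_simps power2_eq_square)
    then have "B\<^sup>2 / (4 * A) \<le> C" using nn[of "- B / (2 * A)"] by simp
    then show ?thesis using \<open>A > 0\<close> by (simp add: field_simps)
  qed
qed

text \<open>Put w = t - l. Then w^2 is the real quadratic Q x = A x^2 + B x + C, extended to complex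
  arguments, at l. As Q \<ge> 0 on the reals, its discriminant bounds |w|^2 by Q (Re l) + A (Im
  l)^2, whence (Im w)^2 \<le> A (Im l)^2 with A = 1 - a.\<close>

lemma upper_half_plane_root:
  fixes a x0 y0 :: real and l t :: complex
  assumes a: "0 \<le> a"
    and bound: "\<And>x::real. a * ((x - x0)\<^sup>2 + y0\<^sup>2) \<le> x\<^sup>2 + 1"
    and l: "Im l > 0"
    and root: "t\<^sup>2 - 2 * l * t + (of_real a * ((l - of_real x0)\<^sup>2 + of_real (y0\<^sup>2)) - 1) = 0"
  shows "Im t > 0"
proof -
  define A B C where "A = 1 - a" and "B = 2 * a * x0" and "C = 1 - a * (x0\<^sup>2 + y0\<^sup>2)"
  define Q where "Q = (\<lambda>x. A * x\<^sup>2 + B * x + C)"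
  define x y where "x = Re l" and "y = Im l"
  define w where "w = t - l"
  have Q: "0 \<le> Q x" for x using bound[of x] by (simp add: Q_def A_def B_def C_def power2_eq_square algebra_simps)
  have A: "0 \<le> A" and disc: "B\<^sup>2 \<le> 4 * A * C" using nonneg_quadratic_imp[of A B C] Q by (auto simp: Q_def)
  have "w\<^sup>2 = l\<^sup>2 - (of_real a * ((l - of_real x0)\<^sup>2 + of_real (y0\<^sup>2)) - 1)"
    using root by (simp add: w_def power2_eq_square algebra_simps)
  then have "Re (w\<^sup>2) = Re (l\<^sup>2 - (of_real a * ((l - of_real x0)\<^sup>2 + of_real (y0\<^sup>2)) - 1))"
    "Im (w\<^sup>2) = Im (l\<^sup>2 - (of_real a * ((l - of_real x0)\<^sup>2 + of_real (y0\<^sup>2)) - 1))" by simp_all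
  then have Re: "(Re w)\<^sup>2 - (Im w)\<^sup>2 = Q x - A * y\<^sup>2" and Im: "2 * Re w * Im w = y * (2 * A * x + B)"
    by (simp_all add: Q_def A_def B_def C_def x_def y_def power2_eq_square algebra_simps)
  have y: "y > 0" using l by (simp add: y_def)
  define m where "m = (Re w)\<^sup>2 + (Im w)\<^sup>2"
  have m0: "0 \<le> m" by (simp add: m_def)
  have "m\<^sup>2 = ((Re w)\<^sup>2 - (Im w)\<^sup>2)\<^sup>2 + (2 * Re w * Im w)\<^sup>2"
    by (simp add: m_def power2_eq_square algebra_simps)
  also have "\<dots> = (Q x - A * y\<^sup>2)\<^sup>2 + y\<^sup>2 * (2 * A * x + B)\<^sup>2" by (simp add: Re Im power_mult_distrib)
  finally have m2: "m\<^sup>2 = (Q x - A * y\<^sup>2)\<^sup>2 + y\<^sup>2 * (2 * A * x + B)\<^sup>2" .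
  have sq: "(2 * A * x + B)\<^sup>2 = 4 * A * Q x + (B\<^sup>2 - 4 * A * C)"
    by (simp add: Q_def power2_eq_square algebra_simps)
  have id: "(Q x + A * y\<^sup>2)\<^sup>2 = (Q x - A * y\<^sup>2)\<^sup>2 + y\<^sup>2 * (4 * A * Q x)"
    by (simp add: power2_eq_square algebra_simps)
  have pos: "0 \<le> Q x + A * y\<^sup>2" using Q[of x] A by simp
  have "y\<^sup>2 * (2 * A * x + B)\<^sup>2 \<le> y\<^sup>2 * (4 * A * Q x)" using disc sq by (intro mult_left_mono) auto
  then have "m\<^sup>2 \<le> (Q x + A * y\<^sup>2)\<^sup>2" using m2 id by linarith
  then have m: "m \<le> Q x + A * y\<^sup>2" using pos power2_le_imp_le by blast
  have two: "2 * (Im w)\<^sup>2 = m - (Q x - A * y\<^sup>2)" using Re by (simp add: m_def)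
  \<comment> \<open>For a = 0 the factor A is 1 and the bound above is not strict, but then Q x =
    x^2 + 1 has strictly negative discriminant.\<close>
  have "(Im w)\<^sup>2 < y\<^sup>2"
  proof (cases "a = 0")
    case True
    then have ABC: "A = 1" "B = 0" "C = 1" by (simp_all add: A_def B_def C_def)
    have "y\<^sup>2 * (2 * A * x + B)\<^sup>2 < y\<^sup>2 * (4 * A * Q x)"
      using y sq by (intro mult_strict_left_mono) (auto simp: ABC)
    then have "m\<^sup>2 < (Q x + A * y\<^sup>2)\<^sup>2" using m2 id by linarith
    then have "m < Q x + A * y\<^sup>2" using pos power2_less_imp_less by blast
    then show ?thesis using two ABC by simp
  next
    case False
    then have "A < 1" using a by (simp add: A_def)
    then have "A * y\<^sup>2 < 1 * y\<^sup>2" using y by (intro mult_strict_right_mono) auto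
    then show ?thesis using m two by simp
  qed
  then have "\<bar>Im w\<bar> < y" using y by (metis abs_of_pos power2_less_imp_less abs_ge_zero power2_abs less_eq_real_def)
  then show ?thesis by (simp add: w_def y_def)
qed

lemma Cayley_less_1:
  assumes "Im t > 0"
  shows "cmod ((t - \<i>) / (t + \<i>)) < 1" "t + \<i> \<noteq> 0"
proof -
  show nz: "t + \<i> \<noteq> 0" using assms by (auto simp: complex_eq_iff)
  have "(cmod (t - \<i>))\<^sup>2 < (cmod (t + \<i>))\<^sup>2"
    unfolding cmod_power2 using assms by (simp add: power2_eq_square algebra_simps)
  then have "cmod (t - \<i>) < cmod (t + \<i>)" by (simp add: power_less_imp_less_base)
  then show "cmod ((t - \<i>) / (t + \<i>)) < 1" using nz by (simp add: norm_divide)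
qed

text \<open>Two points of the upper half-plane with mean m and product n are carried to the disc by
  the Cayley map; the displayed pair is the sum and the product of their images.\<close>

lemma Cayley_pair_in_G2:
  assumes "\<And>t. t\<^sup>2 - 2 * m * t + n = 0 \<Longrightarrow> Im t > 0"
  shows "n + 2 * \<i> * m - 1 \<noteq> 0"
    "(2 * (n + 1) / (n + 2 * \<i> * m - 1), (n - 2 * \<i> * m - 1) / (n + 2 * \<i> * m - 1)) \<in> G2"
proof -
  obtain t u where tu: "2 * m = t + u" "n = t * u" by (rule root_pair_exists)
  have "t\<^sup>2 - 2 * m * t + n = 0" "u\<^sup>2 - 2 * m * u + n = 0"
    unfolding tu by (simp_all add: power2_eq_square algebra_simps)
  then have "Im t > 0" "Im u > 0" by (blast intro: assms)+
  note t = Cayley_less_1[OF this(1)] and u = Cayley_less_1[OF this(2)]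
  have den: "n + 2 * \<i> * m - 1 = (t + \<i>) * (u + \<i>)"
    using tu by (simp add: algebra_simps mult.left_commute[of 2] flip: mult.assoc)
  show "n + 2 * \<i> * m - 1 \<noteq> 0" using t u by (simp add: den)
  have s: "(t - \<i>) / (t + \<i>) + (u - \<i>) / (u + \<i>) = 2 * (n + 1) / (n + 2 * \<i> * m - 1)"
    unfolding den using t(2) u(2) by (simp add: tu add_frac_eq algebra_simps)
  have p: "(t - \<i>) / (t + \<i>) * ((u - \<i>) / (u + \<i>)) = (n - 2 * \<i> * m - 1) / (n + 2 * \<i> * m - 1)"
  proof -
    have "(t - \<i>) * (u - \<i>) = n - \<i> * (2 * m) - 1" unfolding tu by (simp add: algebra_simps)
    then show ?thesis unfolding den by (simp add: mult.left_commute mult.assoc)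
  qed
  show "(2 * (n + 1) / (n + 2 * \<i> * m - 1), (n - 2 * \<i> * m - 1) / (n + 2 * \<i> * m - 1)) \<in> G2"
    unfolding symmetrized_bidisc_def using t(1) u(1) s p
    by (intro CollectI exI[of _ "(t - \<i>) / (t + \<i>)"] exI[of _ "(u - \<i>) / (u + \<i>)"]) simp
qed

lemma mlin_vanishes_imp:
  assumes "cmod p < 1" "mlin p 1 X = 0" "mlin p (- 1) X = 0"
  shows "X = 0"
proof -
  have "p \<noteq> 1" using assms by auto
  have e: "ell p 1 = 1 - p" "ell p (- 1) = - (1 - p)" by (simp_all add: ell_def)
  have "snd X = 0" "fst X / 2 * (1 - p) = 0" using assms(2,3) unfolding mlin_def e by algebra+
  then show ?thesis using \<open>p \<noteq> 1\<close> by (simp add: prod_eq_iff)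
qed

text \<open>
  In the half-plane model with the boundary point \<open>cnj \<omega>\<close> moved to infinity, the disc is given by
  the mean \<open>m = \<lambda>\<close> and the product \<open>n = a ((\<lambda> - x0)\<^sup>2 + y0\<^sup>2) - 1\<close> of the two points.
\<close>

lemma extremal_disc_1:
  assumes p: "cmod p < 1" and X: "X \<noteq> 0"
    and max: "\<And>\<omega>'. cmod \<omega>' = 1 \<Longrightarrow> cmod (mlin p \<omega>' X) \<le> cmod (mlin p 1 X)"
  shows "\<exists>\<phi>. holomorphic_map_on \<phi> unit_disc \<and> \<phi> ` unit_disc \<subseteq> G2 \<and> \<phi> 0 = (0, p) \<and>
    ((\<lambda>z. fst (\<phi> z)) has_field_derivative fst X * of_real ((1 - (cmod p)\<^sup>2) / cmod (mlin p 1 X))) (at 0) \<and>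
    ((\<lambda>z. snd (\<phi> z)) has_field_derivative snd X * of_real ((1 - (cmod p)\<^sup>2) / cmod (mlin p 1 X))) (at 0)"
proof -
  define M S where "M = mlin p 1 X" and "S = fst X"
  have M: "M \<noteq> 0"
  proof
    assume M: "M = 0"
    then have "mlin p (- 1) X = 0" using max[of "-1"] by (simp add: M_def)
    then show False using mlin_vanishes_imp[OF p] M X unfolding M_def by blast
  qed
  have P: "snd X = M + S / 2 * (1 - p)" by (simp add: M_def S_def mlin_def ell_def)
  have p1: "1 + p \<noteq> 0" using one_minus_nonzero[of p "-1"] p by simp
  \<comment> \<open>The roots belonging to (0, p) are opposite. Their half-plane counterparts have
    product - 1 and this mean.\<close>
  define m0 where "m0 = \<i> * (1 - p) / (1 + p)"
  define x0 y0 where "x0 = Re m0" and "y0 = Im m0"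
  have m0: "m0 = of_real x0 + \<i> * of_real y0" by (simp add: x0_def y0_def complex_eq_iff)
  have y0: "y0 = (1 - (cmod p)\<^sup>2) / (cmod (1 + p))\<^sup>2"
  proof -
    have "(1 - p) / (1 + p) = (1 - p) * cnj (1 + p) / of_real ((cmod (1 + p))\<^sup>2)"
      unfolding complex_norm_square using p1 by (simp add: complex_cnj_add[symmetric] del: complex_cnj_add)
    then have "Re ((1 - p) / (1 + p)) = Re ((1 - p) * cnj (1 + p)) / (cmod (1 + p))\<^sup>2"
      by (simp only: Re_divide_of_real)
    also have "Re ((1 - p) * cnj (1 + p)) = 1 - (cmod p)\<^sup>2"
      unfolding cmod_power2 by (simp add: power2_eq_square algebra_simps)
    finally have "Re ((1 - p) / (1 + p)) = (1 - (cmod p)\<^sup>2) / (cmod (1 + p))\<^sup>2" .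
    moreover have "m0 = \<i> * ((1 - p) / (1 + p))" by (simp add: m0_def)
    moreover have "Im (\<i> * z) = Re z" for z by simp
    ultimately show ?thesis unfolding y0_def by (simp only:)
  qed
  have pp: "1 - (cmod p)\<^sup>2 > 0" using p by (simp add: abs_square_less_1)
  have y0pos: "y0 > 0" unfolding y0 using pp p1 by simp
  \<comment> \<open>The prescribed ratio of the derivatives of the product n and the mean m,
    dictated by the tangent vector X.\<close>
  define k where "k = - (\<i> * S * (1 + p) / M)"
  \<comment> \<open>The real parameter x describes the unit circle without the point 1, and the
    maximality of |\<open>mlin p 1 X\<close>| becomes a condition on k for every x.\<close>
  have cond: "cmod (1 + k * (m0 - of_real x) / of_real (x\<^sup>2 + 1)) \<le> 1" for x :: real
  proof -
    define \<omega> where "\<omega> = (of_real x + \<i>) / (of_real x - \<i>)"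
    have nz: "of_real x + \<i> \<noteq> (0::complex)" "of_real x - \<i> \<noteq> (0::complex)" by (auto simp: complex_eq_iff)
    have c: "cnj \<omega> = (of_real x - \<i>) / (of_real x + \<i>)" by (simp add: \<omega>_def)
    have "cmod (of_real x + \<i>) = cmod (of_real x - \<i>)" by (simp add: cmod_def)
    then have \<omega>: "cmod \<omega> = 1" using nz by (simp add: \<omega>_def norm_divide)
    have x1: "of_real (x\<^sup>2 + 1) = (of_real x + \<i>) * (of_real x - \<i>)"
      by (simp add: power2_eq_square algebra_simps)
    have "mlin p \<omega> X = M * (1 + k * (m0 - of_real x) / of_real (x\<^sup>2 + 1))"
    proof -
      have "M * (k * (m0 - of_real x) / of_real (x\<^sup>2 + 1)) = - (\<i> * S * (\<i> * (1 - p) - of_real x * (1 + p))) / of_real (x\<^sup>2 + 1)"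
      proof -
        have Mk: "M * k = - (\<i> * S * (1 + p))" using M by (simp add: k_def)
        have pm: "(1 + p) * (m0 - of_real x) = \<i> * (1 - p) - of_real x * (1 + p)"
        proof -
          have "(1 + p) * m0 = \<i> * (1 - p)"
            unfolding m0_def by (simp only: times_divide_eq_right nonzero_mult_div_cancel_left[OF p1])
          then show ?thesis by (simp only: right_diff_distrib[of "1 + p"] mult.commute[of "1 + p" "of_real x"])
        qed
        have "M * (k * (m0 - of_real x) / of_real (x\<^sup>2 + 1)) = (M * k) * (m0 - of_real x) / of_real (x\<^sup>2 + 1)"
          by (simp only: mult.assoc times_divide_eq_right)
        also have "\<dots> = - (\<i> * S * ((1 + p) * (m0 - of_real x))) / of_real (x\<^sup>2 + 1)"
          unfolding Mk by (simp only: mult.assoc mult_minus_left)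
        finally show ?thesis unfolding pm .
      qed
      also have "\<dots> = S / 2 * (ell p 1 - ell p \<omega>)"
      proof -
        define A B where "A = of_real x + \<i>" and "B = of_real x - \<i>"
        have AB: "A \<noteq> 0" "B \<noteq> 0" "A - B = 2 * \<i>" using nz by (simp_all add: A_def B_def)
        have "1 - p - (B / A - p * (A / B)) = (A - B) * (B + p * A) / (A * B)"
          using AB(1,2) by (simp add: field_simps)
        then have "S / 2 * (ell p 1 - ell p \<omega>) = \<i> * S * (B + p * A) / (A * B)"
          unfolding ell_def c unfolding \<omega>_def A_def[symmetric] B_def[symmetric] AB(3) by simp
        moreover have "\<i> * S * (B + p * A) = - (\<i> * S * (\<i> * (1 - p) - of_real x * (1 + p)))"
          by (simp add: A_def B_def algebra_simps)
        ultimately show ?thesis unfolding x1 A_def B_def by simp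
      qed
      finally have "M * (k * (m0 - of_real x) / of_real (x\<^sup>2 + 1)) = S / 2 * (ell p 1 - ell p \<omega>)" .
      moreover have "mlin p \<omega> X = M + S / 2 * (ell p 1 - ell p \<omega>)"
        by (simp add: M_def S_def mlin_def algebra_simps)
      ultimately show ?thesis by (simp only: distrib_left mult_1_right)
    qed
    then have "cmod M * cmod (1 + k * (m0 - of_real x) / of_real (x\<^sup>2 + 1)) \<le> cmod M * 1"
      using max[OF \<omega>] by (simp add: M_def norm_mult)
    then show ?thesis using M by (metis mult_le_cancel_left_pos zero_less_norm_iff)
  qed
  have cond2: "2 * Re (k * (m0 - of_real x)) * (x\<^sup>2 + 1) + (cmod (k * (m0 - of_real x)))\<^sup>2 \<le> 0" for x :: real
  proof -
    define z where "z = k * (m0 - of_real x)"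
    have pos: "x\<^sup>2 + 1 > 0" by (simp add: add_nonneg_pos)
    have "1 + z / of_real (x\<^sup>2 + 1) = (of_real (x\<^sup>2 + 1) + z) / of_real (x\<^sup>2 + 1)"
      using pos by (simp add: add_divide_distrib del: of_real_add)
    then have "cmod (of_real (x\<^sup>2 + 1) + z) / (x\<^sup>2 + 1) \<le> 1"
      using cond[of x] pos unfolding z_def[symmetric] by (simp add: norm_divide del: of_real_add)
    then have "cmod (of_real (x\<^sup>2 + 1) + z) \<le> x\<^sup>2 + 1" using pos by simp
    then have "(cmod (of_real (x\<^sup>2 + 1) + z))\<^sup>2 \<le> (x\<^sup>2 + 1)\<^sup>2" by (intro power_mono) auto
    moreover have "(cmod (of_real r + z))\<^sup>2 = r\<^sup>2 + 2 * Re z * r + (cmod z)\<^sup>2" for r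
      unfolding cmod_power2 by (simp add: power2_eq_square algebra_simps)
    ultimately show ?thesis unfolding z_def[symmetric] by (simp del: of_real_add)
  qed
  \<comment> \<open>Otherwise the affine function Re (k (m0 - x)) of x would take the value 1
    somewhere, against \<open>cond2\<close>.\<close>
  have Rek: "Re k = 0"
  proof (rule ccontr)
    assume nz: "Re k \<noteq> 0"
    define x where "x = (Re (k * m0) - 1) / Re k"
    have "Re (k * (m0 - of_real x)) = Re (k * m0) - x * Re k" by (simp add: algebra_simps)
    also have "\<dots> = 1" using nz by (simp add: x_def del: times_complex.sel)
    finally have "Re (k * (m0 - of_real x)) = 1" .
    then have "2 * (x\<^sup>2 + 1) + (cmod (k * (m0 - of_real x)))\<^sup>2 \<le> 0" using cond2[of x] by simp
    moreover have "0 \<le> x\<^sup>2" "0 \<le> (cmod (k * (m0 - of_real x)))\<^sup>2" by simp_all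
    moreover have False if "2 * (X + 1) + Y \<le> 0" "0 \<le> X" "0 \<le> Y" for X Y :: real
      using that unfolding distrib_left by linarith
    ultimately show False by blast
  qed
  \<comment> \<open>Chosen so that n = a ((m - x0)^2 + y0^2) - 1 has derivative 2 a \<i> y0 = k with
    respect to m at m0.\<close>
  define a where "a = Im k / (2 * y0)"
  have k: "k = \<i> * of_real (2 * y0 * a)" using Rek y0pos by (simp add: complex_eq_iff a_def)
  have cond3: "4 * y0\<^sup>2 * (a * (a * ((x - x0)\<^sup>2 + y0\<^sup>2) - (x\<^sup>2 + 1))) \<le> 0" for x :: real
  proof -
    have 1: "Re (k * (m0 - of_real x)) = - (2 * y0\<^sup>2 * a)" by (simp add: k m0 power2_eq_square)
    have 2: "(cmod (k * (m0 - of_real x)))\<^sup>2 = 4 * y0\<^sup>2 * a\<^sup>2 * ((x - x0)\<^sup>2 + y0\<^sup>2)"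
      unfolding cmod_power2 by (simp add: k m0 power2_eq_square algebra_simps)
    have "4 * y0\<^sup>2 * (a * (a * ((x - x0)\<^sup>2 + y0\<^sup>2) - (x\<^sup>2 + 1))) =
      2 * (- (2 * y0\<^sup>2 * a)) * (x\<^sup>2 + 1) + 4 * y0\<^sup>2 * a\<^sup>2 * ((x - x0)\<^sup>2 + y0\<^sup>2)"
      by (simp add: power2_eq_square algebra_simps)
    also have "\<dots> \<le> 0" using cond2[of x] unfolding 1 2 .
    finally show ?thesis .
  qed
  have cond4: "a * (a * ((x - x0)\<^sup>2 + y0\<^sup>2) - (x\<^sup>2 + 1)) \<le> 0" for x :: real
    using cond3[of x] y0pos by (simp add: mult_le_0_iff)
  have a: "0 \<le> a"
  proof (rule ccontr)
    assume "\<not> 0 \<le> a"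
    then have "a < 0" by simp
    then have "a * ((0 - x0)\<^sup>2 + y0\<^sup>2) - (0\<^sup>2 + 1) < 0" by (smt (verit) mult_nonpos_nonneg zero_le_power2)
    then have "0 < a * (a * ((0 - x0)\<^sup>2 + y0\<^sup>2) - (0\<^sup>2 + 1))" using \<open>a < 0\<close> by (rule mult_neg_neg[rotated])
    then show False using cond4[of 0] by simp
  qed
  have bound: "a * ((x - x0)\<^sup>2 + y0\<^sup>2) \<le> x\<^sup>2 + 1" for x :: real
  proof (cases "a = 0")
    case True
    then show ?thesis by simp
  next
    case False
    then show ?thesis using cond4[of x] a by (simp add: mult_le_0_iff)
  qed
  define R where "R = (1 - (cmod p)\<^sup>2) / cmod M"
  have R: "R > 0" using pp M by (simp add: R_def)
  \<comment> \<open>The phase of the disc parameter. It makes the derivative of m at 0 match M R,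
    and |u| = 1 because |1 + p|^2 y0 = 1 - |p|^2 = |M| R.\<close>
  define u where "u = - (M * of_real R / ((1 + p)\<^sup>2 * of_real y0))"
  have u: "cmod u = 1"
  proof -
    have "cmod u = cmod M * R / ((cmod (1 + p))\<^sup>2 * y0)"
      using R y0pos by (simp add: u_def norm_divide norm_mult norm_power)
    moreover have "cmod M * R = 1 - (cmod p)\<^sup>2" using M by (simp add: R_def)
    moreover have "(cmod (1 + p))\<^sup>2 * y0 = 1 - (cmod p)\<^sup>2" using p1 by (simp add: y0)
    ultimately show ?thesis using pp by simp
  qed
  define m where "m = (\<lambda>\<zeta>. of_real x0 + \<i> * of_real y0 * ((1 + u * \<zeta>) / (1 - u * \<zeta>)))"
  define n where "n = (\<lambda>\<zeta>. of_real a * ((m \<zeta> - of_real x0)\<^sup>2 + of_real (y0\<^sup>2)) - 1)"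
  define \<phi> where "\<phi> = (\<lambda>\<zeta>. (2 * (n \<zeta> + 1) / (n \<zeta> + 2 * \<i> * m \<zeta> - 1), (n \<zeta> - 2 * \<i> * m \<zeta> - 1) / (n \<zeta> + 2 * \<i> * m \<zeta> - 1)))"
  have unz: "1 - u * \<zeta> \<noteq> 0" if "cmod \<zeta> < 1" for \<zeta>
    using one_minus_nonzero[of \<zeta> u] that u by (simp add: mult.commute)
  have m_pos: "Im (m \<zeta>) > 0" if "cmod \<zeta> < 1" for \<zeta>
  proof -
    define v where "v = u * \<zeta>"
    have v: "cmod v < 1" using that u by (simp add: v_def norm_mult)
    have nz: "1 - v \<noteq> 0" using unz[OF that] by (simp add: v_def)
    have "(1 + v) / (1 - v) = (1 + v) * cnj (1 - v) / of_real ((cmod (1 - v))\<^sup>2)"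
      unfolding complex_norm_square using nz by (simp add: complex_cnj_diff[symmetric] del: complex_cnj_diff)
    then have "Re ((1 + v) / (1 - v)) = Re ((1 + v) * cnj (1 - v)) / (cmod (1 - v))\<^sup>2"
      by (simp only: Re_divide_of_real)
    also have "Re ((1 + v) * cnj (1 - v)) = 1 - (cmod v)\<^sup>2"
      unfolding cmod_power2 by (simp add: power2_eq_square algebra_simps)
    finally have "Re ((1 + v) / (1 - v)) > 0" using v nz by (simp add: abs_square_less_1)
    moreover have "Im (of_real x0 + \<i> * of_real y0 * w) = y0 * Re w" for w by simp
    ultimately show ?thesis using y0pos unfolding m_def v_def[symmetric] by (simp only: mult_pos_pos)
  qed
  have G: "n \<zeta> + 2 * \<i> * m \<zeta> - 1 \<noteq> 0" "\<phi> \<zeta> \<in> G2" if "cmod \<zeta> < 1" for \<zeta>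
  proof -
    have r: "Im t > 0" if "t\<^sup>2 - 2 * m \<zeta> * t + n \<zeta> = 0" for t
      using upper_half_plane_root[OF a bound m_pos[OF \<open>cmod \<zeta> < 1\<close>], of t] that unfolding n_def by blast
    show "n \<zeta> + 2 * \<i> * m \<zeta> - 1 \<noteq> 0" using r by (rule Cayley_pair_in_G2(1))
    show "\<phi> \<zeta> \<in> G2" unfolding \<phi>_def using r by (rule Cayley_pair_in_G2(2))
  qed
  have hm: "m holomorphic_on unit_disc"
    unfolding m_def using unz by (intro holomorphic_intros) auto
  have hn: "n holomorphic_on unit_disc"
    unfolding n_def by (intro holomorphic_intros hm)
  have h\<phi>: "holomorphic_map_on \<phi> unit_disc"
    unfolding holomorphic_map_on_def \<phi>_def fst_conv snd_conv using G(1)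
    by (intro conjI holomorphic_intros hm hn) auto
  have mz: "m 0 = m0" by (simp add: m_def m0)
  have nz: "n 0 = - 1" by (simp add: n_def mz m0 power_mult_distrib)
  have im0: "\<i> * m0 = - ((1 - p) / (1 + p))" 
    using minus_divide_left[of "1 - p" "1 + p"] by (simp add: m0_def mult.assoc[symmetric])
  have den: "n 0 + 2 * \<i> * m 0 - 1 = - 4 / (1 + p)"
  proof -
    have "n 0 + 2 * \<i> * m 0 - 1 = 2 * (\<i> * m0) - 2" unfolding mz nz by simp
    then show ?thesis unfolding im0 using p1 by (simp add: field_simps)
  qed
  have num: "n 0 - 2 * \<i> * m 0 - 1 = - 4 * p / (1 + p)"
  proof -
    have "n 0 - 2 * \<i> * m 0 - 1 = - 2 * (\<i> * m0) - 2" unfolding mz nz by simp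
    then show ?thesis unfolding im0 using p1 by (simp add: field_simps)
  qed
  have \<phi>0: "\<phi> 0 = (0, p)" using p1 unfolding \<phi>_def den num by (simp add: nz)
  define dm dn where "dm = 2 * \<i> * of_real y0 * u" and "dn = k * dm"
  have dm: "(m has_field_derivative dm) (at 0)"
    unfolding m_def dm_def by (auto intro!: derivative_eq_intros simp: algebra_simps)
  have dn: "(n has_field_derivative dn) (at 0)"
  proof -
    have "(n has_field_derivative of_real a * (2 * (m 0 - of_real x0) * dm)) (at 0)"
      unfolding n_def by (auto intro!: derivative_eq_intros dm)
    moreover have "of_real a * (2 * (m 0 - of_real x0) * dm) = dn" by (simp add: mz m0 dn_def k algebra_simps)
    ultimately show ?thesis by simp
  qed
  have dmM: "dm = - 2 * \<i> * M * of_real R / (1 + p)\<^sup>2" using y0pos by (simp add: dm_def u_def)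
  have dnS: "dn = - 2 * S * of_real R / (1 + p)"
  proof -
    have kM: "k * M = - (\<i> * S * (1 + p))" using M by (simp add: k_def)
    have "dn = (k * M) * (- 2 * \<i> * of_real R) / ((1 + p) * (1 + p))"
      by (simp add: dn_def dmM power2_eq_square)
    also have "\<dots> = ((1 + p) * (- 2 * S * of_real R)) / ((1 + p) * (1 + p))" unfolding kM
      by (intro arg_cong2[of _ _ _ _ "(/)"]) (simp_all add: algebra_simps)
    also have "\<dots> = - 2 * S * of_real R / (1 + p)" using p1 by (rule nonzero_mult_divide_mult_cancel_left)
    finally show ?thesis .
  qed
  define w D where "w = 1 + p" and "D = n 0 + 2 * \<i> * m 0 - 1"
  have w: "w \<noteq> 0" and D: "D = - 4 / w" and numD: "n 0 - 2 * \<i> * m 0 - 1 = p * D"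
    using p1 by (simp_all add: w_def D_def den num)
  have Dd: "((\<lambda>z. n z + 2 * \<i> * m z - 1) has_field_derivative dn + 2 * \<i> * dm) (at 0)"
    by (auto intro!: derivative_eq_intros dm dn)
  have d0: "n 0 + 2 * \<i> * m 0 - 1 \<noteq> 0" using G(1)[of 0] by simp
  have "((\<lambda>z. fst (\<phi> z)) has_field_derivative
     (2 * dn * (n 0 + 2 * \<i> * m 0 - 1) - 2 * (n 0 + 1) * (dn + 2 * \<i> * dm)) / (n 0 + 2 * \<i> * m 0 - 1)\<^sup>2) (at 0)"
    unfolding \<phi>_def fst_conv power2_eq_square
    by (rule DERIV_divide[OF _ Dd d0]) (auto intro!: derivative_eq_intros dn)
  moreover have "(2 * dn * (n 0 + 2 * \<i> * m 0 - 1) - 2 * (n 0 + 1) * (dn + 2 * \<i> * dm)) / (n 0 + 2 * \<i> * m 0 - 1)\<^sup>2 = S * of_real R"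
    unfolding D_def[symmetric] unfolding nz dnS w_def[symmetric] D using w by (simp add: power2_eq_square)
  ultimately have 1: "((\<lambda>z. fst (\<phi> z)) has_field_derivative S * of_real R) (at 0)" by simp
  have "((\<lambda>z. snd (\<phi> z)) has_field_derivative
     ((dn - 2 * \<i> * dm) * (n 0 + 2 * \<i> * m 0 - 1) - (n 0 - 2 * \<i> * m 0 - 1) * (dn + 2 * \<i> * dm)) / (n 0 + 2 * \<i> * m 0 - 1)\<^sup>2) (at 0)"
    unfolding \<phi>_def snd_conv power2_eq_square
    by (rule DERIV_divide[OF _ Dd d0]) (auto intro!: derivative_eq_intros dn dm)
  moreover have "((dn - 2 * \<i> * dm) * (n 0 + 2 * \<i> * m 0 - 1) - (n 0 - 2 * \<i> * m 0 - 1) * (dn + 2 * \<i> * dm)) / (n 0 + 2 * \<i> * m 0 - 1)\<^sup>2 = snd X * of_real R"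
  proof -
    have i: "2 * \<i> * dm = 4 * M * of_real R / (1 + p)\<^sup>2" by (simp add: dmM)
    have "((dn - 2 * \<i> * dm) * D - p * D * (dn + 2 * \<i> * dm)) / D\<^sup>2 = ((dn - 2 * \<i> * dm) - p * (dn + 2 * \<i> * dm)) / D"
    proof -
      have "(dn - 2 * \<i> * dm) * D - p * D * (dn + 2 * \<i> * dm) = ((dn - 2 * \<i> * dm) - p * (dn + 2 * \<i> * dm)) * D"
        by (simp add: algebra_simps)
      then show ?thesis using w by (simp add: power2_eq_square D)
    qed
    also have "(dn - 2 * \<i> * dm) - p * (dn + 2 * \<i> * dm) = dn * (1 - p) - (2 * \<i> * dm) * w"
      by (simp add: w_def algebra_simps)
    also have "\<dots> = (- 2 * S * of_real R * (1 - p) - 4 * M * of_real R) / w"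
      unfolding i dnS w_def[symmetric] using w by (simp add: power2_eq_square diff_divide_distrib)
    also have "\<dots> / D = snd X * of_real R" unfolding D P using w by (simp add: field_simps)
    finally show ?thesis unfolding numD D_def[symmetric] .
  qed
  ultimately have 2: "((\<lambda>z. snd (\<phi> z)) has_field_derivative snd X * of_real R) (at 0)" by simp
  show ?thesis
    using h\<phi> G(2) \<phi>0 1 2 unfolding R_def M_def S_def by (intro exI[of _ \<phi>]) auto
qed

text \<open>The rotation (s, p) \<mapsto> (\<omega> s, \<omega>^2 p) preserves \<open>G2\<close> and
  carries the maximizing parameter \<omega> to 1.\<close>

lemma extremal_disc:
  assumes p: "cmod p < 1" and X: "X \<noteq> 0" and \<omega>: "cmod \<omega> = 1"
    and max: "\<And>\<omega>'. cmod \<omega>' = 1 \<Longrightarrow> cmod (mlin p \<omega>' X) \<le> cmod (mlin p \<omega> X)"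
  shows "\<exists>\<phi>. holomorphic_map_on \<phi> unit_disc \<and> \<phi> ` unit_disc \<subseteq> G2 \<and> \<phi> 0 = (0, p) \<and>
    ((\<lambda>z. fst (\<phi> z)) has_field_derivative fst X * of_real ((1 - (cmod p)\<^sup>2) / cmod (mlin p \<omega> X))) (at 0) \<and>
    ((\<lambda>z. snd (\<phi> z)) has_field_derivative snd X * of_real ((1 - (cmod p)\<^sup>2) / cmod (mlin p \<omega> X))) (at 0)"
proof -
  define p' X' where "p' = \<omega>\<^sup>2 * p" and "X' = (\<omega> * fst X, \<omega>\<^sup>2 * snd X)"
  have w: "\<omega> * cnj \<omega> = 1" "cnj \<omega> * \<omega> = 1" "\<omega> \<noteq> 0" using unit_cnj[OF \<omega>] \<omega> by auto
  have w2: "cnj \<omega> * (\<omega> * y) = y" "(cnj \<omega>)\<^sup>2 * (\<omega>\<^sup>2 * y) = y" for y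
    using w by (simp_all flip: mult.assoc power_mult_distrib)
  have p': "cmod p' = cmod p" using \<omega> by (simp add: p'_def norm_mult norm_power)
  have L: "mlin p' \<omega>' X' = \<omega>\<^sup>2 * mlin p (\<omega> * \<omega>') X" for \<omega>'
  proof -
    have "\<omega> * ell p' \<omega>' = \<omega>\<^sup>2 * ell p (\<omega> * \<omega>')"
    proof -
      have "\<omega>\<^sup>2 * ell p (\<omega> * \<omega>') = \<omega> * (\<omega> * cnj \<omega>) * cnj \<omega>' - \<omega>\<^sup>2 * p * (\<omega> * \<omega>')"
        by (simp add: ell_def power2_eq_square algebra_simps)
      then show ?thesis unfolding w by (simp add: ell_def p'_def algebra_simps power2_eq_square)
    qed
    then show ?thesis by (simp add: mlin_def X'_def right_diff_distrib mult.left_commute)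
  qed
  have X'0: "X' \<noteq> 0" using X w by (auto simp: X'_def prod_eq_iff)
  have e: "cmod (mlin p' 1 X') = cmod (mlin p \<omega> X)" by (simp add: L norm_mult norm_power \<omega>)
  have "cmod (mlin p' \<omega>' X') \<le> cmod (mlin p' 1 X')" if "cmod \<omega>' = 1" for \<omega>'
    unfolding e L using max[of "\<omega> * \<omega>'"] that \<omega> by (simp add: norm_mult norm_power)
  then obtain \<phi> where \<phi>: "holomorphic_map_on \<phi> unit_disc" "\<phi> ` unit_disc \<subseteq> G2" "\<phi> 0 = (0, p')"
    "((\<lambda>z. fst (\<phi> z)) has_field_derivative fst X' * of_real ((1 - (cmod p)\<^sup>2) / cmod (mlin p \<omega> X))) (at 0)"
    "((\<lambda>z. snd (\<phi> z)) has_field_derivative snd X' * of_real ((1 - (cmod p)\<^sup>2) / cmod (mlin p \<omega> X))) (at 0)"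
    using extremal_disc_1[of p' X'] p X'0 unfolding e p' by blast
  define \<psi> where "\<psi> = (\<lambda>z. (cnj \<omega> * fst (\<phi> z), (cnj \<omega>)\<^sup>2 * snd (\<phi> z)))"
  have "holomorphic_map_on \<psi> unit_disc"
    using \<phi>(1) unfolding holomorphic_map_on_def \<psi>_def fst_conv snd_conv
    by (intro conjI holomorphic_intros) auto
  moreover have "\<psi> ` unit_disc \<subseteq> G2"
  proof
    fix y assume "y \<in> \<psi> ` unit_disc"
    then obtain z where z: "z \<in> unit_disc" "y = \<psi> z" by blast
    then have "\<phi> z \<in> G2" using \<phi>(2) by blast
    then obtain t u where tu: "\<phi> z = (t + u, t * u)" "cmod t < 1" "cmod u < 1"
      by (auto simp: symmetrized_bidisc_def)
    have "y = (cnj \<omega> * t + cnj \<omega> * u, (cnj \<omega> * t) * (cnj \<omega> * u))"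
      by (simp add: z \<psi>_def tu power2_eq_square algebra_simps)
    moreover have "cmod (cnj \<omega> * t) < 1" "cmod (cnj \<omega> * u) < 1" using tu \<omega> by (simp_all add: norm_mult)
    ultimately show "y \<in> G2" unfolding symmetrized_bidisc_def
      by (intro CollectI exI[of _ "cnj \<omega> * t"] exI[of _ "cnj \<omega> * u"]) simp
  qed
  moreover have "\<psi> 0 = (0, p)" by (simp add: \<psi>_def \<phi>(3) p'_def w2)
  moreover have "((\<lambda>z. fst (\<psi> z)) has_field_derivative fst X * of_real ((1 - (cmod p)\<^sup>2) / cmod (mlin p \<omega> X))) (at 0)"
    using DERIV_cmult[OF \<phi>(4), of "cnj \<omega>"] by (simp add: \<psi>_def X'_def w2 mult.assoc)
  moreover have "((\<lambda>z. snd (\<psi> z)) has_field_derivative snd X * of_real ((1 - (cmod p)\<^sup>2) / cmod (mlin p \<omega> X))) (at 0)"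
    using DERIV_cmult[OF \<phi>(5), of "(cnj \<omega>)\<^sup>2"] by (simp add: \<psi>_def X'_def w2 mult.assoc)
  ultimately show ?thesis by blast
qed

section \<open>Approximately complex-linear functions are holomorphic\<close>

lemma triangle_integral_subtract_linear:
  fixes g :: "complex \<Rightarrow> complex"
  assumes g: "continuous_on (convex hull {a,b,c}) g"
  shows "contour_integral (linepath a b) g + contour_integral (linepath b c) g + contour_integral (linepath c a) g =
    contour_integral (linepath a b) (\<lambda>z. g z - (u + v * z)) +
    contour_integral (linepath b c) (\<lambda>z. g z - (u + v * z)) +
    contour_integral (linepath c a) (\<lambda>z. g z - (u + v * z))"
proof -
  define l where "l = (\<lambda>z. u + v * z)"
  have l: "l holomorphic_on S" for S unfolding l_def by (intro holomorphic_intros)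
  have seg: "closed_segment a b \<subseteq> convex hull {a,b,c}" "closed_segment b c \<subseteq> convex hull {a,b,c}"
    "closed_segment c a \<subseteq> convex hull {a,b,c}"
    by (simp_all add: segments_subset_convex_hull)
  have int: "g contour_integrable_on linepath a b" "g contour_integrable_on linepath b c" "g contour_integrable_on linepath c a"
    using seg by (auto intro!: contour_integrable_continuous_linepath continuous_on_subset[OF g])
  have lint: "l contour_integrable_on linepath x y" for x y
    by (intro contour_integrable_continuous_linepath holomorphic_on_imp_continuous_on l)
  have "(l has_contour_integral 0) (linepath a b +++ linepath b c +++ linepath c a)"
    by (rule Cauchy_theorem_triangle[OF l])
  then have "contour_integral (linepath a b +++ linepath b c +++ linepath c a) l = 0"
    by (rule contour_integral_unique)
  then have "contour_integral (linepath a b) l + (contour_integral (linepath b c) l + contour_integral (linepath c a) l) = 0"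
    using lint by (simp add: contour_integrable_join)
  note sum0 = this
  have d: "contour_integral (linepath x y) (\<lambda>z. g z - (u + v * z)) =
      contour_integral (linepath x y) g - contour_integral (linepath x y) l"
    if "g contour_integrable_on linepath x y" for x y
    using contour_integral_diff[OF that lint] unfolding l_def .
  show ?thesis unfolding d[OF int(1)] d[OF int(2)] d[OF int(3)] using sum0 by algebra
qed

text \<open>Goursat's argument: the linear approximation may depend on the scale as well as on the point.\<close>

lemma holomorphic_if_linear_at_small_scales:
  fixes g :: "complex \<Rightarrow> complex"
  assumes cont: "continuous_on (ball a \<rho>) g"
    and approx: "\<And>\<delta>. \<delta> > 0 \<Longrightarrow> \<exists>\<eta>>0. \<forall>c\<in>ball a \<rho>. \<forall>\<epsilon>. 0 < \<epsilon> \<and> \<epsilon> < \<eta> \<longrightarrow>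
      (\<exists>t. \<forall>h. cmod h \<le> 1 \<longrightarrow> cmod (g (c + of_real \<epsilon> * h) - g c - of_real \<epsilon> * h * t) \<le> \<delta> * \<epsilon>)"
  shows "g holomorphic_on ball a \<rho>"
proof -
  define I where "I = (\<lambda>x y z. contour_integral (linepath x y) g + contour_integral (linepath y z) g + contour_integral (linepath z x) g)"
  have "I a0 b0 c0 = 0" if sub: "convex hull {a0,b0,c0} \<subseteq> ball a \<rho>" for a0 b0 c0
  proof (rule ccontr)
    assume nz: "I a0 b0 c0 \<noteq> 0"
    define K where "K = 1 + dist a0 b0 + dist b0 c0 + dist c0 a0"
    have K: "K > 0" "dist a0 b0 \<le> K" "dist b0 c0 \<le> K" "dist c0 a0 \<le> K"
      by (simp_all add: K_def add_pos_nonneg)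
    define e where "e = cmod (I a0 b0 c0) / K\<^sup>2"
    have e: "e > 0" using nz K by (simp add: e_def)
    have nested: "\<exists>x y z. convex hull {x,y,z} \<subseteq> ball a \<rho> \<and> dist x y \<le> K / 2 ^ n \<and> dist y z \<le> K / 2 ^ n \<and>
        dist z x \<le> K / 2 ^ n \<and> e * (K / 2 ^ n)\<^sup>2 \<le> cmod (I x y z)" for n
    proof (induction n)
      case 0
      have "e * K\<^sup>2 = cmod (I a0 b0 c0)" using K by (simp add: e_def)
      then show ?case using sub K by (intro exI[of _ a0] exI[of _ b0] exI[of _ c0]) simp
    next
      case (Suc n)
      then obtain x y z where xyz: "convex hull {x,y,z} \<subseteq> ball a \<rho>" "dist x y \<le> K / 2 ^ n" "dist y z \<le> K / 2 ^ n"
        "dist z x \<le> K / 2 ^ n" "e * (K / 2 ^ n)\<^sup>2 \<le> cmod (I x y z)" by blast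
      obtain x' y' z' where 1: "x' \<in> convex hull {x,y,z}" "y' \<in> convex hull {x,y,z}" "z' \<in> convex hull {x,y,z}"
        and 2: "dist x' y' \<le> K / 2 ^ n / 2" "dist y' z' \<le> K / 2 ^ n / 2" "dist z' x' \<le> K / 2 ^ n / 2"
        "e * (K / 2 ^ n / 2)\<^sup>2 \<le> cmod (I x' y' z')"
        using Cauchy_theorem_quadrisection[OF continuous_on_subset[OF cont xyz(1)] xyz(2,3,4), of e] xyz(5)
        unfolding I_def by blast
      have "convex hull {x',y',z'} \<subseteq> convex hull {x,y,z}"
        using 1 by (intro hull_minimal) auto
      moreover have "K / 2 ^ n / 2 = K / 2 ^ Suc n" by simp
      ultimately show ?case using xyz(1) 2 by (metis order_trans)
    qed
    \<comment> \<open>Each of the three sides contributes at most a quarter of e times the squared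
      side bound. Three quarters stay below the lower bound that quadrisection preserves.\<close>
    have "e / 4 > 0" using e by simp
    then obtain \<eta> where \<eta>: "\<eta> > 0" "\<And>c \<epsilon>. c \<in> ball a \<rho> \<Longrightarrow> 0 < \<epsilon> \<Longrightarrow> \<epsilon> < \<eta> \<Longrightarrow>
      (\<exists>t. \<forall>h. cmod h \<le> 1 \<longrightarrow> cmod (g (c + of_real \<epsilon> * h) - g c - of_real \<epsilon> * h * t) \<le> (e / 4) * \<epsilon>)"
      using approx[of "e / 4"] by blast
    have "(\<lambda>n. K / 2 ^ n) \<longlonglongrightarrow> 0" by real_asymp
    then obtain n where n: "K / 2 ^ n < \<eta>"
      using \<eta>(1) by (metis (no_types, lifting) eventually_sequentially order_tendstoD(2) order_refl)
    define \<epsilon> where "\<epsilon> = K / 2 ^ n"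
    have \<epsilon>: "0 < \<epsilon>" "\<epsilon> < \<eta>" using K n by (simp_all add: \<epsilon>_def)
    obtain x y z where xyz: "convex hull {x,y,z} \<subseteq> ball a \<rho>" "dist x y \<le> \<epsilon>" "dist y z \<le> \<epsilon>"
        "dist z x \<le> \<epsilon>" "e * \<epsilon>\<^sup>2 \<le> cmod (I x y z)"
      using nested[of n] unfolding \<epsilon>_def by blast
    have xh: "x \<in> convex hull {x,y,z}" by (simp add: hull_inc)
    then obtain t where t: "\<And>h. cmod h \<le> 1 \<Longrightarrow> cmod (g (x + of_real \<epsilon> * h) - g x - of_real \<epsilon> * h * t) \<le> (e / 4) * \<epsilon>"
      using \<eta>(2)[OF _ \<epsilon>] xyz(1) by blast
    define R where "R = (\<lambda>w. g w - ((g x - t * x) + t * w))"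
    have R: "cmod (R w) \<le> (e / 4) * \<epsilon>" if "w \<in> convex hull {x,y,z}" for w
    proof -
      have "cmod (x - w) \<le> \<epsilon>"
        using triangle_points_closer[OF xh that] xyz(2,3,4) by (auto simp: dist_norm)
      then have "cmod ((w - x) / of_real \<epsilon>) \<le> 1" using \<epsilon> by (simp add: norm_divide norm_minus_commute)
      moreover have "of_real \<epsilon> * ((w - x) / of_real \<epsilon>) = w - x" using \<epsilon> by simp
      ultimately have "cmod (g (x + (w - x)) - g x - (w - x) * t) \<le> (e / 4) * \<epsilon>"
        using t[of "(w - x) / of_real \<epsilon>"] by metis
      then show ?thesis by (simp add: R_def algebra_simps)
    qed
    have cR: "continuous_on (convex hull {x,y,z}) R"
      unfolding R_def by (intro continuous_intros continuous_on_subset[OF cont xyz(1)])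
    have bound: "cmod (contour_integral (linepath u v) R) \<le> (e / 4) * \<epsilon> * \<epsilon>"
      if "closed_segment u v \<subseteq> convex hull {x,y,z}" "dist u v \<le> \<epsilon>" for u v
    proof -
      have "R contour_integrable_on linepath u v"
        using continuous_on_subset[OF cR that(1)] by (rule contour_integrable_continuous_linepath)
      then have "(R has_contour_integral contour_integral (linepath u v) R) (linepath u v)"
        by (rule has_contour_integral_integral)
      then have "cmod (contour_integral (linepath u v) R) \<le> (e / 4) * \<epsilon> * cmod (v - u)"
        using that(1) R e \<epsilon> by (intro has_contour_integral_bound_linepath) auto
      also have "\<dots> \<le> (e / 4) * \<epsilon> * \<epsilon>"
        using that(2) e \<epsilon> by (intro mult_left_mono) (auto simp: dist_norm norm_minus_commute)
      finally show ?thesis .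
    qed
    have "I x y z = contour_integral (linepath x y) R + contour_integral (linepath y z) R + contour_integral (linepath z x) R"
      unfolding I_def R_def by (rule triangle_integral_subtract_linear[OF continuous_on_subset[OF cont xyz(1)]])
    then have "cmod (I x y z) \<le> cmod (contour_integral (linepath x y) R) + cmod (contour_integral (linepath y z) R) + cmod (contour_integral (linepath z x) R)"
      using norm_triangle_ineq[of "contour_integral (linepath x y) R + contour_integral (linepath y z) R" "contour_integral (linepath z x) R"]
        norm_triangle_ineq[of "contour_integral (linepath x y) R" "contour_integral (linepath y z) R"] by simp
    also have "\<dots> \<le> (e / 4) * \<epsilon> * \<epsilon> + (e / 4) * \<epsilon> * \<epsilon> + (e / 4) * \<epsilon> * \<epsilon>"
      using xyz(2,3,4) by (intro add_mono bound) (simp_all add: segments_subset_convex_hull)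
    also have "\<dots> = 3 / 4 * (e * \<epsilon>\<^sup>2)" by (simp add: power2_eq_square)
    also have "\<dots> < e * \<epsilon>\<^sup>2" using e \<epsilon> by simp
    finally show False using xyz(5) by simp
  qed
  then have "g analytic_on ball a \<rho>"
    using cont unfolding I_def by (intro Morera_triangle) auto
  then show ?thesis by (rule analytic_imp_holomorphic)
qed

section \<open>Pointwise limits of asymptotically Lipschitz sequences\<close>

text \<open>The estimate holds for each pair only from some index on, because a difference quotient
  of f is under control only once its points have come close to the centre. A diagonal subsequence
  converges on a countable dense set, and the Lipschitz bound carries convergence to all
  points.\<close>

lemma asymptotically_Lipschitz_subsequence:
  fixes D :: "nat \<Rightarrow> 'a::euclidean_space \<Rightarrow> 'b::euclidean_space"
  assumes C: "C \<ge> 0" and lip: "\<And>x y. \<forall>\<^sub>F n in sequentially. norm (D n x - D n y) \<le> C * norm (x - y)"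
    and D0: "\<And>n. D n 0 = 0"
  obtains k F where "strict_mono k" "\<And>x. (\<lambda>n. D (k n) x) \<longlonglongrightarrow> F x"
proof -
  obtain S :: "'a set" where S: "countable S" "\<And>X. open X \<Longrightarrow> X \<noteq> {} \<Longrightarrow> \<exists>d\<in>S. d \<in> X"
    using countable_dense_exists by blast
  \<comment> \<open>Cut off by 0 and scaled so that one bound C holds for all n and x, as the
    diagonal argument requires. Eventually, at each point, the cut-off has no effect.\<close>
  define g where "g = (\<lambda>n x. if norm (D n x) \<le> C * norm x then D n x /\<^sub>R (1 + norm x) else 0)"
  have pos: "1 + norm x > 0" for x :: 'a by (simp add: add_pos_nonneg)
  have "norm (g n x) \<le> C" for n x
  proof -
    have "norm (D n x) / (1 + norm x) \<le> C" if "norm (D n x) \<le> C * norm x"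
      using that pos[of x] C by (simp add: divide_le_eq algebra_simps)
    then show ?thesis using C pos[of x] by (auto simp: g_def divide_inverse mult.commute)
  qed
  then obtain k where k: "strict_mono k" "\<And>x. x \<in> S \<Longrightarrow> \<exists>l. (\<lambda>n. g (k n) x) \<longlonglongrightarrow> l"
    using function_convergent_subsequence[OF S(1), of g C] by blast
  have lipk: "\<forall>\<^sub>F n in sequentially. norm (D (k n) x - D (k n) y) \<le> C * norm (x - y)" for x y
    using filterlim_subseq[OF k(1)] lip[of x y] by (auto simp: filterlim_iff)
  have conv: "convergent (\<lambda>n. D (k n) x)" if xS: "x \<in> S" for x
  proof -
    obtain l where "(\<lambda>n. g (k n) x) \<longlonglongrightarrow> l" using k(2)[OF xS] by blast
    then have "(\<lambda>n. (1 + norm x) *\<^sub>R g (k n) x) \<longlonglongrightarrow> (1 + norm x) *\<^sub>R l" by (intro tendsto_intros)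
    moreover have "\<forall>\<^sub>F n in sequentially. (1 + norm x) *\<^sub>R g (k n) x = D (k n) x"
      using lipk[of x 0]
    proof eventually_elim
      case (elim n)
      then show ?case using pos[of x] by (simp add: g_def D0)
    qed
    ultimately have "(\<lambda>n. D (k n) x) \<longlonglongrightarrow> (1 + norm x) *\<^sub>R l" by (rule Lim_transform_eventually)
    then show ?thesis by (rule convergentI)
  qed
  have "convergent (\<lambda>n. D (k n) x)" for x
  proof -
    have "Cauchy (\<lambda>n. D (k n) x)"
    proof (rule metric_CauchyI)
      fix e :: real assume e: "e > 0"
      define r where "r = e / (3 * (C + 1))"
      have r: "r > 0" using e C by (simp add: r_def)
      then obtain y where y: "y \<in> S" "y \<in> ball x r" using S(2)[of "ball x r"] by auto
      have "C * norm (x - y) \<le> (C + 1) * r"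
        using y(2) C by (intro mult_mono) (auto simp: dist_norm)
      also have "\<dots> = e / 3" using C by (simp add: r_def field_simps)
      finally have Cr: "C * norm (x - y) \<le> e / 3" .
      have "Cauchy (\<lambda>n. D (k n) y)" using conv[OF y(1)] by (rule convergent_Cauchy)
      then obtain M1 where M1: "\<And>m n. m \<ge> M1 \<Longrightarrow> n \<ge> M1 \<Longrightarrow> dist (D (k m) y) (D (k n) y) < e / 3"
        using e metric_CauchyD[of "\<lambda>n. D (k n) y" "e / 3"] by auto
      obtain M2 where M2: "\<And>n. n \<ge> M2 \<Longrightarrow> norm (D (k n) x - D (k n) y) \<le> C * norm (x - y)"
        using lipk[of x y] by (auto simp: eventually_sequentially)
      show "\<exists>M. \<forall>m\<ge>M. \<forall>n\<ge>M. dist (D (k m) x) (D (k n) x) < e"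
      proof (intro exI[of _ "max M1 M2"] allI impI)
        fix m n assume mn: "max M1 M2 \<le> m" "max M1 M2 \<le> n"
        have "dist (D (k m) x) (D (k n) x) \<le> dist (D (k m) x) (D (k m) y) + dist (D (k m) y) (D (k n) y) + dist (D (k n) y) (D (k n) x)"
          using dist_triangle[of "D (k m) x" "D (k n) x" "D (k m) y"] dist_triangle[of "D (k m) y" "D (k n) x" "D (k n) y"]
          by linarith
        moreover have "dist (D (k m) x) (D (k m) y) \<le> e / 3" "dist (D (k n) y) (D (k n) x) \<le> e / 3"
          using M2[of m] M2[of n] mn Cr by (auto simp: dist_norm norm_minus_commute)
        moreover have "dist (D (k m) y) (D (k n) y) < e / 3" using M1 mn by simp
        ultimately show "dist (D (k m) x) (D (k n) x) < e" by linarith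
      qed
    qed
    then show ?thesis by (rule Cauchy_convergent)
  qed
  then have "\<exists>F. \<forall>x. (\<lambda>n. D (k n) x) \<longlonglongrightarrow> F x" unfolding convergent_def by (rule choice[OF allI])
  then show ?thesis using that k(1) by blast
qed

lemma uniform_limit_if_uniformly_Lipschitz:
  fixes D :: "nat \<Rightarrow> 'a::metric_space \<Rightarrow> 'b::real_normed_vector"
  assumes K: "compact K" and C: "C \<ge> 0"
    and lip: "\<forall>\<^sub>F n in sequentially. \<forall>x\<in>K. \<forall>y\<in>K. norm (D n x - D n y) \<le> C * dist x y"
    and lim: "\<And>x. x \<in> K \<Longrightarrow> (\<lambda>n. D n x) \<longlonglongrightarrow> F x"
    and \<delta>: "\<delta> > 0"
  shows "\<forall>\<^sub>F n in sequentially. \<forall>x\<in>K. norm (D n x - F x) \<le> \<delta>"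
proof -
  have F: "norm (F x - F y) \<le> C * dist x y" if "x \<in> K" "y \<in> K" for x y
  proof (rule tendsto_upperbound)
    show "(\<lambda>n. norm (D n x - D n y)) \<longlonglongrightarrow> norm (F x - F y)" using lim that by (intro tendsto_intros)
    show "\<forall>\<^sub>F n in sequentially. norm (D n x - D n y) \<le> C * dist x y"
      using lip by eventually_elim (use that in blast)
  qed simp
  define r where "r = \<delta> / (3 * (C + 1))"
  have r: "r > 0" using \<delta> C by (simp add: r_def)
  obtain X where X: "finite X" "X \<subseteq> K" "K \<subseteq> (\<Union>x\<in>X. ball x r)"
    using compactE_image[OF K, of K "\<lambda>x. ball x r"] r by (metis UN_I centre_in_ball open_ball subsetI)
  have "\<forall>\<^sub>F n in sequentially. \<forall>x\<in>X. norm (D n x - F x) < \<delta> / 3"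
  proof (subst eventually_ball_finite_distrib[OF X(1)], intro ballI)
    fix x assume "x \<in> X"
    then have "(\<lambda>n. D n x) \<longlonglongrightarrow> F x" using lim X(2) by blast
    then show "\<forall>\<^sub>F n in sequentially. norm (D n x - F x) < \<delta> / 3"
      using \<delta> tendstoD[of "\<lambda>n. D n x" "F x" sequentially "\<delta> / 3"] by (simp add: dist_norm)
  qed
  then show ?thesis using lip
  proof eventually_elim
    case (elim n)
    show ?case
    proof
      fix y assume y: "y \<in> K"
      then obtain x where x: "x \<in> X" "dist x y < r" using X(3) by auto
      then have xK: "x \<in> K" using X(2) by blast
      have "C * dist x y \<le> (C + 1) * r" using x(2) C by (intro mult_mono) auto
      also have "\<dots> = \<delta> / 3" using C by (simp add: r_def field_simps)
      finally have "norm (D n x - D n y) \<le> \<delta> / 3" "norm (F x - F y) \<le> \<delta> / 3"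
        using elim(2) F xK y by (blast intro: order_trans)+
      moreover have "norm (D n x - F x) < \<delta> / 3" using elim(1) x(1) by blast
      moreover have "D n y - F y = (D n x - F x) - (D n x - D n y) + (F x - F y)" by simp
      then have "norm (D n y - F y) \<le> norm (D n x - F x) + norm (D n x - D n y) + norm (F x - F y)"
        using norm_triangle_ineq[of "(D n x - F x) - (D n x - D n y)" "F x - F y"]
          norm_triangle_ineq4[of "D n x - F x" "D n x - D n y"] by simp
      ultimately show "norm (D n y - F y) \<le> \<delta>" by linarith
    qed
  qed
qed

section \<open>Blow-ups of Kobayashi isometries\<close>

definition kobayashi_isometry_on :: "(complex \<Rightarrow> complex \<times> complex) \<Rightarrow> complex set \<Rightarrow> bool"
  where "kobayashi_isometry_on f U \<longleftrightarrow> open U \<and> U \<subseteq> unit_disc \<and> f ` U \<subseteq> G2 \<and>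
    (\<forall>a\<in>U. \<forall>b\<in>U. kobayashi_dist G2 (f a) (f b) = poincare_dist a b)"

lemma kobayashi_isometry_onD:
  assumes "kobayashi_isometry_on f U"
  shows "open U" "\<And>a. a \<in> U \<Longrightarrow> cmod a < 1" "\<And>a. a \<in> U \<Longrightarrow> f a \<in> G2"
    "\<And>a b. a \<in> U \<Longrightarrow> b \<in> U \<Longrightarrow> kobayashi_dist G2 (f a) (f b) = poincare_dist a b"
  using assms by (auto simp: kobayashi_isometry_on_def)

lemma kobayashi_isometry_on_G2_aut:
  assumes f: "kobayashi_isometry_on f U" and \<alpha>: "cmod \<alpha> < 1"
  shows "kobayashi_isometry_on (\<lambda>z. G2_aut \<alpha> (f z)) U"
  unfolding kobayashi_isometry_on_def
proof (intro conjI ballI)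
  show "open U" "U \<subseteq> unit_disc" using f by (simp_all add: kobayashi_isometry_on_def)
  show "(\<lambda>z. G2_aut \<alpha> (f z)) ` U \<subseteq> G2" using kobayashi_isometry_onD(3)[OF f] G2_aut_in[OF \<alpha>] by (simp add: image_subset_iff)
  show "kobayashi_dist G2 (G2_aut \<alpha> (f a)) (G2_aut \<alpha> (f b)) = poincare_dist a b" if "a \<in> U" "b \<in> U" for a b
    using kobayashi_G2_aut[OF \<alpha>] kobayashi_isometry_onD(3,4)[OF f] that by simp
qed

lemma kobayashi_isometry_contracts:
  assumes f: "kobayashi_isometry_on f U" and ab: "a \<in> U" "b \<in> U"
    and FD: "\<And>x. x \<in> G2 \<Longrightarrow> cmod (F x) < 1"
    and hol: "\<And>\<phi>. holomorphic_map_on \<phi> unit_disc \<Longrightarrow> \<phi> ` unit_disc \<subseteq> G2 \<Longrightarrow>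
                (\<lambda>z. F (\<phi> z)) holomorphic_on unit_disc"
  shows "cmod (disc_aut (F (f b)) (F (f a))) \<le> cmod (disc_aut b a)"
proof -
  note fD = kobayashi_isometry_onD[OF f]
  have "poincare_dist (F (f a)) (F (f b)) \<le> poincare_dist a b"
    using kobayashi_lower_bound[OF FD hol fD(3)[OF ab(1)] fD(3)[OF ab(2)]] fD(4)[OF ab] by simp
  then show ?thesis
    by (subst (asm) poincare_dist_le_iff) (simp_all add: FD fD ab)
qed

lemma kobayashi_isometry_contracts_magic:
  assumes f: "kobayashi_isometry_on f U" and ab: "a \<in> U" "b \<in> U" and \<omega>: "cmod \<omega> = 1"
  shows "cmod (disc_aut (magic \<omega> (f b)) (magic \<omega> (f a))) \<le> cmod (disc_aut b a)"
proof -
  note fD = kobayashi_isometry_onD[OF f]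
  have "poincare_dist (magic \<omega> (f a)) (magic \<omega> (f b)) \<le> poincare_dist a b"
    using kobayashi_magic_le[OF fD(3)[OF ab(1)] fD(3)[OF ab(2)] \<omega>] fD(4)[OF ab] by simp
  then show ?thesis
    by (subst (asm) poincare_dist_le_iff) (simp_all add: magic_less_1 \<omega> fD ab)
qed

lemma cmod_diff_le_disc_aut:
  assumes "cmod u < 1" "cmod v < 1"
  shows "cmod (u - v) \<le> 2 * cmod (disc_aut v u)"
proof -
  have nz: "1 - cnj v * u \<noteq> 0" using one_minus_cnj_nonzero assms by blast
  have "cmod v * cmod u \<le> 1 * 1" using assms by (intro mult_mono) auto
  then have "cmod (1 - cnj v * u) \<le> 2"
    using norm_triangle_ineq4[of 1 "cnj v * u"] by (simp add: norm_mult)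
  then have "cmod (disc_aut v u) * cmod (1 - cnj v * u) \<le> cmod (disc_aut v u) * 2"
    by (intro mult_left_mono) auto
  then show ?thesis using nz by (simp add: disc_aut_def norm_divide mult.commute)
qed

lemma disc_aut_le:
  assumes "cmod a < 1" "cmod b < 1"
  shows "cmod (disc_aut b a) \<le> cmod (a - b) / (1 - cmod b)"
proof -
  have "cmod b * cmod a \<le> cmod b * 1" using assms by (intro mult_left_mono) auto
  then have "1 - cmod b \<le> cmod (1 - cnj b * a)"
    using norm_triangle_ineq2[of 1 "cnj b * a"] by (simp add: norm_mult)
  then show ?thesis using assms by (simp add: disc_aut_def norm_divide frac_le)
qed

text \<open>\<open>fst x / 2\<close> and \<open>snd x\<close> are functions into the disc, so f
  contracts through them. The pseudohyperbolic distance is comparable with the Euclidean one away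
  from the unit circle; 6 is the sum of the factors 4 and 2 for the two coordinates.\<close>

lemma kobayashi_isometry_local_Lipschitz:
  assumes f: "kobayashi_isometry_on f U" and a: "a \<in> U"
  obtains r C where "r > 0" "C \<ge> 0" "ball a r \<subseteq> U"
    "\<And>x y. x \<in> ball a r \<Longrightarrow> y \<in> ball a r \<Longrightarrow> norm (f x - f y) \<le> C * cmod (x - y)"
proof -
  note fD = kobayashi_isometry_onD[OF f]
  obtain r0 where r0: "r0 > 0" "ball a r0 \<subseteq> U" using fD(1) a open_contains_ball by blast
  \<comment> \<open>Half the distance of a to the unit circle; it bounds 1 - |y| from below for all
    y in the ball.\<close>
  define s where "s = (1 - cmod a) / 2"
  have s: "s > 0" using fD(2)[OF a] by (simp add: s_def)
  define r where "r = min r0 s"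
  have r: "r > 0" "ball a r \<subseteq> U" using r0 s by (auto simp: r_def)
  show ?thesis
  proof (rule that[OF r(1) _ r(2)])
    show "0 \<le> 6 / s" using s by simp
    fix x y assume xy: "x \<in> ball a r" "y \<in> ball a r"
    then have U: "x \<in> U" "y \<in> U" using r by auto
    have fx: "(fst (f z), snd (f z)) \<in> G2" if "z \<in> U" for z using fD(3)[OF that] by simp
    let ?d = "cmod (disc_aut y x)"
    have half: "cmod (fst z / 2) < 1" if "z \<in> G2" for z
      using G2_bounds(2)[of "fst z" "snd z"] that by (simp add: norm_divide)
    have "cmod (disc_aut (fst (f y) / 2) (fst (f x) / 2)) \<le> ?d"
      by (rule kobayashi_isometry_contracts[OF f U, of "\<lambda>z. fst z / 2", OF half])
        (auto simp: holomorphic_map_on_def intro!: holomorphic_intros)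
    then have "cmod (fst (f x) / 2 - fst (f y) / 2) \<le> 2 * ?d"
      using cmod_diff_le_disc_aut[OF half half, OF fD(3) fD(3), OF U] by linarith
    then have 1: "cmod (fst (f x) - fst (f y)) \<le> 4 * ?d"
      by (simp add: norm_divide flip: diff_divide_distrib)
    have p1: "cmod (snd z) < 1" if "z \<in> G2" for z
      using G2_bounds(1)[of "fst z" "snd z"] that by simp
    have "cmod (disc_aut (snd (f y)) (snd (f x))) \<le> ?d"
      by (rule kobayashi_isometry_contracts[OF f U, of snd, OF p1]) (auto simp: holomorphic_map_on_def)
    then have 2: "cmod (snd (f x) - snd (f y)) \<le> 2 * ?d"
      using cmod_diff_le_disc_aut[OF p1 p1, OF fD(3) fD(3), OF U] by linarith
    have "norm (f x - f y) \<le> cmod (fst (f x) - fst (f y)) + cmod (snd (f x) - snd (f y))"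
      using norm_Pair_le[of "fst (f x - f y)" "snd (f x - f y)"] by (simp add: minus_prod_def)
    then have le: "norm (f x - f y) \<le> 6 * ?d" using 1 2 by linarith
    have "cmod y \<le> cmod a + cmod (a - y)" using norm_triangle_ineq2[of y a] by (simp add: norm_minus_commute)
    then have "1 - cmod y \<ge> s" using xy(2) by (simp add: r_def s_def dist_norm)
    then have "cmod (x - y) / (1 - cmod y) \<le> cmod (x - y) / s" using s by (intro divide_left_mono) auto
    then have "?d \<le> cmod (x - y) / s" using disc_aut_le[OF fD(2) fD(2), OF U] by linarith
    then show "norm (f x - f y) \<le> 6 / s * cmod (x - y)" using le by simp
  qed
qed

lemma kobayashi_isometry_continuous:
  assumes f: "kobayashi_isometry_on f U"
  shows "continuous_on U f"
proof -
  have "isCont f a" if a: "a \<in> U" for a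
  proof -
    obtain r C where r: "r > 0" "C \<ge> 0" "ball a r \<subseteq> U"
      "\<And>x y. x \<in> ball a r \<Longrightarrow> y \<in> ball a r \<Longrightarrow> norm (f x - f y) \<le> C * cmod (x - y)"
      by (rule kobayashi_isometry_local_Lipschitz[OF f a]) blast
    have "C-lipschitz_on (ball a r) f" using r by (intro lipschitz_onI) (auto simp: dist_norm)
    then have "continuous_on (ball a r) f" by (rule lipschitz_on_continuous_on)
    then show ?thesis using r(1) by (simp add: continuous_on_eq_continuous_at)
  qed
  then show ?thesis by (simp add: continuous_at_imp_continuous_on)
qed

definition quotient :: "(complex \<Rightarrow> complex \<times> complex) \<Rightarrow> complex \<Rightarrow> real \<Rightarrow> complex \<Rightarrow> complex \<times> complex"
  where "quotient f b \<epsilon> h = (f (b + of_real \<epsilon> * h) - f b) /\<^sub>R \<epsilon>"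

definition cscale :: "complex \<Rightarrow> complex \<times> complex \<Rightarrow> complex \<times> complex"
  where "cscale c x = (c * fst x, c * snd x)"

text \<open>A subsequence of the quotients converges pointwise, and the limit satisfies
  \<open>tangent_isometry\<close>, hence is linear or conjugate linear. The clause on \<omega>
  records a functional that norms T; it later yields equality in the Schwarz lemma.\<close>

lemma blow_up_at_center:
  fixes b :: "nat \<Rightarrow> complex" and \<epsilon> :: "nat \<Rightarrow> real"
  assumes f: "kobayashi_isometry_on f U" and a: "a \<in> U" and fa: "f a = (0, p)" and p0: "p \<noteq> 0"
    and b: "b \<longlonglongrightarrow> a" and \<epsilon>: "\<epsilon> \<longlonglongrightarrow> 0" "\<And>n. \<epsilon> n > 0"
  shows "\<exists>k T. strict_mono k \<and> T \<noteq> 0 \<and>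
    (\<exists>\<omega>. cmod \<omega> = 1 \<and> cmod (mlin p \<omega> T) * (1 - (cmod a)\<^sup>2) = 1 - (cmod p)\<^sup>2) \<and>
    ((\<forall>h. (\<lambda>n. quotient f (b (k n)) (\<epsilon> (k n)) h) \<longlonglongrightarrow> cscale h T) \<or>
     (\<forall>h. (\<lambda>n. quotient f (b (k n)) (\<epsilon> (k n)) h) \<longlonglongrightarrow> cscale (cnj h) T))"
proof -
  note fD = kobayashi_isometry_onD[OF f]
  have p: "cmod p < 1" using G2_bounds(1)[of 0 p] fD(3)[OF a] fa by simp
  have pp: "1 - (cmod p)\<^sup>2 > 0" using p by (simp add: abs_square_less_1)
  have aa: "1 - (cmod a)\<^sup>2 > 0" using fD(2)[OF a] by (simp add: abs_square_less_1)
  obtain r C where r: "r > 0" "C \<ge> 0" "ball a r \<subseteq> U"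
    and lip: "\<And>x y. x \<in> ball a r \<Longrightarrow> y \<in> ball a r \<Longrightarrow> norm (f x - f y) \<le> C * cmod (x - y)"
    by (rule kobayashi_isometry_local_Lipschitz[OF f a]) blast
  define x where "x = (\<lambda>n h. b n + of_real (\<epsilon> n) * h)"
  have x: "(\<lambda>n. x n h) \<longlonglongrightarrow> a" for h
    unfolding x_def using b \<epsilon>(1) by (auto intro!: tendsto_eq_intros)
  have xb: "\<forall>\<^sub>F n in sequentially. x n h \<in> ball a r" for h
    using x r(1) by (auto simp: tendsto_iff dist_commute)
  have x0: "x n 0 = b n" for n by (simp add: x_def)
  define D where "D = (\<lambda>n h. quotient f (b n) (\<epsilon> n) h)"
  have Dx: "D n h = (f (x n h) - f (x n 0)) /\<^sub>R \<epsilon> n" for n h by (simp add: D_def quotient_def x_def)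
  have "\<forall>\<^sub>F n in sequentially. norm (D n h - D n h') \<le> C * norm (h - h')" for h h'
    using xb[of h] xb[of h']
  proof eventually_elim
    case (elim n)
    have "D n h - D n h' = (f (x n h) - f (x n h')) /\<^sub>R \<epsilon> n"
      unfolding Dx by (simp flip: scaleR_right_diff_distrib)
    then have "norm (D n h - D n h') = norm (f (x n h) - f (x n h')) / \<epsilon> n"
      using \<epsilon>(2)[of n] by (simp add: divide_inverse mult.commute)
    also have "\<dots> \<le> C * cmod (x n h - x n h') / \<epsilon> n"
      using lip[OF elim] \<epsilon>(2)[of n] by (simp add: divide_right_mono)
    also have "x n h - x n h' = of_real (\<epsilon> n) * (h - h')" by (simp add: x_def algebra_simps)
    also have "C * cmod (of_real (\<epsilon> n) * (h - h')) / \<epsilon> n = C * cmod (h - h')"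
      using \<epsilon>(2)[of n] by (simp add: norm_mult)
    finally show ?case .
  qed
  moreover have "D n 0 = 0" for n by (simp add: Dx)
  ultimately obtain k F where k: "strict_mono k" and F: "\<And>h. (\<lambda>n. D (k n) h) \<longlonglongrightarrow> F h"
    using asymptotically_Lipschitz_subsequence[OF r(2), of D] by blast
  have sub: "(\<lambda>n. s (k n)) \<longlonglongrightarrow> l" if "s \<longlonglongrightarrow> l" for s :: "nat \<Rightarrow> 'b::topological_space" and l
    using LIMSEQ_subseq_LIMSEQ[OF that k] by (simp add: comp_def)
  have subev: "\<forall>\<^sub>F n in sequentially. P (k n)" if "\<forall>\<^sub>F n in sequentially. P n" for P
    using filterlim_subseq[OF k] that by (auto simp: filterlim_iff)
  have isc: "isCont f a" using kobayashi_isometry_continuous[OF f] a fD(1) by (simp add: continuous_on_eq_continuous_at)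
  have X: "(\<lambda>n. f (x (k n) h)) \<longlonglongrightarrow> (0, p)" for h
    using isCont_tendsto_compose[OF isc sub[OF x]] by (simp add: fa)
  have V: "(\<lambda>n. (f (x (k n) h) - f (x (k n) h')) /\<^sub>R \<epsilon> (k n)) \<longlonglongrightarrow> F h - F h'" for h h'
  proof -
    have "(\<lambda>n. D (k n) h - D (k n) h') \<longlonglongrightarrow> F h - F h'" by (intro tendsto_intros F)
    then show ?thesis unfolding Dx by (simp flip: scaleR_right_diff_distrib)
  qed
  have inU: "\<forall>\<^sub>F n in sequentially. x (k n) h \<in> U" for h
    using subev[OF xb[of h]] by (rule eventually_mono) (use r(3) in blast)
  have one_minus: "(\<lambda>n. cmod (1 - cnj (x (k n) h') * x (k n) h)) \<longlonglongrightarrow> 1 - (cmod a)\<^sup>2" for h h'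
  proof -
    have "(\<lambda>n. cmod (1 - cnj (x (k n) h') * x (k n) h)) \<longlonglongrightarrow> cmod (1 - cnj a * a)"
      by (intro tendsto_intros sub[OF x])
    moreover have "1 - cnj a * a = of_real (1 - (cmod a)\<^sup>2)"
      unfolding of_real_diff of_real_cmod_power2 by (simp add: mult.commute)
    then have "cmod (1 - cnj a * a) = 1 - (cmod a)\<^sup>2" using aa by (simp only: norm_of_real abs_of_pos)
    ultimately show ?thesis by simp
  qed
  have xdiff: "x n h - x n h' = of_real (\<epsilon> n) * (h - h')" for n h h' by (simp add: x_def algebra_simps)
  \<comment> \<open>The Poincare density 1 / (1 - |a|^2) of the source divided by the density 1 / (1
    - |p|^2) at the value \<omega> p of the magic function.\<close>
  define N where "N = (1 - (cmod p)\<^sup>2) / (1 - (cmod a)\<^sup>2)"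
  have contr: "cmod (mlin p \<omega> (F h - F h')) \<le> N * cmod (h - h')" if \<omega>: "cmod \<omega> = 1" for \<omega> h h'
  proof -
    define m where "m = (\<lambda>n h. magic \<omega> (f (x (k n) h)))"
    have "((\<lambda>n. (m n h - m n h') /\<^sub>R \<epsilon> (k n)) \<longlonglongrightarrow> \<omega> * mlin p \<omega> (F h - F h'))"
      unfolding m_def by (rule magic_difference_quotient[OF X X V \<omega>])
    then have "(\<lambda>n. cmod ((m n h - m n h') /\<^sub>R \<epsilon> (k n)) * cmod (1 - cnj (x (k n) h') * x (k n) h)) \<longlonglongrightarrow>
       cmod (\<omega> * mlin p \<omega> (F h - F h')) * (1 - (cmod a)\<^sup>2)"
      by (intro tendsto_intros one_minus)
    moreover have "(\<lambda>n. cmod (h - h') * cmod (1 - cnj (m n h') * m n h)) \<longlonglongrightarrow> cmod (h - h') * (1 - (cmod p)\<^sup>2)"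
    proof -
      have m: "(\<lambda>n. m n h) \<longlonglongrightarrow> \<omega> * p" for h
      proof -
        have s: "(\<lambda>n. fst (f (x (k n) h))) \<longlonglongrightarrow> 0" "(\<lambda>n. snd (f (x (k n) h))) \<longlonglongrightarrow> p"
          using tendsto_fst[OF X[of h]] tendsto_snd[OF X[of h]] by simp_all
        have "(\<lambda>n. magic \<omega> (f (x (k n) h))) \<longlonglongrightarrow> (2 * \<omega> * p - 0) / (2 - \<omega> * 0)"
          unfolding magic_def by (intro tendsto_intros s) simp
        then show ?thesis by (simp add: m_def)
      qed
      have "(\<lambda>n. cmod (h - h') * cmod (1 - cnj (m n h') * m n h)) \<longlonglongrightarrow> cmod (h - h') * cmod (1 - cnj (\<omega> * p) * (\<omega> * p))"
        by (intro tendsto_intros m)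
      moreover have "cnj (\<omega> * p) * (\<omega> * p) = of_real ((cmod p)\<^sup>2)"
        using unit_cnj(2)[OF \<omega>] unfolding of_real_cmod_power2 by (simp add: mult_ac)
      then have "1 - cnj (\<omega> * p) * (\<omega> * p) = of_real (1 - (cmod p)\<^sup>2)" by simp
      then have "cmod (1 - cnj (\<omega> * p) * (\<omega> * p)) = 1 - (cmod p)\<^sup>2" using pp by (simp only: norm_of_real abs_of_pos)
      ultimately show ?thesis by simp
    qed
    moreover have "\<forall>\<^sub>F n in sequentially. cmod ((m n h - m n h') /\<^sub>R \<epsilon> (k n)) * cmod (1 - cnj (x (k n) h') * x (k n) h)
        \<le> cmod (h - h') * cmod (1 - cnj (m n h') * m n h)"
      using inU[of h] inU[of h']
    proof eventually_elim
      case (elim n)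
      have e: "\<epsilon> (k n) > 0" by (rule \<epsilon>)
      have m1: "cmod (m n h) < 1" "cmod (m n h') < 1" unfolding m_def by (intro magic_less_1 fD(3) elim \<omega>)+
      have nz: "cmod (1 - cnj (m n h') * m n h) > 0" "cmod (1 - cnj (x (k n) h') * x (k n) h) > 0"
        using one_minus_cnj_nonzero[OF m1(2,1)] one_minus_cnj_nonzero[OF fD(2)[OF elim(2)] fD(2)[OF elim(1)]] by simp_all
      have "cmod (disc_aut (m n h') (m n h)) \<le> cmod (disc_aut (x (k n) h') (x (k n) h))"
        unfolding m_def by (rule kobayashi_isometry_contracts_magic[OF f elim \<omega>])
      then have "cmod (m n h - m n h') / cmod (1 - cnj (m n h') * m n h) \<le>
        \<epsilon> (k n) * cmod (h - h') / cmod (1 - cnj (x (k n) h') * x (k n) h)"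
        unfolding disc_aut_def norm_divide xdiff norm_mult using e by simp
      then have "cmod (m n h - m n h') * cmod (1 - cnj (x (k n) h') * x (k n) h) \<le>
        \<epsilon> (k n) * cmod (h - h') * cmod (1 - cnj (m n h') * m n h)"
        using nz by (simp add: field_simps)
      moreover have "inverse e * A \<le> B" if "A \<le> e * B" "0 < e" for A B e :: real
        using that by (simp add: field_simps)
      ultimately have "inverse (\<epsilon> (k n)) * (cmod (m n h - m n h') * cmod (1 - cnj (x (k n) h') * x (k n) h)) \<le>
        cmod (h - h') * cmod (1 - cnj (m n h') * m n h)" using e by (simp only: mult.assoc)
      then show ?case using e by (simp only: norm_scaleR abs_inverse abs_of_pos mult.assoc)
    qed
    ultimately have "cmod (\<omega> * mlin p \<omega> (F h - F h')) * (1 - (cmod a)\<^sup>2) \<le> cmod (h - h') * (1 - (cmod p)\<^sup>2)"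
      unfolding eventually_sequentially by (rule LIMSEQ_le)
    then show ?thesis using aa by (simp add: N_def norm_mult \<omega> field_simps)
  qed
  \<comment> \<open>A disc whose derivative is (F h - F h') / q bounds the distance of the two image
    points at scale \<epsilon> by about \<epsilon> q. The loss 1 / s from
    \<open>kobayashi_local_upper_bound\<close> disappears as s tends to 1.\<close>
  have upper: "cmod (h - h') \<le> q * (1 - (cmod a)\<^sup>2)"
    if \<phi>: "holomorphic_map_on \<phi> unit_disc" "\<phi> ` unit_disc \<subseteq> G2" "\<phi> 0 = (0, p)"
      "((\<lambda>z. fst (\<phi> z)) has_field_derivative A) (at 0)" "((\<lambda>z. snd (\<phi> z)) has_field_derivative B) (at 0)"
      and q: "q > 0" and AB: "F h - F h' = (of_real q * A, of_real q * B)" for \<phi> A B q h h'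
  proof (rule field_le_mult_one_interval)
    fix s :: real assume s: "0 < s" "s < 1"
    have \<epsilon>k: "(\<lambda>n. \<epsilon> (k n)) \<longlonglongrightarrow> 0" "\<forall>\<^sub>F n in sequentially. \<epsilon> (k n) > 0" using sub[OF \<epsilon>(1)] \<epsilon>(2) by simp_all
    have "\<forall>\<^sub>F n in sequentially. \<epsilon> (k n) * q / s < 1 \<and>
        kobayashi_dist G2 (f (x (k n) h')) (f (x (k n) h)) \<le> artanh (\<epsilon> (k n) * q / s)"
      using X[of h'] V[of h h'] unfolding AB \<phi>(3)[symmetric]
      by (intro kobayashi_local_upper_bound[OF \<phi>(1,2,4,5) q s \<epsilon>k])
    then have "\<forall>\<^sub>F n in sequentially. cmod (h - h') \<le> q / s * cmod (1 - cnj (x (k n) h') * x (k n) h)"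
      using inU[of h] inU[of h']
    proof eventually_elim
      case (elim n)
      have e: "\<epsilon> (k n) > 0" by (rule \<epsilon>)
      have x1: "cmod (x (k n) h) < 1" "cmod (x (k n) h') < 1" using fD(2) elim by blast+
      have nz: "cmod (1 - cnj (x (k n) h') * x (k n) h) > 0" using one_minus_cnj_nonzero[OF x1(2,1)] by simp
      have "artanh (cmod (disc_aut (x (k n) h') (x (k n) h))) \<le> artanh (\<epsilon> (k n) * q / s)"
        using elim fD(4)[OF elim(3,2)] by (simp add: poincare_dist_disc_aut cmod_disc_aut_commute)
      then have "cmod (disc_aut (x (k n) h') (x (k n) h)) \<le> \<epsilon> (k n) * q / s"
        using elim(1) e q s disc_aut_less_1[OF x1(2,1)] by (subst (asm) artanh_le_iff_real) auto
      then have "\<epsilon> (k n) * cmod (h - h') / cmod (1 - cnj (x (k n) h') * x (k n) h) \<le> \<epsilon> (k n) * (q / s)"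
        unfolding disc_aut_def norm_divide xdiff norm_mult using e by simp
      then have "\<epsilon> (k n) * cmod (h - h') \<le> \<epsilon> (k n) * (q / s) * cmod (1 - cnj (x (k n) h') * x (k n) h)"
        using nz by (simp add: pos_divide_le_eq)
      then show ?case unfolding mult.assoc mult_le_cancel_left_pos[OF e] .
    qed
    moreover have "(\<lambda>n. q / s * cmod (1 - cnj (x (k n) h') * x (k n) h)) \<longlonglongrightarrow> q / s * (1 - (cmod a)\<^sup>2)"
      by (intro tendsto_intros one_minus)
    ultimately have "cmod (h - h') \<le> q / s * (1 - (cmod a)\<^sup>2)"
      by (intro tendsto_lowerbound) auto
    then show "s * cmod (h - h') \<le> q * (1 - (cmod a)\<^sup>2)" using s by (simp add: field_simps)
  qed
  have zp: "(0, p) \<in> G2" using fD(3)[OF a] fa by simp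
  have att: "\<exists>\<omega>. cmod \<omega> = 1 \<and> cmod (mlin p \<omega> (F h - F h')) = N * cmod (h - h')" for h h'
  \<comment> \<open>There is no extremal disc for the zero vector. A constant disc has every q > 0
    as admissible speed, so h = h'.\<close>
  proof (cases "F h - F h' = 0")
    case True
    have "cmod (h - h') \<le> 0 + e" if "e > 0" for e
    proof -
      have "cmod (h - h') \<le> (e / (1 - (cmod a)\<^sup>2)) * (1 - (cmod a)\<^sup>2)"
      proof (rule upper[of "\<lambda>_. (0, p)" 0 0])
        show "holomorphic_map_on (\<lambda>_. (0, p)) unit_disc" by (simp add: holomorphic_map_on_def)
        show "(\<lambda>_. (0, p)) ` unit_disc \<subseteq> G2" using zp by auto
        show "e / (1 - (cmod a)\<^sup>2) > 0" using \<open>e > 0\<close> aa by simp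
      qed (use True in \<open>auto simp: zero_prod_def\<close>)
      then show ?thesis using aa by simp
    qed
    then have "cmod (h - h') \<le> 0" by (rule field_le_epsilon)
    then show ?thesis using True by (intro exI[of _ 1]) simp
  next
    case False
    have "continuous_on (sphere 0 1) (\<lambda>\<omega>. cmod (mlin p \<omega> (F h - F h')))"
      unfolding mlin_def ell_def by (intro continuous_intros)
    then obtain \<omega> where \<omega>: "\<omega> \<in> sphere 0 1"
      and max: "\<And>\<omega>'. \<omega>' \<in> sphere 0 1 \<Longrightarrow> cmod (mlin p \<omega>' (F h - F h')) \<le> cmod (mlin p \<omega> (F h - F h'))"
      using continuous_attains_sup[of "sphere (0::complex) 1" "\<lambda>\<omega>. cmod (mlin p \<omega> (F h - F h'))"] by auto
    define q where "q = cmod (mlin p \<omega> (F h - F h')) / (1 - (cmod p)\<^sup>2)"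
    have nz: "cmod (mlin p \<omega> (F h - F h')) > 0"
      using mlin_vanishes_imp[OF p, of "F h - F h'"] max[of 1] max[of "-1"] False
      by (metis dual_order.antisym mem_sphere_0 norm_ge_zero norm_minus_cancel norm_one norm_eq_zero zero_less_norm_iff)
    then have q: "q > 0" using pp by (simp add: q_def)
    have e: "(1 - (cmod p)\<^sup>2) / cmod (mlin p \<omega> (F h - F h')) = 1 / q" by (simp add: q_def)
    obtain \<phi> where \<phi>: "holomorphic_map_on \<phi> unit_disc" "\<phi> ` unit_disc \<subseteq> G2" "\<phi> 0 = (0, p)"
      "((\<lambda>z. fst (\<phi> z)) has_field_derivative fst (F h - F h') * of_real (1 / q)) (at 0)"
      "((\<lambda>z. snd (\<phi> z)) has_field_derivative snd (F h - F h') * of_real (1 / q)) (at 0)"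
      using extremal_disc[OF p False, of \<omega>] \<omega> max unfolding e by auto
    have "cmod (h - h') \<le> q * (1 - (cmod a)\<^sup>2)"
      using q by (intro upper[OF \<phi> q]) (simp add: prod_eq_iff)
    then have "N * cmod (h - h') \<le> cmod (mlin p \<omega> (F h - F h'))"
      using aa pp by (simp add: N_def q_def field_simps)
    then show ?thesis using contr[of \<omega> h h'] \<omega> by (intro exI[of _ \<omega>]) auto
  qed
  have F0: "F 0 = 0"
    using F[of 0] by (simp add: Dx LIMSEQ_const_iff)
  interpret tangent_isometry p N F
    by unfold_locales (use p pp aa F0 contr att in \<open>auto simp: N_def\<close>)
  obtain T where T: "(\<forall>h. F h = (h * fst T, h * snd T)) \<or> (\<forall>h. F h = (cnj h * fst T, cnj h * snd T))"
    using linear_or_conjugate_linear[OF p0] by blast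
  have "T \<noteq> 0"
  proof
    assume "T = 0"
    then have "F h = 0" for h using T by (auto simp: zero_prod_def)
    then show False using att[of 1 0] pp aa by (simp add: N_def)
  qed
  note T0 = this
  have "F 1 = T" using T by (auto simp: prod_eq_iff)
  then obtain \<omega> where "cmod \<omega> = 1" "cmod (mlin p \<omega> T) = N"
    using att[of 1 0] F0 by auto
  then have w: "\<exists>\<omega>. cmod \<omega> = 1 \<and> cmod (mlin p \<omega> T) * (1 - (cmod a)\<^sup>2) = 1 - (cmod p)\<^sup>2"
    using aa by (intro exI[of _ \<omega>]) (simp add: N_def)
  from T show ?thesis
  proof
    assume "\<forall>h. F h = (h * fst T, h * snd T)"
    then have "(\<lambda>n. quotient f (b (k n)) (\<epsilon> (k n)) h) \<longlonglongrightarrow> cscale h T" for h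
      using F[of h] by (simp add: D_def cscale_def)
    then show ?thesis using k T0 w by (intro exI[of _ k] exI[of _ T]) simp
  next
    assume "\<forall>h. F h = (cnj h * fst T, cnj h * snd T)"
    then have "(\<lambda>n. quotient f (b (k n)) (\<epsilon> (k n)) h) \<longlonglongrightarrow> cscale (cnj h) T" for h
      using F[of h] by (simp add: D_def cscale_def)
    then show ?thesis using k T0 w by (intro exI[of _ k] exI[of _ T]) simp
  qed
qed

text \<open>Centre f a by an automorphism, blow up there, and pull the limit back by the complex
  linear derivative of the inverse automorphism, which preserves the alternative.\<close>

lemma blow_up:
  fixes b :: "nat \<Rightarrow> complex" and \<epsilon> :: "nat \<Rightarrow> real"
  assumes f: "kobayashi_isometry_on f U" and a: "a \<in> U" and nr: "(fst (f a))\<^sup>2 \<noteq> 4 * snd (f a)"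
    and b: "b \<longlonglongrightarrow> a" and \<epsilon>: "\<epsilon> \<longlonglongrightarrow> 0" "\<And>n. \<epsilon> n > 0"
  shows "\<exists>k T. strict_mono k \<and> T \<noteq> 0 \<and>
    ((\<forall>h. (\<lambda>n. quotient f (b (k n)) (\<epsilon> (k n)) h) \<longlonglongrightarrow> cscale h T) \<or>
     (\<forall>h. (\<lambda>n. quotient f (b (k n)) (\<epsilon> (k n)) h) \<longlonglongrightarrow> cscale (cnj h) T))"
proof -
  note fD = kobayashi_isometry_onD[OF f]
  obtain \<alpha> where \<alpha>: "cmod \<alpha> < 1" "fst (G2_aut \<alpha> (f a)) = 0" using G2_center_exists[OF fD(3)[OF a]] .
  have \<alpha>': "cmod (- \<alpha>) < 1" using \<alpha>(1) by simp
  define g where "g = (\<lambda>z. G2_aut \<alpha> (f z))"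
  have g: "kobayashi_isometry_on g U" unfolding g_def by (rule kobayashi_isometry_on_G2_aut[OF f \<alpha>(1)])
  note gD = kobayashi_isometry_onD[OF g]
  define p where "p = snd (g a)"
  have ga: "g a = (0, p)" using \<alpha>(2) by (simp add: g_def p_def prod_eq_iff)
  have p0: "p \<noteq> 0" using nr G2_aut_royal_iff[OF \<alpha>(1) fD(3)[OF a]] \<alpha>(2) by (auto simp: p_def g_def)
  obtain k T where k: "strict_mono k" and T: "T \<noteq> 0"
    and lim: "(\<forall>h. (\<lambda>n. quotient g (b (k n)) (\<epsilon> (k n)) h) \<longlonglongrightarrow> cscale h T) \<or>
     (\<forall>h. (\<lambda>n. quotient g (b (k n)) (\<epsilon> (k n)) h) \<longlonglongrightarrow> cscale (cnj h) T)"
    using blow_up_at_center[OF g a ga p0 b \<epsilon>] by blast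
  have x: "(\<lambda>n. b (k n) + of_real (\<epsilon> (k n)) * h) \<longlonglongrightarrow> a" for h
  proof -
    have "(\<lambda>n. b n + of_real (\<epsilon> n) * h) \<longlonglongrightarrow> a" using b \<epsilon>(1) by (auto intro!: tendsto_eq_intros)
    then show ?thesis using LIMSEQ_subseq_LIMSEQ[OF _ k] by (fastforce simp: comp_def)
  qed
  have xU: "\<forall>\<^sub>F n in sequentially. b (k n) + of_real (\<epsilon> (k n)) * h \<in> U" for h
    using topological_tendstoD[OF x fD(1) a] .
  have cg: "(\<lambda>n. g (b (k n) + of_real (\<epsilon> (k n)) * h)) \<longlonglongrightarrow> g a" for h
  proof -
    have "isCont g a" using kobayashi_isometry_continuous[OF g] a fD(1) by (simp add: continuous_on_eq_continuous_at)
    then show ?thesis using x by (rule isCont_tendsto_compose)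
  qed
  have fg: "f z = G2_aut (- \<alpha>) (g z)" if "z \<in> U" for z
    using G2_aut_inverse[OF \<alpha>(1) fD(3)[OF that]] by (simp add: g_def)
  define L where "L = G2_aut_deriv (- \<alpha>) (g a)"
  have pull: "(\<lambda>n. quotient f (b (k n)) (\<epsilon> (k n)) h) \<longlonglongrightarrow> L V"
    if "(\<lambda>n. quotient g (b (k n)) (\<epsilon> (k n)) h) \<longlonglongrightarrow> V" for h V
  proof -
    have "(\<lambda>n. (G2_aut (- \<alpha>) (g (b (k n) + of_real (\<epsilon> (k n)) * h)) - G2_aut (- \<alpha>) (g (b (k n)))) /\<^sub>R \<epsilon> (k n)) \<longlonglongrightarrow> L V"
      unfolding L_def using cg[of 0] that unfolding quotient_def
      by (intro G2_aut_difference_quotient[OF _ cg _ \<alpha>' gD(3)[OF a]]) simp_all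
    moreover have "\<forall>\<^sub>F n in sequentially. (G2_aut (- \<alpha>) (g (b (k n) + of_real (\<epsilon> (k n)) * h)) - G2_aut (- \<alpha>) (g (b (k n)))) /\<^sub>R \<epsilon> (k n)
       = quotient f (b (k n)) (\<epsilon> (k n)) h"
      using xU[of h] xU[of 0] by eventually_elim (simp add: quotient_def fg)
    ultimately show ?thesis by (rule Lim_transform_eventually)
  qed
  have L: "L (cscale h T) = cscale h (L T)" for h
    using G2_aut_deriv_cmult[of "- \<alpha>" "g a" h "fst T" "snd T"] by (simp add: L_def cscale_def)
  \<comment> \<open>Argued without the formula for L: vanishing quotients of f would, pushed forward
    by the automorphism, give vanishing quotients of g, whereas these tend to T.\<close>
  have "L T \<noteq> 0"
  proof
    assume L0: "L T = 0"
    have z: "cscale h 0 = 0" for h by (simp add: cscale_def zero_prod_def)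
    have "(\<lambda>n. quotient f (b (k n)) (\<epsilon> (k n)) 1) \<longlonglongrightarrow> 0"
    proof (cases "\<forall>h. (\<lambda>n. quotient g (b (k n)) (\<epsilon> (k n)) h) \<longlonglongrightarrow> cscale h T")
      case True
      then show ?thesis using pull[of 1 "cscale 1 T"] unfolding L L0 z by blast
    next
      case False
      then show ?thesis using lim pull[of 1 "cscale (cnj 1) T"] unfolding L L0 z by blast
    qed
    moreover have cf: "(\<lambda>n. f (b (k n) + of_real (\<epsilon> (k n)) * h)) \<longlonglongrightarrow> f a" for h
    proof -
      have "isCont f a" using kobayashi_isometry_continuous[OF f] a fD(1) by (simp add: continuous_on_eq_continuous_at)
      then show ?thesis using x by (rule isCont_tendsto_compose)
    qed
    ultimately have "(\<lambda>n. quotient g (b (k n)) (\<epsilon> (k n)) 1) \<longlonglongrightarrow> G2_aut_deriv \<alpha> (f a) 0"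
      unfolding quotient_def g_def using cf[of 0]
      by (intro G2_aut_difference_quotient[OF _ cf _ \<alpha>(1) fD(3)[OF a]]) simp_all
    moreover have "G2_aut_deriv \<alpha> (f a) 0 = 0" by (simp add: G2_aut_deriv_def zero_prod_def)
    moreover have "(\<lambda>n. quotient g (b (k n)) (\<epsilon> (k n)) 1) \<longlonglongrightarrow> T"
      using lim by (auto dest: spec[of _ 1] simp: cscale_def)
    ultimately show False using T LIMSEQ_unique by metis
  qed
  note LT = this
  from lim show ?thesis
  proof
    assume l: "\<forall>h. (\<lambda>n. quotient g (b (k n)) (\<epsilon> (k n)) h) \<longlonglongrightarrow> cscale h T"
    have "(\<lambda>n. quotient f (b (k n)) (\<epsilon> (k n)) h) \<longlonglongrightarrow> cscale h (L T)" for h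
      using pull[OF l[rule_format, of h]] by (simp only: L)
    then show ?thesis using k LT by (intro exI[of _ k] exI[of _ "L T"]) simp
  next
    assume l: "\<forall>h. (\<lambda>n. quotient g (b (k n)) (\<epsilon> (k n)) h) \<longlonglongrightarrow> cscale (cnj h) T"
    have "(\<lambda>n. quotient f (b (k n)) (\<epsilon> (k n)) h) \<longlonglongrightarrow> cscale (cnj h) (L T)" for h
      using pull[OF l[rule_format, of h]] by (simp only: L)
    then show ?thesis using k LT by (intro exI[of _ k] exI[of _ "L T"]) simp
  qed
qed

section \<open>Local holomorphy off the royal variety\<close>

text \<open>Positive if the blow-up is close to \<open>h \<mapsto> h T\<close>, negative if it is close to \<open>h \<mapsto> cnj h T\<close>.\<close>

definition orientation :: "(complex \<Rightarrow> complex \<times> complex) \<Rightarrow> complex \<Rightarrow> real \<Rightarrow> real"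
  where "orientation f b \<epsilon> =
    norm (quotient f b \<epsilon> \<i> + cscale \<i> (quotient f b \<epsilon> 1)) - norm (quotient f b \<epsilon> \<i> - cscale \<i> (quotient f b \<epsilon> 1))"

lemma norm_cscale: "norm (cscale c x) = cmod c * norm x"
proof -
  have "norm (cscale c x) = sqrt ((cmod c)\<^sup>2 * ((norm (fst x))\<^sup>2 + (norm (snd x))\<^sup>2))"
    by (simp add: cscale_def norm_Pair norm_mult power_mult_distrib distrib_left)
  also have "\<dots> = cmod c * norm (fst x, snd x)" by (simp only: real_sqrt_mult norm_Pair real_sqrt_abs abs_norm_cancel)
  finally show ?thesis by simp
qed

lemma tendsto_cscale: "(X \<longlongrightarrow> x) F \<Longrightarrow> ((\<lambda>n. cscale c (X n)) \<longlongrightarrow> cscale c x) F"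
  unfolding cscale_def by (intro tendsto_intros)

lemma orientation_limit:
  assumes "T \<noteq> 0"
  shows "(\<And>h. (\<lambda>n. quotient f (b n) (\<epsilon> n) h) \<longlonglongrightarrow> cscale h T) \<Longrightarrow> \<forall>\<^sub>F n in sequentially. orientation f (b n) (\<epsilon> n) > 0"
    "(\<And>h. (\<lambda>n. quotient f (b n) (\<epsilon> n) h) \<longlonglongrightarrow> cscale (cnj h) T) \<Longrightarrow> \<forall>\<^sub>F n in sequentially. orientation f (b n) (\<epsilon> n) < 0"
proof -
  have *: "(\<lambda>n. orientation f (b n) (\<epsilon> n)) \<longlonglongrightarrow> norm (A + cscale \<i> B) - norm (A - cscale \<i> B)"
    if "(\<lambda>n. quotient f (b n) (\<epsilon> n) \<i>) \<longlonglongrightarrow> A" "(\<lambda>n. quotient f (b n) (\<epsilon> n) 1) \<longlonglongrightarrow> B" for A B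
    unfolding orientation_def using that by (intro tendsto_intros tendsto_cscale)
  have s: "cscale \<i> T + cscale \<i> T = cscale (2 * \<i>) T" "cscale (- \<i>) T - cscale \<i> T = cscale (- 2 * \<i>) T"
    "cscale (- \<i>) T + cscale \<i> T = 0" "cscale 1 T = T"
    by (simp_all add: cscale_def prod_eq_iff)
  {
    assume "\<And>h. (\<lambda>n. quotient f (b n) (\<epsilon> n) h) \<longlonglongrightarrow> cscale h T"
    from *[OF this[of \<i>] this[of 1]] have "(\<lambda>n. orientation f (b n) (\<epsilon> n)) \<longlonglongrightarrow> 2 * norm T"
      unfolding s by (simp add: s norm_cscale norm_mult)
    then show "\<forall>\<^sub>F n in sequentially. orientation f (b n) (\<epsilon> n) > 0"
      using assms by (intro order_tendstoD) auto
  next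
    assume "\<And>h. (\<lambda>n. quotient f (b n) (\<epsilon> n) h) \<longlonglongrightarrow> cscale (cnj h) T"
    from *[OF this[of \<i>] this[of 1]] have "(\<lambda>n. orientation f (b n) (\<epsilon> n)) \<longlonglongrightarrow> - 2 * norm T"
      by (simp add: s norm_cscale norm_mult)
    then show "\<forall>\<^sub>F n in sequentially. orientation f (b n) (\<epsilon> n) < 0"
      using assms by (intro order_tendstoD) auto
  }
qed

text \<open>Bad centres at scales tending to 0 would accumulate at some point. The blow-up along
  them converges pointwise, and the uniform Lipschitz bound makes the convergence uniform on the
  unit disc, a contradiction. Here \<sigma> stands for the identity or for
  \<open>cnj\<close>.\<close>

lemma uniformly_approximable:
  assumes lip: "\<And>x y. x \<in> ball a r \<Longrightarrow> y \<in> ball a r \<Longrightarrow> norm (f x - f y) \<le> C * cmod (x - y)"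
    and C: "C \<ge> 0" and \<rho>: "\<rho> < r"
    and blow: "\<And>b \<epsilon> c. (\<And>n. b n \<in> cball a \<rho>) \<Longrightarrow> b \<longlonglongrightarrow> c \<Longrightarrow> \<epsilon> \<longlonglongrightarrow> 0 \<Longrightarrow> (\<And>n. \<epsilon> n > 0) \<Longrightarrow>
      \<exists>k T. strict_mono (k :: nat \<Rightarrow> nat) \<and> (\<forall>h. (\<lambda>n. quotient f (b (k n)) (\<epsilon> (k n)) h) \<longlonglongrightarrow> cscale (\<sigma> h) T)"
    and \<delta>: "\<delta> > 0"
  shows "\<exists>\<eta>>0. \<forall>c\<in>cball a \<rho>. \<forall>\<epsilon>. 0 < \<epsilon> \<and> \<epsilon> < \<eta> \<longrightarrow>
    (\<exists>T. \<forall>h. cmod h \<le> 1 \<longrightarrow> norm (quotient f c \<epsilon> h - cscale (\<sigma> h) T) \<le> \<delta>)"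
proof (rule ccontr)
  define P where "P = (\<lambda>\<eta>. \<forall>c\<in>cball a \<rho>. \<forall>\<epsilon>. 0 < \<epsilon> \<and> \<epsilon> < \<eta> \<longrightarrow>
    (\<exists>T. \<forall>h. cmod h \<le> 1 \<longrightarrow> norm (quotient f c \<epsilon> h - cscale (\<sigma> h) T) \<le> \<delta>))"
  assume "\<not> ?thesis"
  then have none: "\<not> (\<exists>\<eta>>0. P \<eta>)" unfolding P_def .
  have "\<exists>c \<epsilon>. c \<in> cball a \<rho> \<and> 0 < \<epsilon> \<and> \<epsilon> < inverse (real (Suc n)) \<and>
    (\<forall>T. \<exists>h. cmod h \<le> 1 \<and> \<not> norm (quotient f c \<epsilon> h - cscale (\<sigma> h) T) \<le> \<delta>)" for n
  proof -
    have "0 < inverse (real (Suc n))" by simp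
    then have "\<not> P (inverse (real (Suc n)))" using none by blast
    then show ?thesis unfolding P_def by blast
  qed
  then obtain b \<epsilon> where b: "\<And>n. b n \<in> cball a \<rho>" and \<epsilon>: "\<And>n. 0 < \<epsilon> n" "\<And>n. \<epsilon> n < inverse (real (Suc n))"
    and bad: "\<And>n T. \<exists>h. cmod h \<le> 1 \<and> \<not> norm (quotient f (b n) (\<epsilon> n) h - cscale (\<sigma> h) T) \<le> \<delta>"
    by metis
  have \<epsilon>0: "\<epsilon> \<longlonglongrightarrow> 0"
  proof (rule real_tendsto_sandwich[OF _ _ tendsto_const LIMSEQ_inverse_real_of_nat])
    show "\<forall>\<^sub>F n in sequentially. 0 \<le> \<epsilon> n" using \<epsilon>(1) by (simp add: less_imp_le)
    show "\<forall>\<^sub>F n in sequentially. \<epsilon> n \<le> inverse (real (Suc n))"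
      by (intro always_eventually allI less_imp_le \<epsilon>(2))
  qed
  obtain c k where c: "c \<in> cball a \<rho>" and k: "strict_mono k" and lim: "(b \<circ> k) \<longlonglongrightarrow> c"
    using seq_compactE[OF compact_imp_seq_compact[OF compact_cball] , of b a \<rho>] b by auto
  obtain l T where l: "strict_mono l"
    and L: "\<And>h. (\<lambda>n. quotient f ((b \<circ> k) (l n)) ((\<epsilon> \<circ> k) (l n)) h) \<longlonglongrightarrow> cscale (\<sigma> h) T"
  proof -
    have "\<exists>l T. strict_mono (l :: nat \<Rightarrow> nat) \<and> (\<forall>h. (\<lambda>n. quotient f ((b \<circ> k) (l n)) ((\<epsilon> \<circ> k) (l n)) h) \<longlonglongrightarrow> cscale (\<sigma> h) T)"
      by (rule blow[OF _ lim LIMSEQ_subseq_LIMSEQ[OF \<epsilon>0 k]]) (simp_all only: comp_def b \<epsilon>(1))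
    then show ?thesis using that by blast
  qed
  define D where "D = (\<lambda>n h. quotient f ((b \<circ> k) (l n)) ((\<epsilon> \<circ> k) (l n)) h)"
  have "(\<lambda>n. (\<epsilon> \<circ> k) (l n)) \<longlonglongrightarrow> 0"
    using LIMSEQ_subseq_LIMSEQ[OF LIMSEQ_subseq_LIMSEQ[OF \<epsilon>0 k] l] by (simp add: comp_def)
  then have "\<forall>\<^sub>F n in sequentially. (\<epsilon> \<circ> k) (l n) < r - \<rho>" using \<rho> by (intro order_tendstoD) auto
  then have "\<forall>\<^sub>F n in sequentially. \<forall>x\<in>cball 0 1. \<forall>y\<in>cball 0 1. norm (D n x - D n y) \<le> C * dist x y"
  proof eventually_elim
    case (elim n)
    define B E where "B = (b \<circ> k) (l n)" and "E = (\<epsilon> \<circ> k) (l n)"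
    have B: "B \<in> cball a \<rho>" and E: "0 < E" "E < r - \<rho>" using b \<epsilon>(1) elim by (simp_all add: B_def E_def)
    have in_ball: "B + of_real E * x \<in> ball a r" if "x \<in> cball 0 1" for x
    proof -
      have "cmod (of_real E * x) \<le> E * 1" using that E unfolding norm_mult by (intro mult_mono) auto
      moreover have "cmod (B - a) \<le> \<rho>" using B by (simp add: dist_norm norm_minus_commute)
      ultimately have "cmod ((B - a) + of_real E * x) < r"
        using E norm_triangle_ineq[of "B - a" "of_real E * x"] by linarith
      then show ?thesis by (simp add: dist_norm norm_minus_commute algebra_simps)
    qed
    show ?case
    proof (intro ballI)
      fix x y :: complex assume xy: "x \<in> cball 0 1" "y \<in> cball 0 1"
      have "D n x - D n y = (f (B + of_real E * x) - f (B + of_real E * y)) /\<^sub>R E"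
        unfolding D_def quotient_def B_def[symmetric] E_def[symmetric] by (simp flip: scaleR_right_diff_distrib)
      then have "norm (D n x - D n y) = norm (f (B + of_real E * x) - f (B + of_real E * y)) / E"
        using E by (simp add: divide_inverse mult.commute)
      also have "\<dots> \<le> C * cmod ((B + of_real E * x) - (B + of_real E * y)) / E"
        using lip[OF in_ball in_ball, OF xy] E by (intro divide_right_mono) auto
      also have "(B + of_real E * x) - (B + of_real E * y) = of_real E * (x - y)" by (simp add: algebra_simps)
      also have "C * cmod (of_real E * (x - y)) / E = C * dist x y" using E by (simp add: norm_mult dist_norm)
      finally show "norm (D n x - D n y) \<le> C * dist x y" .
    qed
  qed
  then have "\<forall>\<^sub>F n in sequentially. \<forall>x\<in>cball 0 1. norm (D n x - cscale (\<sigma> x) T) \<le> \<delta>"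
  proof (rule uniform_limit_if_uniformly_Lipschitz[OF compact_cball C _ _ \<delta>])
    show "(\<lambda>n. D n x) \<longlonglongrightarrow> cscale (\<sigma> x) T" for x unfolding D_def by (rule L)
  qed
  then have "\<exists>n. \<forall>x\<in>cball 0 1. norm (D n x - cscale (\<sigma> x) T) \<le> \<delta>"
    by (rule eventually_happens'[OF sequentially_bot])
  then obtain n where n: "\<forall>x\<in>cball 0 1. norm (D n x - cscale (\<sigma> x) T) \<le> \<delta>" ..
  obtain h where h: "cmod h \<le> 1" "\<not> norm (quotient f (b (k (l n))) (\<epsilon> (k (l n))) h - cscale (\<sigma> h) T) \<le> \<delta>"
    using bad[of "k (l n)" T] by blast
  from n[rule_format, of h] h show False by (simp add: D_def)
qed

lemma component_approximation:
  assumes "norm (quotient f c \<epsilon> h - cscale u T) \<le> \<delta>" "\<epsilon> > 0"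
  shows "cmod (fst (f (c + of_real \<epsilon> * h)) - fst (f c) - of_real \<epsilon> * u * fst T) \<le> \<delta> * \<epsilon>"
    "cmod (snd (f (c + of_real \<epsilon> * h)) - snd (f c) - of_real \<epsilon> * u * snd T) \<le> \<delta> * \<epsilon>"
proof -
  define y where "y = quotient f c \<epsilon> h - cscale u T"
  have "\<epsilon> *\<^sub>R quotient f c \<epsilon> h = f (c + of_real \<epsilon> * h) - f c" using assms(2) by (simp add: quotient_def)
  then have e: "\<epsilon> *\<^sub>R y = f (c + of_real \<epsilon> * h) - f c - \<epsilon> *\<^sub>R cscale u T" by (simp add: y_def scaleR_right_diff_distrib)
  have "cmod (fst (\<epsilon> *\<^sub>R y)) \<le> norm (\<epsilon> *\<^sub>R y)" "cmod (snd (\<epsilon> *\<^sub>R y)) \<le> norm (\<epsilon> *\<^sub>R y)"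
    using norm_fst_le[of "fst (\<epsilon> *\<^sub>R y)" "snd (\<epsilon> *\<^sub>R y)"] norm_snd_le[of "snd (\<epsilon> *\<^sub>R y)" "fst (\<epsilon> *\<^sub>R y)"]
    by (simp_all only: prod.collapse)
  moreover have "norm (\<epsilon> *\<^sub>R y) \<le> \<delta> * \<epsilon>" using assms by (simp add: y_def mult.commute mult_right_mono)
  ultimately show "cmod (fst (f (c + of_real \<epsilon> * h)) - fst (f c) - of_real \<epsilon> * u * fst T) \<le> \<delta> * \<epsilon>"
    "cmod (snd (f (c + of_real \<epsilon> * h)) - snd (f c) - of_real \<epsilon> * u * snd T) \<le> \<delta> * \<epsilon>"
    unfolding e by (simp_all add: cscale_def scaleR_conv_of_real mult.assoc)
qed

lemma component_uniform_approximation: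
  assumes ap: "\<exists>\<eta>>0. \<forall>c\<in>B. \<forall>\<epsilon>. 0 < \<epsilon> \<and> \<epsilon> < \<eta> \<longrightarrow>
      (\<exists>T. \<forall>h. cmod h \<le> 1 \<longrightarrow> norm (quotient f c \<epsilon> h - cscale (\<sigma> h) T) \<le> \<delta>)"
    and comp: "\<And>c \<epsilon> h T. norm (quotient f c \<epsilon> h - cscale (\<sigma> h) T) \<le> \<delta> \<Longrightarrow> 0 < \<epsilon> \<Longrightarrow>
      cmod (g (c + of_real \<epsilon> * h) - g c - of_real \<epsilon> * h * t T) \<le> \<delta> * \<epsilon>"
  shows "\<exists>\<eta>>0. \<forall>c\<in>B. \<forall>\<epsilon>. 0 < \<epsilon> \<and> \<epsilon> < \<eta> \<longrightarrow>
      (\<exists>t. \<forall>h. cmod h \<le> 1 \<longrightarrow> cmod (g (c + of_real \<epsilon> * h) - g c - of_real \<epsilon> * h * t) \<le> \<delta> * \<epsilon>)"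
proof -
  obtain \<eta> where \<eta>: "\<eta> > 0" and T: "\<forall>c\<in>B. \<forall>\<epsilon>. 0 < \<epsilon> \<and> \<epsilon> < \<eta> \<longrightarrow>
      (\<exists>T. \<forall>h. cmod h \<le> 1 \<longrightarrow> norm (quotient f c \<epsilon> h - cscale (\<sigma> h) T) \<le> \<delta>)"
    using ap by (elim exE conjE) (rule that)
  show ?thesis
  proof (rule exI[of _ \<eta>], intro conjI \<eta> ballI allI impI)
    fix c \<epsilon> assume c: "c \<in> B" and \<epsilon>: "0 < \<epsilon> \<and> \<epsilon> < \<eta>"
    obtain T where "\<forall>h. cmod h \<le> 1 \<longrightarrow> norm (quotient f c \<epsilon> h - cscale (\<sigma> h) T) \<le> \<delta>"
      using T[rule_format, OF c \<epsilon>] by (elim exE) (rule that)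
    then show "\<exists>t. \<forall>h. cmod h \<le> 1 \<longrightarrow> cmod (g (c + of_real \<epsilon> * h) - g c - of_real \<epsilon> * h * t) \<le> \<delta> * \<epsilon>"
      using comp[OF _ conjunct1[OF \<epsilon>]] by (intro exI[of _ "t T"] allI impI) simp
  qed
qed

text \<open>\<open>orientation\<close> has no zero for base points near a and small scales, since
  zeros accumulating at a would contradict the blow-up there. It is continuous in base point and
  scale jointly on a connected set, so its sign is constant and all blow-ups near a have the same
  type.\<close>

lemma locally_holomorphic_or_antiholomorphic:
  assumes f: "kobayashi_isometry_on f U" and a: "a \<in> U" and nr: "(fst (f a))\<^sup>2 \<noteq> 4 * snd (f a)"
  obtains r where "r > 0" "ball a r \<subseteq> U" "holomorphic_map_on f (ball a r) \<or> antiholomorphic_map_on f (ball a r)"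
proof -
  note fD = kobayashi_isometry_onD[OF f]
  have cont: "continuous_on U f" by (rule kobayashi_isometry_continuous[OF f])
  obtain r1 C where r1: "r1 > 0" "C \<ge> 0" "ball a r1 \<subseteq> U"
    and lip: "\<And>x y. x \<in> ball a r1 \<Longrightarrow> y \<in> ball a r1 \<Longrightarrow> norm (f x - f y) \<le> C * cmod (x - y)"
    by (rule kobayashi_isometry_local_Lipschitz[OF f a]) blast
  have "continuous_on U (\<lambda>z. (fst (f z))\<^sup>2 - 4 * snd (f z))" by (intro continuous_intros cont)
  then have "open (U \<inter> (\<lambda>z. (fst (f z))\<^sup>2 - 4 * snd (f z)) -` (- {0}))"
    using fD(1) by (intro continuous_open_preimage) auto
  then obtain r2 where r2: "r2 > 0" "ball a r2 \<subseteq> U \<inter> (\<lambda>z. (fst (f z))\<^sup>2 - 4 * snd (f z)) -` (- {0})"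
    using a nr open_contains_ball by (metis (no_types, lifting) Int_iff vimage_eq Compl_iff singletonD right_minus_eq)
  \<comment> \<open>Base points within R of a and increments shorter than R stay in the ball of
    radius 2 R, where f is Lipschitz and avoids the royal variety.\<close>
  define R where "R = min r1 r2 / 2"
  have R: "R > 0" "2 * R \<le> r1" "2 * R \<le> r2" using r1 r2 by (simp_all add: R_def)
  have nrR: "(fst (f z))\<^sup>2 \<noteq> 4 * snd (f z)" "z \<in> U" if "z \<in> ball a (2 * R)" for z
  proof -
    have "z \<in> ball a r2" using that R by simp
    then have "z \<in> U \<inter> (\<lambda>z. (fst (f z))\<^sup>2 - 4 * snd (f z)) -` (- {0})" using r2(2) by blast
    then show "(fst (f z))\<^sup>2 \<noteq> 4 * snd (f z)" "z \<in> U" by auto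
  qed
  define P where "P = (\<lambda>r. \<forall>b\<in>ball a r. \<forall>\<epsilon>. 0 < \<epsilon> \<and> \<epsilon> < r \<longrightarrow> orientation f b \<epsilon> \<noteq> 0)"
  have "\<exists>r>0. r < R \<and> P r"
  proof (rule ccontr)
    assume none: "\<not> (\<exists>r>0. r < R \<and> P r)"
    \<comment> \<open>With \<open>Suc (Suc n)\<close> the factor is at most 1 / 2, so that the
      radius is less than R even for n = 0.\<close>
    have "\<exists>b \<epsilon>. b \<in> ball a (R * inverse (real (Suc (Suc n)))) \<and> 0 < \<epsilon> \<and> \<epsilon> < R * inverse (real (Suc (Suc n))) \<and> orientation f b \<epsilon> = 0" for n
    proof -
      define r where "r = R * inverse (real (Suc (Suc n)))"
      have "inverse (real (Suc (Suc n))) < 1" by (simp add: field_simps)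
      then have "R * inverse (real (Suc (Suc n))) < R * 1" using R(1) by (rule mult_strict_left_mono)
      then have "r < R" by (simp add: r_def)
      moreover have "r > 0" using R(1) by (simp add: r_def)
      ultimately have "\<not> P r" using none by blast
      then show ?thesis unfolding P_def r_def[symmetric] by blast
    qed
    then obtain b \<epsilon> where b: "\<And>n. b n \<in> ball a (R * inverse (real (Suc (Suc n))))" and
      \<epsilon>: "\<And>n. 0 < \<epsilon> n" "\<And>n. \<epsilon> n < R * inverse (real (Suc (Suc n)))" and bad: "\<And>n. orientation f (b n) (\<epsilon> n) = 0"
      by metis
    have R0: "(\<lambda>n. R * inverse (real (Suc (Suc n)))) \<longlonglongrightarrow> 0" by real_asymp
    have \<epsilon>0: "\<epsilon> \<longlonglongrightarrow> 0"
    proof (rule real_tendsto_sandwich[OF _ _ tendsto_const R0])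
      show "\<forall>\<^sub>F n in sequentially. 0 \<le> \<epsilon> n" using \<epsilon>(1) by (simp add: less_imp_le)
      show "\<forall>\<^sub>F n in sequentially. \<epsilon> n \<le> R * inverse (real (Suc (Suc n)))"
        by (intro always_eventually allI less_imp_le \<epsilon>(2))
    qed
    have "(\<lambda>n. dist (b n) a) \<longlonglongrightarrow> 0"
    proof (rule real_tendsto_sandwich[OF _ _ tendsto_const R0])
      have "dist (b n) a < R * inverse (real (Suc (Suc n)))" for n using b[of n] by (simp only: mem_ball dist_commute)
      then show "\<forall>\<^sub>F n in sequentially. dist (b n) a \<le> R * inverse (real (Suc (Suc n)))"
        by (intro always_eventually allI less_imp_le)
    qed simp
    then have "b \<longlonglongrightarrow> a" by (rule tendsto_dist_iff[THEN iffD2])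
    then obtain k T where T: "T \<noteq> 0" and
      "(\<forall>h. (\<lambda>n. quotient f (b (k n)) (\<epsilon> (k n)) h) \<longlonglongrightarrow> cscale h T) \<or>
       (\<forall>h. (\<lambda>n. quotient f (b (k n)) (\<epsilon> (k n)) h) \<longlonglongrightarrow> cscale (cnj h) T)"
      using blow_up[OF f a nr _ \<epsilon>0 \<epsilon>(1)] by blast
    then have "(\<forall>\<^sub>F n in sequentially. orientation f (b (k n)) (\<epsilon> (k n)) > 0) \<or> (\<forall>\<^sub>F n in sequentially. orientation f (b (k n)) (\<epsilon> (k n)) < 0)"
      using orientation_limit[OF T, of f "\<lambda>n. b (k n)" "\<lambda>n. \<epsilon> (k n)"] by blast
    then show False by (simp add: bad)
  qed
  then obtain r where r: "r > 0" "r < R"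
    and ori: "\<And>b \<epsilon>. b \<in> ball a r \<Longrightarrow> 0 < \<epsilon> \<Longrightarrow> \<epsilon> < r \<Longrightarrow> orientation f b \<epsilon> \<noteq> 0"
    unfolding P_def by blast
  define \<rho> where "\<rho> = r / 2"
  have \<rho>: "\<rho> > 0" "\<rho> < r" "\<rho> < r1" using r R by (simp_all add: \<rho>_def)
  have ballU: "ball a \<rho> \<subseteq> U" using \<rho> r1(3) by auto
  define S where "S = ball a r \<times> {0<..<r}"
  have "connected S" unfolding S_def by (intro connected_Times) auto
  moreover have "continuous_on S (\<lambda>x. orientation f (fst x) (snd x))"
  proof -
    have q: "continuous_on S (\<lambda>x. quotient f (fst x) (snd x) h)" if "cmod h \<le> 1" for h
    proof -
      have sub: "fst x \<in> U \<and> fst x + of_real (snd x) * h \<in> U" if "x \<in> S" for x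
      proof -
        have x: "cmod (fst x - a) < r" "0 < snd x" "snd x < r" using that by (auto simp: S_def dist_norm norm_minus_commute)
        have "cmod (of_real (snd x) * h) \<le> snd x * 1" using \<open>cmod h \<le> 1\<close> x(2) unfolding norm_mult by (intro mult_mono) auto
        then have "cmod ((fst x - a) + of_real (snd x) * h) < 2 * R"
          using x r norm_triangle_ineq[of "fst x - a" "of_real (snd x) * h"] by linarith
        then have "fst x + of_real (snd x) * h \<in> ball a (2 * R)" by (simp add: dist_norm norm_minus_commute algebra_simps)
        moreover have "fst x \<in> ball a (2 * R)" using x r by (simp add: dist_norm norm_minus_commute)
        ultimately show ?thesis using nrR(2) by blast
      qed
      have 1: "continuous_on S (\<lambda>x. f (fst x + of_real (snd x) * h))"
        by (rule continuous_on_compose2[OF cont]) (use sub in \<open>auto simp: image_subset_iff intro!: continuous_intros\<close>)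
      have 2: "continuous_on S (\<lambda>x. f (fst x))"
        by (rule continuous_on_compose2[OF cont]) (use sub in \<open>auto simp: image_subset_iff intro!: continuous_intros\<close>)
      have 3: "\<forall>x\<in>S. snd x \<noteq> 0" by (auto simp: S_def)
      show ?thesis unfolding quotient_def by (intro continuous_intros 1 2 3)
    qed
    show ?thesis
      unfolding orientation_def cscale_def by (intro continuous_intros q) auto
  qed
  ultimately have conn: "connected ((\<lambda>x. orientation f (fst x) (snd x)) ` S)" by (rule connected_continuous_image[rotated])
  have sign: "(\<forall>x\<in>S. orientation f (fst x) (snd x) > 0) \<or> (\<forall>x\<in>S. orientation f (fst x) (snd x) < 0)"
  proof (rule ccontr)
    assume "\<not> ?thesis"
    then obtain x y where xy: "x \<in> S" "y \<in> S" "orientation f (fst x) (snd x) \<le> 0" "orientation f (fst y) (snd y) \<ge> 0"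
      by (auto simp: not_less)
    then have "0 \<in> (\<lambda>x. orientation f (fst x) (snd x)) ` S"
      using connectedD_interval[OF conn] by (meson imageI)
    then show False using ori by (auto simp: S_def)
  qed
  have key': "(\<exists>\<eta>>0. \<forall>c\<in>cball a \<rho>. \<forall>\<epsilon>. 0 < \<epsilon> \<and> \<epsilon> < \<eta> \<longrightarrow>
      (\<exists>T. \<forall>h. cmod h \<le> 1 \<longrightarrow> norm (quotient f c \<epsilon> h - cscale (\<sigma> h) T) \<le> \<delta>))"
    if \<delta>: "\<delta> > 0" and \<sigma>: "(\<sigma> = (\<lambda>h. h) \<and> (\<forall>x\<in>S. orientation f (fst x) (snd x) > 0)) \<or> (\<sigma> = cnj \<and> (\<forall>x\<in>S. orientation f (fst x) (snd x) < 0))" for \<delta> \<sigma>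
  proof (rule uniformly_approximable[OF lip r1(2) \<rho>(3) _ \<delta>])
    fix b :: "nat \<Rightarrow> complex" and \<epsilon> :: "nat \<Rightarrow> real" and c
    assume b: "\<And>n. b n \<in> cball a \<rho>" "b \<longlonglongrightarrow> c" and \<epsilon>: "\<epsilon> \<longlonglongrightarrow> 0" "\<And>n. \<epsilon> n > 0"
    have c: "c \<in> cball a \<rho>" using b closed_sequentially[OF closed_cball] by blast
    then have "c \<in> ball a (2 * R)" using \<rho> r by auto
    note c' = nrR[OF this]
    obtain k T where k: "strict_mono k" and T: "T \<noteq> 0" and
      lim: "(\<forall>h. (\<lambda>n. quotient f (b (k n)) (\<epsilon> (k n)) h) \<longlonglongrightarrow> cscale h T) \<or>
       (\<forall>h. (\<lambda>n. quotient f (b (k n)) (\<epsilon> (k n)) h) \<longlonglongrightarrow> cscale (cnj h) T)"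
      using blow_up[OF f c'(2,1) b(2) \<epsilon>] by blast
    have "(\<lambda>n. \<epsilon> (k n)) \<longlonglongrightarrow> 0" using LIMSEQ_subseq_LIMSEQ[OF \<epsilon>(1) k] by (simp add: comp_def)
    then have "\<forall>\<^sub>F n in sequentially. \<epsilon> (k n) < r" using r by (intro order_tendstoD) auto
    then have inS: "\<forall>\<^sub>F n in sequentially. (b (k n), \<epsilon> (k n)) \<in> S"
    proof eventually_elim
      case (elim n)
      then show ?case using b(1)[of "k n"] \<epsilon>(2)[of "k n"] \<rho> by (simp add: S_def)
    qed
    \<comment> \<open>The sign of \<open>orientation\<close> along the sequence must agree with its
      sign on S, which excludes the other type of limit.\<close>
    have lim': "\<forall>h. (\<lambda>n. quotient f (b (k n)) (\<epsilon> (k n)) h) \<longlonglongrightarrow> cscale (\<sigma> h) T"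
      using lim
    proof
      assume l: "\<forall>h. (\<lambda>n. quotient f (b (k n)) (\<epsilon> (k n)) h) \<longlonglongrightarrow> cscale h T"
      then have "\<forall>\<^sub>F n in sequentially. orientation f (b (k n)) (\<epsilon> (k n)) > 0 \<and> (b (k n), \<epsilon> (k n)) \<in> S"
        using orientation_limit(1)[OF T, of f "\<lambda>n. b (k n)" "\<lambda>n. \<epsilon> (k n)"] inS by (simp add: eventually_conj)
      then have "\<exists>n. orientation f (b (k n)) (\<epsilon> (k n)) > 0 \<and> (b (k n), \<epsilon> (k n)) \<in> S"
        by (rule eventually_happens'[OF sequentially_bot])
      then obtain n where "orientation f (b (k n)) (\<epsilon> (k n)) > 0" "(b (k n), \<epsilon> (k n)) \<in> S" by blast
      then have "\<sigma> = (\<lambda>h. h)" using \<sigma> by force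
      then show ?thesis using l by simp
    next
      assume l: "\<forall>h. (\<lambda>n. quotient f (b (k n)) (\<epsilon> (k n)) h) \<longlonglongrightarrow> cscale (cnj h) T"
      then have "\<forall>\<^sub>F n in sequentially. orientation f (b (k n)) (\<epsilon> (k n)) < 0 \<and> (b (k n), \<epsilon> (k n)) \<in> S"
        using orientation_limit(2)[OF T, of f "\<lambda>n. b (k n)" "\<lambda>n. \<epsilon> (k n)"] inS by (simp add: eventually_conj)
      then have "\<exists>n. orientation f (b (k n)) (\<epsilon> (k n)) < 0 \<and> (b (k n), \<epsilon> (k n)) \<in> S"
        by (rule eventually_happens'[OF sequentially_bot])
      then obtain n where "orientation f (b (k n)) (\<epsilon> (k n)) < 0" "(b (k n), \<epsilon> (k n)) \<in> S" by blast
      then have "\<sigma> = cnj" using \<sigma> by force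
      then show ?thesis using l by simp
    qed
    show "\<exists>k T. strict_mono (k :: nat \<Rightarrow> nat) \<and> (\<forall>h. (\<lambda>n. quotient f (b (k n)) (\<epsilon> (k n)) h) \<longlonglongrightarrow> cscale (\<sigma> h) T)"
      using k lim' by blast
  qed
  have key: "\<exists>\<eta>>0. \<forall>c\<in>ball a \<rho>. \<forall>\<epsilon>. 0 < \<epsilon> \<and> \<epsilon> < \<eta> \<longrightarrow>
      (\<exists>T. \<forall>h. cmod h \<le> 1 \<longrightarrow> norm (quotient f c \<epsilon> h - cscale (\<sigma> h) T) \<le> \<delta>)"
    if "\<delta> > 0" "(\<sigma> = (\<lambda>h. h) \<and> (\<forall>x\<in>S. orientation f (fst x) (snd x) > 0)) \<or> (\<sigma> = cnj \<and> (\<forall>x\<in>S. orientation f (fst x) (snd x) < 0))" for \<delta> \<sigma>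
    using key'[OF that] by (elim exE conjE, intro exI conjI ballI) (assumption, erule bspec, simp)
  have contb: "continuous_on (ball a \<rho>) f" using cont ballU by (rule continuous_on_subset)
  show ?thesis
  proof (rule that[OF \<rho>(1) ballU])
    from sign show "holomorphic_map_on f (ball a \<rho>) \<or> antiholomorphic_map_on f (ball a \<rho>)"
    proof
      assume s: "\<forall>x\<in>S. orientation f (fst x) (snd x) > 0"
      note ap = key[OF _ disjI1[OF conjI[OF refl s]]]
      have "(\<lambda>z. fst (f z)) holomorphic_on ball a \<rho>"
        by (rule holomorphic_if_linear_at_small_scales[OF _
              component_uniform_approximation[OF ap, of _ "\<lambda>z. fst (f z)" fst, OF _ component_approximation(1)]])
          (intro continuous_intros contb)
      moreover have "(\<lambda>z. snd (f z)) holomorphic_on ball a \<rho>"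
        by (rule holomorphic_if_linear_at_small_scales[OF _
              component_uniform_approximation[OF ap, of _ "\<lambda>z. snd (f z)" snd, OF _ component_approximation(2)]])
          (intro continuous_intros contb)
      ultimately show ?thesis by (simp add: holomorphic_map_on_def)
    next
      assume s: "\<forall>x\<in>S. orientation f (fst x) (snd x) < 0"
      note ap = key[OF _ disjI2[OF conjI[OF refl s]]]
      have conj: "cmod (cnj x - cnj y - of_real \<epsilon> * h * cnj t) = cmod (x - y - of_real \<epsilon> * cnj h * t)" for x y \<epsilon> h t
      proof -
        have "cnj x - cnj y - of_real \<epsilon> * h * cnj t = cnj (x - y - of_real \<epsilon> * cnj h * t)" by simp
        then show ?thesis by (simp only: complex_mod_cnj)
      qed
      have c1: "cmod (cnj (fst (f (c + of_real \<epsilon> * h))) - cnj (fst (f c)) - of_real \<epsilon> * h * cnj (fst T)) \<le> \<delta> * \<epsilon>"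
        if "norm (quotient f c \<epsilon> h - cscale (cnj h) T) \<le> \<delta>" "0 < \<epsilon>" for c \<epsilon> h T \<delta>
        unfolding conj by (rule component_approximation(1)[OF that])
      have c2: "cmod (cnj (snd (f (c + of_real \<epsilon> * h))) - cnj (snd (f c)) - of_real \<epsilon> * h * cnj (snd T)) \<le> \<delta> * \<epsilon>"
        if "norm (quotient f c \<epsilon> h - cscale (cnj h) T) \<le> \<delta>" "0 < \<epsilon>" for c \<epsilon> h T \<delta>
        unfolding conj by (rule component_approximation(2)[OF that])
      have "(\<lambda>z. cnj (fst (f z))) holomorphic_on ball a \<rho>"
        by (rule holomorphic_if_linear_at_small_scales[OF _
              component_uniform_approximation[OF ap, of _ "\<lambda>z. cnj (fst (f z))" "\<lambda>T. cnj (fst T)",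
                OF _ c1]])
          (intro continuous_intros contb)
      moreover have "(\<lambda>z. cnj (snd (f z))) holomorphic_on ball a \<rho>"
        by (rule holomorphic_if_linear_at_small_scales[OF _
              component_uniform_approximation[OF ap, of _ "\<lambda>z. cnj (snd (f z))" "\<lambda>T. cnj (snd T)",
                OF _ c2]])
          (intro continuous_intros contb)
      ultimately show ?thesis by (simp add: antiholomorphic_map_on_def)
    qed
  qed
qed

section \<open>Equality in the Schwarz lemma and rigidity\<close>

lemma Re_derivative_at_norm_maximum:
  fixes K :: "complex \<Rightarrow> complex"
  assumes K: "(K has_field_derivative k) (at 0)" and max: "\<And>t::real. cmod (K (of_real t)) \<le> cmod (K 0)"
  shows "Re (cnj (K 0) * k) = 0"
proof -
  define u where "u = (\<lambda>t::real. K (of_real t))"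
  have "(u has_vector_derivative k) (at 0)"
    unfolding u_def using has_vector_derivative_real_field[of K k 0 UNIV] K by simp
  then have d: "(u has_derivative (\<lambda>h. h *\<^sub>R k)) (at 0)" by (simp add: has_vector_derivative_def)
  have "((\<lambda>t. u t \<bullet> u t) has_derivative (\<lambda>h. u 0 \<bullet> (h *\<^sub>R k) + (h *\<^sub>R k) \<bullet> u 0)) (at 0)"
    by (rule has_derivative_inner[OF d d])
  moreover have "(\<lambda>h. u 0 \<bullet> (h *\<^sub>R k) + (h *\<^sub>R k) \<bullet> u 0) = (*) (2 * (u 0 \<bullet> k))"
    by (simp add: fun_eq_iff inner_commute)
  ultimately have D: "((\<lambda>t. u t \<bullet> u t) has_real_derivative 2 * (u 0 \<bullet> k)) (at 0)"
    by (simp add: has_field_derivative_def)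
  have le: "u t \<bullet> u t \<le> u 0 \<bullet> u 0" for t
    using max[of t] by (simp add: u_def flip: power2_norm_eq_inner)
  have "2 * (u 0 \<bullet> k) = 0" by (rule DERIV_local_max[OF D zero_less_one]) (simp only: le simp_thms)
  then show ?thesis by (simp add: u_def inner_complex_def)
qed

lemma disc_aut_has_derivative:
  assumes "cmod \<eta> < 1" "cmod z < 1"
  shows "(disc_aut \<eta> has_field_derivative (1 - \<eta> * cnj \<eta>) / (1 - cnj \<eta> * z)\<^sup>2) (at z)"
proof -
  have nz: "1 - cnj \<eta> * z \<noteq> 0" by (rule one_minus_cnj_nonzero[OF assms])
  have "((\<lambda>z. (z - \<eta>) / (1 - cnj \<eta> * z)) has_field_derivative
      (1 * (1 - cnj \<eta> * z) - (z - \<eta>) * (- cnj \<eta>)) / ((1 - cnj \<eta> * z) * (1 - cnj \<eta> * z))) (at z)"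
  proof (rule DERIV_divide)
    show "((\<lambda>z. z - \<eta>) has_field_derivative 1) (at z)" by (auto intro!: derivative_eq_intros)
    show "((\<lambda>z. 1 - cnj \<eta> * z) has_field_derivative - cnj \<eta>) (at z)" by (auto intro!: derivative_eq_intros)
    show "1 - cnj \<eta> * z \<noteq> 0" by (rule nz)
  qed
  moreover have "1 * (1 - cnj \<eta> * z) - (z - \<eta>) * (- cnj \<eta>) = 1 - \<eta> * cnj \<eta>" by (simp add: algebra_simps)
  ultimately show ?thesis unfolding disc_aut_def[abs_def] power2_eq_square by (simp only:)
qed

text \<open>The parameter t is complex, so that complex derivatives can be chained; only real t keep
  the parameter on the circle. The derivative vanishes exactly at royal points.\<close>

lemma magic_rotation_derivative:
  assumes x: "x \<in> G2" and \<omega>: "cmod \<omega> = 1"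
  shows "((\<lambda>t. magic (\<omega> * exp (\<i> * t)) x) has_field_derivative
    \<i> * \<omega> * (4 * snd x - (fst x)\<^sup>2) / (2 - \<omega> * fst x)\<^sup>2) (at 0)"
proof -
  have nz: "2 - (\<omega> * exp (\<i> * 0)) * fst x \<noteq> 0" using magic_denominator[OF x \<omega>] by simp
  have "((\<lambda>t. (2 * (\<omega> * exp (\<i> * t)) * snd x - fst x) / (2 - (\<omega> * exp (\<i> * t)) * fst x)) has_field_derivative
    ((2 * (\<omega> * \<i>) * snd x) * (2 - (\<omega> * exp (\<i> * 0)) * fst x) - (2 * (\<omega> * exp (\<i> * 0)) * snd x - fst x) * (- (\<omega> * \<i> * fst x))) /
    ((2 - (\<omega> * exp (\<i> * 0)) * fst x) * (2 - (\<omega> * exp (\<i> * 0)) * fst x))) (at 0)"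
  proof (rule DERIV_divide)
    show "((\<lambda>t. 2 * (\<omega> * exp (\<i> * t)) * snd x - fst x) has_field_derivative 2 * (\<omega> * \<i>) * snd x) (at 0)"
      by (auto intro!: derivative_eq_intros)
    show "((\<lambda>t. 2 - (\<omega> * exp (\<i> * t)) * fst x) has_field_derivative - (\<omega> * \<i> * fst x)) (at 0)"
      by (auto intro!: derivative_eq_intros)
    show "2 - (\<omega> * exp (\<i> * 0)) * fst x \<noteq> 0" by (rule nz)
  qed
  moreover have "(2 * (\<omega> * \<i>) * snd x) * (2 - \<omega> * fst x) - (2 * \<omega> * snd x - fst x) * (- (\<omega> * \<i> * fst x)) =
    \<i> * \<omega> * (4 * snd x - (fst x)\<^sup>2)"
    by (simp add: power2_eq_square algebra_simps)
  ultimately show ?thesis by (simp add: magic_def power2_eq_square)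
qed

text \<open>At the maximum the derivative along the circle is orthogonal to the value. Dividing by
  the positive number |w|^2 (1 - |\<eta>|^2) removes all conjugates depending on x except for the
  outer real part, so conditions for different \<eta> can be compared by holomorphy.\<close>

lemma magic_stationary:
  assumes x: "x \<in> G2" and \<omega>: "cmod \<omega> = 1" and \<eta>: "cmod \<eta> < 1" and ne: "magic \<omega> x \<noteq> \<eta>"
    and max: "\<And>\<omega>'. cmod \<omega>' = 1 \<Longrightarrow> cmod (disc_aut \<eta> (magic \<omega>' x)) \<le> cmod (disc_aut \<eta> (magic \<omega> x))"
  shows "Re (\<i> * \<omega> * (4 * snd x - (fst x)\<^sup>2) / (2 - \<omega> * fst x)\<^sup>2 /
    ((magic \<omega> x - \<eta>) * (1 - cnj \<eta> * magic \<omega> x))) = 0"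
proof -
  define Q where "Q = \<i> * \<omega> * (4 * snd x - (fst x)\<^sup>2) / (2 - \<omega> * fst x)\<^sup>2"
  define \<Phi> where "\<Phi> = magic \<omega> x"
  define E where "E = 1 - cnj \<eta> * \<Phi>"
  have \<Phi>1: "cmod \<Phi> < 1" unfolding \<Phi>_def by (rule magic_less_1[OF x \<omega>])
  have E: "E \<noteq> 0" unfolding E_def by (rule one_minus_cnj_nonzero[OF \<eta> \<Phi>1])
  have nz: "\<Phi> - \<eta> \<noteq> 0" using ne by (simp add: \<Phi>_def)
  define w where "w = disc_aut \<eta> \<Phi>"
  have w: "w = (\<Phi> - \<eta>) / E" by (simp add: w_def disc_aut_def E_def)
  define K where "K = (\<lambda>t. disc_aut \<eta> (magic (\<omega> * exp (\<i> * t)) x))"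
  have K0: "K 0 = w" by (simp add: K_def w_def \<Phi>_def)
  have "(K has_field_derivative ((1 - \<eta> * cnj \<eta>) / E\<^sup>2) * Q) (at 0)"
    unfolding K_def Q_def
  proof (rule DERIV_chain2[OF _ magic_rotation_derivative[OF x \<omega>]])
    show "(disc_aut \<eta> has_field_derivative (1 - \<eta> * cnj \<eta>) / E\<^sup>2) (at (magic (\<omega> * exp (\<i> * 0)) x))"
      using disc_aut_has_derivative[OF \<eta> \<Phi>1] by (simp add: E_def \<Phi>_def)
  qed
  moreover have "cmod (K (of_real t)) \<le> cmod (K 0)" for t
    unfolding K0 unfolding K_def w_def \<Phi>_def using \<omega> by (intro max) (simp add: norm_mult)
  ultimately have "Re (cnj w * (((1 - \<eta> * cnj \<eta>) / E\<^sup>2) * Q)) = 0"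
    using Re_derivative_at_norm_maximum[of K] K0 by metis
  moreover have "cnj w * (((1 - \<eta> * cnj \<eta>) / E\<^sup>2) * Q) =
    of_real ((cmod w)\<^sup>2 * (1 - (cmod \<eta>)\<^sup>2)) * (Q / ((\<Phi> - \<eta>) * E))"
  proof -
    have "(1 - \<eta> * cnj \<eta>) = of_real (1 - (cmod \<eta>)\<^sup>2)" unfolding of_real_diff of_real_cmod_power2 by simp
    moreover have "cnj w = of_real ((cmod w)\<^sup>2) / w" using nz E unfolding of_real_cmod_power2 by (simp add: w)
    moreover have "1 / w / E\<^sup>2 = 1 / ((\<Phi> - \<eta>) * E)" using nz E by (simp add: w power2_eq_square)
    ultimately have e: "1 - \<eta> * cnj \<eta> = of_real (1 - (cmod \<eta>)\<^sup>2)" "cnj w = of_real ((cmod w)\<^sup>2) / w"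
      "1 / w / E\<^sup>2 = 1 / ((\<Phi> - \<eta>) * E)" by blast+
    have "cnj w * (((1 - \<eta> * cnj \<eta>) / E\<^sup>2) * Q) = (1 - \<eta> * cnj \<eta>) * Q * (cnj w / E\<^sup>2)"
      by (simp only: divide_inverse mult_ac)
    also have "cnj w / E\<^sup>2 = of_real ((cmod w)\<^sup>2) * (1 / w / E\<^sup>2)"
      by (subst e(2)) (simp only: divide_inverse mult_ac mult_1)
    finally have "cnj w * (((1 - \<eta> * cnj \<eta>) / E\<^sup>2) * Q) =
        of_real (1 - (cmod \<eta>)\<^sup>2) * Q * (of_real ((cmod w)\<^sup>2) * (1 / ((\<Phi> - \<eta>) * E)))"
      unfolding e(1,3) .
    then show ?thesis by (simp only: of_real_mult divide_inverse mult_ac mult_1)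
  qed
  ultimately have "(cmod w)\<^sup>2 * (1 - (cmod \<eta>)\<^sup>2) * Re (Q / ((\<Phi> - \<eta>) * E)) = 0"
    by (simp only: Re_Im_complex_of_real_mult)
  moreover have "(cmod w)\<^sup>2 * (1 - (cmod \<eta>)\<^sup>2) \<noteq> 0" using nz E \<eta> by (simp add: w abs_square_eq_1)
  ultimately show ?thesis unfolding Q_def[symmetric] \<Phi>_def[symmetric] E_def[symmetric] by simp
qed

lemma real_valued_holomorphic_constant:
  assumes h: "h holomorphic_on S" and S: "open S" "connected S" "S \<noteq> {}" and re: "\<And>z. z \<in> S \<Longrightarrow> Im (h z) = 0"
  shows "h constant_on S"
proof (rule ccontr)
  assume "\<not> h constant_on S"
  then have op: "open (h ` S)" using open_mapping_thm[OF h S(1,2) S(1) order_refl] by blast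
  obtain z where z: "z \<in> S" using S(3) by blast
  then obtain e where e: "e > 0" "ball (h z) e \<subseteq> h ` S" using op open_contains_ball by blast
  have "h z + \<i> * of_real (e / 2) \<in> ball (h z) e" using e(1) by (simp add: dist_norm norm_mult)
  then obtain y where y: "y \<in> S" "h z + \<i> * of_real (e / 2) = h y" using e(2) by blast
  have "Im (h z + \<i> * of_real (e / 2)) = e / 2" using re[OF z] by simp
  then have "e / 2 = Im (h y)" using y(2) by metis
  then show False using re[OF y(1)] e(1) by simp
qed

text \<open>The quadratic has the roots \<eta> and 1 / \<open>cnj \<eta>\<close>. Comparing
  coefficients gives (\<kappa> - 1) (\<kappa> |\<eta>1|^2 - 1) = 0, and the second factor cannot
  vanish since it would put |\<eta>1| |\<eta>2| = 1.\<close>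

lemma proportional_disc_quadratics:
  fixes \<kappa> :: real
  assumes \<eta>: "cmod \<eta>1 < 1" "cmod \<eta>2 < 1" and Z: "infinite Z"
    and eq: "\<And>z. z \<in> Z \<Longrightarrow> (z - \<eta>2) * (1 - cnj \<eta>2 * z) = of_real \<kappa> * ((z - \<eta>1) * (1 - cnj \<eta>1 * z))"
  shows "\<eta>1 = \<eta>2"
proof -
  let ?q = "[: of_real \<kappa> * \<eta>1 - \<eta>2, (1 + \<eta>2 * cnj \<eta>2) - of_real \<kappa> * (1 + \<eta>1 * cnj \<eta>1), of_real \<kappa> * cnj \<eta>1 - cnj \<eta>2 :]"
  have "poly ?q z = (z - \<eta>2) * (1 - cnj \<eta>2 * z) - of_real \<kappa> * ((z - \<eta>1) * (1 - cnj \<eta>1 * z))" for z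
    by (simp add: algebra_simps)
  then have "Z \<subseteq> {z. poly ?q z = 0}" using eq by auto
  then have "?q = 0" using Z poly_roots_finite finite_subset by blast
  then have 1: "\<eta>2 = of_real \<kappa> * \<eta>1" and "1 + \<eta>2 * cnj \<eta>2 = of_real \<kappa> * (1 + \<eta>1 * cnj \<eta>1)" by simp_all
  then have "complex_of_real (1 + (cmod \<eta>2)\<^sup>2) = of_real (\<kappa> * (1 + (cmod \<eta>1)\<^sup>2))"
    unfolding of_real_add of_real_mult of_real_cmod_power2 by simp
  then have 2: "1 + (cmod \<eta>2)\<^sup>2 = \<kappa> * (1 + (cmod \<eta>1)\<^sup>2)" by (rule of_real_eq_iff[THEN iffD1])
  have n: "(cmod \<eta>2)\<^sup>2 = \<kappa>\<^sup>2 * (cmod \<eta>1)\<^sup>2" by (simp add: 1 norm_mult power_mult_distrib)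
  have "(\<kappa> - 1) * (\<kappa> * (cmod \<eta>1)\<^sup>2 - 1) = 0"
    using 2 unfolding n by (simp add: power2_eq_square algebra_simps)
  then consider "\<kappa> = 1" | "\<kappa> * (cmod \<eta>1)\<^sup>2 = 1" by auto
  then show ?thesis
  proof cases
    case 1
    then show ?thesis using \<open>\<eta>2 = of_real \<kappa> * \<eta>1\<close> by simp
  next
    case 2
    have "(cmod \<eta>2)\<^sup>2 * (cmod \<eta>1)\<^sup>2 = (\<kappa> * (cmod \<eta>1)\<^sup>2)\<^sup>2" unfolding n by (simp add: power2_eq_square)
    then have "(cmod \<eta>2 * cmod \<eta>1)\<^sup>2 = 1" by (simp add: 2 power_mult_distrib)
    moreover have "cmod \<eta>2 * cmod \<eta>1 < 1" using \<eta> mult_strict_mono'[of "cmod \<eta>2" 1 "cmod \<eta>1" 1] by simp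
    ultimately show ?thesis by (simp add: power2_eq_1_iff) (smt (verit) mult_nonneg_nonneg norm_ge_zero)
  qed
qed

text \<open>Both quotients are purely imaginary, so their ratio, in which Q cancels, is real. This
  ratio is holomorphic in z and hence constant, which makes the two quadratics in \<Phi> z
  proportional.\<close>

lemma stationary_parameter_unique:
  assumes S: "open S" "connected S" "S \<noteq> {}" and \<Phi>: "\<Phi> holomorphic_on S" "inj_on \<Phi> S" "\<And>z. z \<in> S \<Longrightarrow> cmod (\<Phi> z) < 1"
    and Q: "\<And>z. z \<in> S \<Longrightarrow> Q z \<noteq> 0"
    and \<eta>: "cmod \<eta>1 < 1" "cmod \<eta>2 < 1" "\<And>z. z \<in> S \<Longrightarrow> \<Phi> z \<noteq> \<eta>1" "\<And>z. z \<in> S \<Longrightarrow> \<Phi> z \<noteq> \<eta>2"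
    and re: "\<And>z. z \<in> S \<Longrightarrow> Re (Q z / ((\<Phi> z - \<eta>1) * (1 - cnj \<eta>1 * \<Phi> z))) = 0"
      "\<And>z. z \<in> S \<Longrightarrow> Re (Q z / ((\<Phi> z - \<eta>2) * (1 - cnj \<eta>2 * \<Phi> z))) = 0"
  shows "\<eta>1 = \<eta>2"
proof -
  define A where "A = (\<lambda>\<eta> z. (\<Phi> z - \<eta>) * (1 - cnj \<eta> * \<Phi> z))"
  have A: "A \<eta>1 z \<noteq> 0" "A \<eta>2 z \<noteq> 0" if "z \<in> S" for z
    using \<eta>(3,4)[OF that] one_minus_cnj_nonzero[OF \<eta>(1) \<Phi>(3)[OF that]] one_minus_cnj_nonzero[OF \<eta>(2) \<Phi>(3)[OF that]]
    by (simp_all add: A_def)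
  define h where "h = (\<lambda>z. A \<eta>2 z / A \<eta>1 z)"
  have "h holomorphic_on S"
    unfolding h_def using A(1) unfolding A_def by (intro holomorphic_intros \<Phi>(1)) blast
  moreover have "Im (h z) = 0" if z: "z \<in> S" for z
  proof -
    have im: "Re (u / v) = 0 \<Longrightarrow> Re (u / w) = 0 \<Longrightarrow> u \<noteq> 0 \<Longrightarrow> v \<noteq> 0 \<Longrightarrow> w \<noteq> 0 \<Longrightarrow> Im (w / v) = 0" for u v w :: complex
    proof -
      assume h: "Re (u / v) = 0" "Re (u / w) = 0" "u \<noteq> 0" "v \<noteq> 0" "w \<noteq> 0"
      have "w / v = (u / v) / (u / w)" using h by simp
      moreover have "u / v = \<i> * of_real (Im (u / v))" "u / w = \<i> * of_real (Im (u / w))"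
        using h(1,2) by (simp_all only: complex_eq_iff) simp_all
      ultimately have "w / v = of_real (Im (u / v) / Im (u / w))" by (metis mult_divide_mult_cancel_left complex_i_not_zero of_real_divide)
      then show "Im (w / v) = 0" by (metis Im_complex_of_real)
    qed
    have "Re (Q z / A \<eta>1 z) = 0" "Re (Q z / A \<eta>2 z) = 0" using re[OF z] unfolding A_def by blast+
    then show ?thesis unfolding h_def by (rule im[OF _ _ Q[OF z] A[OF z]])
  qed
  ultimately have "h constant_on S" using real_valued_holomorphic_constant S by blast
  then obtain c where c: "\<And>z. z \<in> S \<Longrightarrow> h z = c" by (auto simp: constant_on_def)
  obtain z0 where z0: "z0 \<in> S" using S(3) by blast
  have "c = of_real (Re c)"
    using c[OF z0] \<open>\<And>z. z \<in> S \<Longrightarrow> Im (h z) = 0\<close>[OF z0] by (simp add: complex_eq_iff)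
  then have "A \<eta>2 z = of_real (Re c) * A \<eta>1 z" if "z \<in> S" for z
    using c[OF that] A[OF that] by (simp add: h_def field_simps)
  then have eq: "(w - \<eta>2) * (1 - cnj \<eta>2 * w) = of_real (Re c) * ((w - \<eta>1) * (1 - cnj \<eta>1 * w))" if "w \<in> \<Phi> ` S" for w
    using that by (auto simp: A_def)
  have "infinite S" using S(1,3) finite_imp_not_open by blast
  then have "infinite (\<Phi> ` S)" using \<Phi>(2) finite_imageD by blast
  then show ?thesis by (rule proportional_disc_quadratics[OF \<eta>(1,2) _ eq])
qed

text \<open>The contraction towards a maps a pseudohyperbolic disc of radius \<rho> around a into
  the one of the same radius around g a. After recentring both and dividing by \<rho> this is a
  self-map \<open>H\<close> of the unit disc with |H' 0| = 1, and the Schwarz lemma makes it a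
  rotation.\<close>

lemma disc_automorphism_if_equality:
  assumes a: "cmod a < 1" and r: "r > 0" "ball a r \<subseteq> unit_disc"
    and g: "g holomorphic_on ball a r" "\<And>z. z \<in> ball a r \<Longrightarrow> cmod (g z) < 1"
    and contr: "\<And>z. z \<in> ball a r \<Longrightarrow> cmod (disc_aut (g a) (g z)) \<le> cmod (disc_aut a z)"
    and der: "(g has_field_derivative g') (at a)" "cmod g' * (1 - (cmod a)\<^sup>2) = 1 - (cmod (g a))\<^sup>2"
  obtains c s where "cmod c = 1" "s > 0" "s \<le> r" "\<And>z. z \<in> ball a s \<Longrightarrow> g z = disc_aut (- g a) (c * disc_aut a z)"
proof -
  have ma: "cmod (- a) < 1" using a by simp
  have ga: "cmod (g a) < 1" using g(2) r(1) by simp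
  have d0: "(disc_aut (- a) has_field_derivative (1 - a * cnj a)) (at 0)"
    using disc_aut_has_derivative[OF ma, of 0] by simp
  have "isCont (disc_aut (- a)) 0" by (rule DERIV_isCont[OF d0])
  then obtain \<rho>' where \<rho>': "\<rho>' > 0" "\<And>w. dist w 0 < \<rho>' \<Longrightarrow> dist (disc_aut (- a) w) (disc_aut (- a) 0) < r"
    using r(1) unfolding continuous_at_eps_delta by blast
  define \<rho> where "\<rho> = min \<rho>' (1 / 2)"
  have \<rho>: "0 < \<rho>" "\<rho> < 1" "\<And>w. cmod w < \<rho> \<Longrightarrow> disc_aut (- a) w \<in> ball a r" using \<rho>' by (simp_all add: \<rho>_def dist_commute)
  define H where "H = (\<lambda>\<zeta>. disc_aut (g a) (g (disc_aut (- a) (of_real \<rho> * \<zeta>))) / of_real \<rho>)"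
  have sc: "cmod (of_real \<rho> * \<zeta>) < \<rho>" "cmod (of_real \<rho> * \<zeta>) < 1" if "cmod \<zeta> < 1" for \<zeta>
  proof -
    have "\<rho> * cmod \<zeta> < \<rho> * 1" using that \<rho> by (intro mult_strict_left_mono) auto
    moreover have "cmod (of_real \<rho> * \<zeta>) = \<rho> * cmod \<zeta>" using \<rho>(1) by (simp add: norm_mult)
    ultimately show "cmod (of_real \<rho> * \<zeta>) < \<rho>" "cmod (of_real \<rho> * \<zeta>) < 1" using \<rho>(2) by linarith+
  qed
  have hol: "H holomorphic_on unit_disc"
  proof -
    have 1: "(\<lambda>\<zeta>. of_real \<rho> * \<zeta>) holomorphic_on unit_disc" by (intro holomorphic_intros)
    have 2: "(disc_aut (- a) \<circ> (\<lambda>\<zeta>. of_real \<rho> * \<zeta>)) holomorphic_on unit_disc"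
      by (rule holomorphic_on_compose_gen[OF 1 disc_aut_holomorphic[OF ma]]) (use sc in auto)
    have 3: "(g \<circ> (disc_aut (- a) \<circ> (\<lambda>\<zeta>. of_real \<rho> * \<zeta>))) holomorphic_on unit_disc"
      by (rule holomorphic_on_compose_gen[OF 2 g(1)]) (use sc \<rho>(3) in \<open>simp add: image_subset_iff\<close>)
    have 4: "(disc_aut (g a) \<circ> (g \<circ> (disc_aut (- a) \<circ> (\<lambda>\<zeta>. of_real \<rho> * \<zeta>)))) holomorphic_on unit_disc"
      by (rule holomorphic_on_compose_gen[OF 3 disc_aut_holomorphic[OF ga]])
        (use sc \<rho>(3) g(2) in \<open>simp add: image_subset_iff\<close>)
    have "H = (\<lambda>\<zeta>. (disc_aut (g a) \<circ> (g \<circ> (disc_aut (- a) \<circ> (\<lambda>\<zeta>. of_real \<rho> * \<zeta>)))) \<zeta> / of_real \<rho>)"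
      by (simp add: H_def fun_eq_iff)
    moreover have "(\<lambda>\<zeta>. (disc_aut (g a) \<circ> (g \<circ> (disc_aut (- a) \<circ> (\<lambda>\<zeta>. of_real \<rho> * \<zeta>)))) \<zeta> / of_real \<rho>) holomorphic_on unit_disc"
      by (rule holomorphic_on_divide[OF 4 holomorphic_on_const]) (use \<rho>(1) in simp)
    ultimately show ?thesis by (simp only:)
  qed
  have H0: "H 0 = 0" by (simp add: H_def)
  have Hle: "cmod (H \<zeta>) < 1" if "cmod \<zeta> < 1" for \<zeta>
  proof -
    have "cmod (disc_aut (g a) (g (disc_aut (- a) (of_real \<rho> * \<zeta>)))) \<le> cmod (disc_aut a (disc_aut (- a) (of_real \<rho> * \<zeta>)))"
      by (rule contr[OF \<rho>(3)[OF sc(1)[OF that]]])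
    also have "\<dots> = cmod (of_real \<rho> * \<zeta>)" by (simp only: disc_aut_inverse'[OF a sc(2)[OF that]])
    also have "\<dots> < \<rho>" by (rule sc(1)[OF that])
    finally show ?thesis using \<rho>(1) by (simp add: H_def norm_divide)
  qed
  have "(H has_field_derivative ((1 - g a * cnj (g a)) / (1 - cnj (g a) * g a)\<^sup>2 * (g' * ((1 - a * cnj a) * of_real \<rho>))) / of_real \<rho>) (at 0)"
    unfolding H_def
  proof (rule DERIV_cdivide, rule DERIV_chain2[of "disc_aut (g a)"])
    show "(disc_aut (g a) has_field_derivative (1 - g a * cnj (g a)) / (1 - cnj (g a) * g a)\<^sup>2) (at (g (disc_aut (- a) (of_real \<rho> * 0))))"
      using disc_aut_has_derivative[OF ga ga] by simp
    show "((\<lambda>\<zeta>. g (disc_aut (- a) (of_real \<rho> * \<zeta>))) has_field_derivative g' * ((1 - a * cnj a) * of_real \<rho>)) (at 0)"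
    proof (rule DERIV_chain2[of g])
      show "(g has_field_derivative g') (at (disc_aut (- a) (of_real \<rho> * 0)))" using der(1) by simp
      show "((\<lambda>\<zeta>. disc_aut (- a) (of_real \<rho> * \<zeta>)) has_field_derivative (1 - a * cnj a) * of_real \<rho>) (at 0)"
        by (rule DERIV_chain2[of "disc_aut (- a)"]) (use d0 in \<open>auto intro!: derivative_eq_intros\<close>)
    qed
  qed
  then have "deriv H 0 = ((1 - g a * cnj (g a)) / (1 - cnj (g a) * g a)\<^sup>2 * (g' * ((1 - a * cnj a) * of_real \<rho>))) / of_real \<rho>"
    by (rule DERIV_imp_deriv)
  also have "\<dots> = g' * of_real (1 - (cmod a)\<^sup>2) / of_real (1 - (cmod (g a))\<^sup>2)"
  proof -
    have "1 - cnj (g a) * g a \<noteq> 0" by (rule one_minus_cnj_nonzero[OF ga ga])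
    then show ?thesis unfolding of_real_diff of_real_cmod_power2 using \<rho>(1)
      by (simp add: power2_eq_square mult.commute[of "cnj (g a)"])
  qed
  finally have "cmod (deriv H 0) = cmod g' * \<bar>1 - (cmod a)\<^sup>2\<bar> / \<bar>1 - (cmod (g a))\<^sup>2\<bar>"
    by (simp only: norm_divide norm_mult norm_of_real)
  moreover have "(cmod a)\<^sup>2 < 1" "(cmod (g a))\<^sup>2 < 1" using a ga by (simp_all add: abs_square_less_1)
  ultimately have "cmod (deriv H 0) = 1" using der(2) by simp
  then obtain c where c: "\<And>\<zeta>. cmod \<zeta> < 1 \<Longrightarrow> H \<zeta> = c * \<zeta>" "cmod c = 1"
    using Schwarz_Lemma(3)[OF hol H0 Hle, of 0] by auto
  have "isCont (disc_aut a) a" by (rule DERIV_isCont[OF disc_aut_has_derivative[OF a a]])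
  then obtain s' where s': "s' > 0" "\<And>z. dist z a < s' \<Longrightarrow> dist (disc_aut a z) (disc_aut a a) < \<rho>"
    using \<rho>(1) unfolding continuous_at_eps_delta by blast
  define s where "s = min r s'"
  show ?thesis
  proof (rule that[OF c(2), of s])
    show "s > 0" "s \<le> r" using r(1) s'(1) by (simp_all add: s_def)
    fix z assume z: "z \<in> ball a s"
    then have zr: "z \<in> ball a r" and w: "cmod (disc_aut a z) < \<rho>" using s'(2)[of z] by (simp_all add: s_def dist_commute)
    have z1: "cmod z < 1" using zr r(2) by auto
    define \<zeta> where "\<zeta> = disc_aut a z / of_real \<rho>"
    have \<zeta>: "cmod \<zeta> < 1" "of_real \<rho> * \<zeta> = disc_aut a z" using w \<rho>(1) by (simp_all add: \<zeta>_def norm_divide)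
    have "disc_aut (g a) (g z) / of_real \<rho> = c * \<zeta>"
      using c(1)[OF \<zeta>(1)] unfolding H_def \<zeta>(2) disc_aut_inverse[OF a z1] .
    then have "disc_aut (g a) (g z) = c * disc_aut a z" using \<rho>(1) by (simp add: \<zeta>_def)
    then show "g z = disc_aut (- g a) (c * disc_aut a z)"
      using disc_aut_inverse[OF ga g(2)[OF zr]] by simp
  qed
qed

section \<open>Analytic continuation across the royal variety\<close>

lemma difference_quotient_tendsto:
  fixes g :: "complex \<Rightarrow> complex"
  assumes g: "(g has_field_derivative C) (at a)" and \<epsilon>: "\<epsilon> \<longlonglongrightarrow> 0" "\<And>n. \<epsilon> n > 0"
  shows "(\<lambda>n. (g (a + of_real (\<epsilon> n)) - g a) /\<^sub>R \<epsilon> n) \<longlonglongrightarrow> C"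
proof -
  have "(\<lambda>n. complex_of_real (\<epsilon> n)) \<longlonglongrightarrow> 0" using \<epsilon>(1) by (auto intro!: tendsto_eq_intros)
  then have 1: "filterlim (\<lambda>n. complex_of_real (\<epsilon> n)) (at 0) sequentially"
    by (intro filterlim_atI) (use \<epsilon>(2) in \<open>auto simp: less_le\<close>)
  have 2: "((\<lambda>z. (g (a + z) - g a) / z) \<longlongrightarrow> C) (at 0)" using g by (simp add: DERIV_def)
  have "(\<lambda>n. (g (a + of_real (\<epsilon> n)) - g a) / of_real (\<epsilon> n)) \<longlonglongrightarrow> C"
    by (rule filterlim_compose[OF 2 1])
  then show ?thesis by (simp add: scaleR_conv_of_real divide_inverse mult.commute)
qed

lemma magic_holomorphic:
  assumes f: "holomorphic_map_on f S" "f ` S \<subseteq> G2" and \<omega>: "cmod \<omega> = 1"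
  shows "(\<lambda>z. magic \<omega> (f z)) holomorphic_on S"
proof -
  have "2 - \<omega> * fst (f z) \<noteq> 0" if "z \<in> S" for z using magic_denominator[OF _ \<omega>] f(2) that by blast
  then show ?thesis
    using f(1) unfolding magic_def holomorphic_map_on_def by (elim conjE, intro holomorphic_intros) blast+
qed

lemma magic_royal:
  assumes "x \<in> G2" "(fst x)\<^sup>2 = 4 * snd x" "cmod \<omega> = 1"
  shows "magic \<omega> x = - fst x / 2"
proof -
  have nz: "2 - \<omega> * fst x \<noteq> 0" by (rule magic_denominator[OF assms(1,3)])
  have "snd x = (fst x)\<^sup>2 / 4" using assms(2) by simp
  then have "2 * \<omega> * snd x - fst x = (- fst x / 2) * (2 - \<omega> * fst x)" by (simp add: power2_eq_square field_simps)
  then show ?thesis using nz unfolding magic_def by (metis nonzero_mult_div_cancel_right)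
qed

lemma kobayashi_isometry_inj:
  assumes f: "kobayashi_isometry_on f U" and ab: "a \<in> U" "b \<in> U" "f a = f b"
  shows "a = b"
proof -
  note fD = kobayashi_isometry_onD[OF f]
  have "poincare_dist a b \<le> poincare_dist a a" using fD(4)[OF ab(1,2)] fD(4)[OF ab(1,1)] ab(3) by simp
  then have "cmod (disc_aut b a) \<le> cmod (disc_aut a a)"
    by (subst (asm) poincare_dist_le_iff) (simp_all add: fD ab)
  then have "disc_aut b a = 0" by simp
  then show ?thesis using one_minus_cnj_nonzero[OF fD(2)[OF ab(2)] fD(2)[OF ab(1)]] by (simp add: disc_aut_def)
qed

lemma holomorphic_and_antiholomorphic_constant:
  assumes g: "g holomorphic_on S" "(\<lambda>z. cnj (g z)) holomorphic_on S" and S: "open S" "connected S" "S \<noteq> {}"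
  shows "g constant_on S"
proof -
  have "(\<lambda>z. g z + cnj (g z)) constant_on S"
    by (rule real_valued_holomorphic_constant[OF _ S]) (auto intro!: holomorphic_intros g)
  moreover have "(\<lambda>z. \<i> * (g z - cnj (g z))) constant_on S"
    by (rule real_valued_holomorphic_constant[OF _ S]) (auto intro!: holomorphic_intros g)
  ultimately obtain c d where c: "\<And>z. z \<in> S \<Longrightarrow> g z + cnj (g z) = c" and d: "\<And>z. z \<in> S \<Longrightarrow> \<i> * (g z - cnj (g z)) = d"
    by (auto simp: constant_on_def)
  have "g z = (c - \<i> * d) / 2" if "z \<in> S" for z
    unfolding c[OF that, symmetric] d[OF that, symmetric] by (simp add: algebra_simps)
  then show ?thesis unfolding constant_on_def by blast
qed

lemma kobayashi_isometry_not_both: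
  assumes f: "kobayashi_isometry_on f U" and S: "open S" "S \<noteq> {}" "S \<subseteq> U"
    and h: "holomorphic_map_on f S" "antiholomorphic_map_on f S"
  shows False
proof -
  obtain z e where z: "z \<in> S" and e: "e > 0" "ball z e \<subseteq> S" using S open_contains_ball by blast
  have "(\<lambda>z. fst (f z)) constant_on ball z e"
    using h e unfolding holomorphic_map_on_def antiholomorphic_map_on_def
    by (intro holomorphic_and_antiholomorphic_constant) (auto elim: holomorphic_on_subset)
  moreover have "(\<lambda>z. snd (f z)) constant_on ball z e"
    using h e unfolding holomorphic_map_on_def antiholomorphic_map_on_def
    by (intro holomorphic_and_antiholomorphic_constant) (auto elim: holomorphic_on_subset)
  moreover have w: "z + of_real (e / 2) \<in> ball z e" "z \<in> ball z e" using e(1) by (auto simp: dist_norm)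
  ultimately have "f (z + of_real (e / 2)) = f z" by (metis constant_on_def prod.collapse)
  then have "z + of_real (e / 2) = z" using kobayashi_isometry_inj[OF f] w e S by blast
  then show False using e(1) by simp
qed

text \<open>With constant base points the blow-up recovers the derivative T of f at a. The parameter
  that norms T gives equality in the infinitesimal Schwarz-Pick inequality for the corresponding
  magic function.\<close>

lemma magic_automorphism_at_center:
  assumes f: "kobayashi_isometry_on f U" and a: "a \<in> U" and fa: "f a = (0, p)" and p0: "p \<noteq> 0"
    and r: "r > 0" "ball a r \<subseteq> U" "holomorphic_map_on f (ball a r)"
  obtains \<omega> c s where "cmod \<omega> = 1" "cmod c = 1" "s > 0" "s \<le> r"
    "\<And>z. z \<in> ball a s \<Longrightarrow> magic \<omega> (f z) = disc_aut (- magic \<omega> (f a)) (c * disc_aut a z)"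
proof -
  note fD = kobayashi_isometry_onD[OF f]
  define \<epsilon> where "\<epsilon> = (\<lambda>n. inverse (real (Suc n)))"
  have \<epsilon>: "\<epsilon> \<longlonglongrightarrow> 0" "\<And>n. \<epsilon> n > 0" unfolding \<epsilon>_def using LIMSEQ_inverse_real_of_nat by simp_all
  obtain k T \<omega> where k: "strict_mono k" and \<omega>: "cmod \<omega> = 1" "cmod (mlin p \<omega> T) * (1 - (cmod a)\<^sup>2) = 1 - (cmod p)\<^sup>2"
    and lim: "(\<forall>h. (\<lambda>n. quotient f a (\<epsilon> (k n)) h) \<longlonglongrightarrow> cscale h T) \<or>
     (\<forall>h. (\<lambda>n. quotient f a (\<epsilon> (k n)) h) \<longlonglongrightarrow> cscale (cnj h) T)"
    using blow_up_at_center[OF f a fa p0 tendsto_const \<epsilon>] by blast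
  have \<epsilon>k: "(\<lambda>n. \<epsilon> (k n)) \<longlonglongrightarrow> 0" "\<And>n. \<epsilon> (k n) > 0"
    using LIMSEQ_subseq_LIMSEQ[OF \<epsilon>(1) k] \<epsilon>(2) by (simp_all add: comp_def)
  have "(\<lambda>n. quotient f a (\<epsilon> (k n)) 1) \<longlonglongrightarrow> cscale 1 T" using lim by (elim disjE) (metis complex_cnj_one)+
  then have T: "(\<lambda>n. (f (a + of_real (\<epsilon> (k n))) - f a) /\<^sub>R \<epsilon> (k n)) \<longlonglongrightarrow> T" by (simp add: quotient_def cscale_def)
  define g where "g = (\<lambda>z. magic \<omega> (f z))"
  have hol: "g holomorphic_on ball a r"
    unfolding g_def by (rule magic_holomorphic[OF r(3) _ \<omega>(1)]) (use r(2) fD(3) in blast)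
  have dg: "(g has_field_derivative deriv g a) (at a)"
    by (rule holomorphic_derivI[OF hol]) (use r(1) in auto)
  have isc: "isCont f a" using kobayashi_isometry_continuous[OF f] a fD(1) by (simp add: continuous_on_eq_continuous_at)
  have X: "(\<lambda>n. f (a + of_real (\<epsilon> (k n)))) \<longlonglongrightarrow> (0, p)"
  proof -
    have "(\<lambda>n. a + of_real (\<epsilon> (k n))) \<longlonglongrightarrow> a" using \<epsilon>k(1) by (auto intro!: tendsto_eq_intros)
    then show ?thesis using isCont_tendsto_compose[OF isc] fa by metis
  qed
  have "(\<lambda>n. (g (a + of_real (\<epsilon> (k n))) - g a) /\<^sub>R \<epsilon> (k n)) \<longlonglongrightarrow> \<omega> * mlin p \<omega> T"
    unfolding g_def by (rule magic_difference_quotient[OF _ X T \<omega>(1)]) (simp add: fa)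
  then have "deriv g a = \<omega> * mlin p \<omega> T"
    using LIMSEQ_unique[OF difference_quotient_tendsto[OF dg \<epsilon>k]] by blast
  moreover have ga: "g a = \<omega> * p" by (simp add: g_def magic_def fa)
  ultimately have d: "cmod (deriv g a) * (1 - (cmod a)\<^sup>2) = 1 - (cmod (g a))\<^sup>2"
    using \<omega> by (simp add: norm_mult)
  have sub: "z \<in> U" if "z \<in> ball a r" for z using that r(2) by blast
  have 1: "ball a r \<subseteq> unit_disc" using sub fD(2) by auto
  have 2: "cmod (g z) < 1" if "z \<in> ball a r" for z
    unfolding g_def by (rule magic_less_1[OF fD(3)[OF sub[OF that]] \<omega>(1)])
  have 3: "cmod (disc_aut (g a) (g z)) \<le> cmod (disc_aut a z)" if "z \<in> ball a r" for z
    unfolding g_def by (rule kobayashi_isometry_contracts_magic[OF f sub[OF that] a \<omega>(1)])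
  obtain c s where cs: "cmod c = 1" "s > 0" "s \<le> r" "\<And>z. z \<in> ball a s \<Longrightarrow> g z = disc_aut (- g a) (c * disc_aut a z)"
    by (rule disc_automorphism_if_equality[OF fD(2)[OF a] r(1) 1 hol 2 3 dg d]) (assumption, assumption, rule that)
  show ?thesis by (rule that[OF \<omega>(1) cs[unfolded g_def]])
qed

text \<open>Off the royal variety f would be antiholomorphic near e, while holomorphic on the part
  of C there; an injective map cannot be both on a nonempty open set.\<close>

lemma frontier_point_royal:
  assumes f: "kobayashi_isometry_on f U" and C: "open C" "C \<subseteq> U" "holomorphic_map_on f C"
    and e: "e \<in> U" "e \<in> frontier C"
    and sing: "\<And>s. s > 0 \<Longrightarrow> ball e s \<subseteq> U \<Longrightarrow> \<not> holomorphic_map_on f (ball e s)"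
  shows "(fst (f e))\<^sup>2 = 4 * snd (f e)"
proof (rule ccontr)
  assume "(fst (f e))\<^sup>2 \<noteq> 4 * snd (f e)"
  then obtain s where s: "s > 0" "ball e s \<subseteq> U" "holomorphic_map_on f (ball e s) \<or> antiholomorphic_map_on f (ball e s)"
    by (rule locally_holomorphic_or_antiholomorphic[OF f e(1)])
  then have ah: "antiholomorphic_map_on f (ball e s)" using sing by blast
  have "e \<in> closure C" using e(2) by (simp add: frontier_def)
  then have "C \<inter> ball e s \<noteq> {}" using s(1) closure_iff_nhds_not_empty[of e C] by (metis Int_commute centre_in_ball open_ball order_refl)
  moreover have "holomorphic_map_on f (C \<inter> ball e s)"
    using C(3) unfolding holomorphic_map_on_def by (auto elim: holomorphic_on_subset)
  moreover have "antiholomorphic_map_on f (C \<inter> ball e s)"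
    using ah unfolding antiholomorphic_map_on_def by (auto elim: holomorphic_on_subset)
  ultimately show False using kobayashi_isometry_not_both[OF f, of "C \<inter> ball e s"] C(1,2) by blast
qed

text \<open>At a royal point every parameter gives the same value \<eta>. Hence all \<omega>'
  compete for the same bound |\<open>disc_aut e z\<close>|, which \<omega> attains, and \<omega> is
  a maximum on the circle.\<close>

lemma magic_stationary_royal:
  assumes f: "kobayashi_isometry_on f U" and z: "z \<in> U" "(fst (f z))\<^sup>2 \<noteq> 4 * snd (f z)"
    and e: "e \<in> U" "(fst (f e))\<^sup>2 = 4 * snd (f e)" and \<omega>: "cmod \<omega> = 1"
    and eq: "cmod (disc_aut (magic \<omega> (f e)) (magic \<omega> (f z))) = cmod (disc_aut e z)"
  shows "magic \<omega> (f z) \<noteq> magic \<omega> (f e)"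
    and "Re (\<i> * \<omega> * (4 * snd (f z) - (fst (f z))\<^sup>2) / (2 - \<omega> * fst (f z))\<^sup>2 /
      ((magic \<omega> (f z) - magic \<omega> (f e)) * (1 - cnj (magic \<omega> (f e)) * magic \<omega> (f z)))) = 0"
proof -
  note fD = kobayashi_isometry_onD[OF f]
  show ne: "magic \<omega> (f z) \<noteq> magic \<omega> (f e)"
  proof
    assume "magic \<omega> (f z) = magic \<omega> (f e)"
    then have "disc_aut e z = 0" using eq by simp
    then have "z = e" using one_minus_cnj_nonzero[OF fD(2)[OF e(1)] fD(2)[OF z(1)]] by (simp add: disc_aut_def)
    then show False using z(2) e(2) by simp
  qed
  show "Re (\<i> * \<omega> * (4 * snd (f z) - (fst (f z))\<^sup>2) / (2 - \<omega> * fst (f z))\<^sup>2 /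
      ((magic \<omega> (f z) - magic \<omega> (f e)) * (1 - cnj (magic \<omega> (f e)) * magic \<omega> (f z)))) = 0"
  proof (rule magic_stationary[OF fD(3)[OF z(1)] \<omega> magic_less_1[OF fD(3)[OF e(1)] \<omega>] ne])
    fix \<omega>' :: complex assume \<omega>': "cmod \<omega>' = 1"
    have "magic \<omega> (f e) = magic \<omega>' (f e)" using magic_royal[OF fD(3)[OF e(1)] e(2)] \<omega> \<omega>' by simp
    then show "cmod (disc_aut (magic \<omega> (f e)) (magic \<omega>' (f z))) \<le> cmod (disc_aut (magic \<omega> (f e)) (magic \<omega> (f z)))"
      using kobayashi_isometry_contracts_magic[OF f z(1) e(1) \<omega>'] unfolding eq by simp
  qed
qed

lemma cmod_disc_aut_rotate:
  assumes "cmod c = 1"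
  shows "cmod (disc_aut (c * a) (c * z)) = cmod (disc_aut a z)"
proof -
  have "cnj (c * a) * (c * z) = (c * cnj c) * (cnj a * z)" by simp
  also have "\<dots> = cnj a * z" using unit_cnj(1)[OF assms] by simp
  finally have "disc_aut (c * a) (c * z) = c * disc_aut a z"
    unfolding disc_aut_def by (simp add: right_diff_distrib)
  then show ?thesis using assms by (simp add: norm_mult)
qed

text \<open>On the component C where f is holomorphic, \<open>magic \<omega> (f z)\<close> equals
  the automorphism \<tau>, so frontier points of C in U attain equality in the contraction. Each of
  them imposes a stationarity condition near a, and two different points cannot impose it
  simultaneously.\<close>

lemma holomorphic_extension_at_center:
  assumes f: "kobayashi_isometry_on f U" and conn: "connected U" and a: "a \<in> U" and fa: "f a = (0, p)" and p0: "p \<noteq> 0"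
    and r: "r > 0" "ball a r \<subseteq> U" "holomorphic_map_on f (ball a r)"
  shows "holomorphic_map_on f U"
proof -
  note fD = kobayashi_isometry_onD[OF f]
  have cont: "continuous_on U f" by (rule kobayashi_isometry_continuous[OF f])
  obtain \<omega> c s where \<omega>: "cmod \<omega> = 1" and c: "cmod c = 1" and s: "s > 0" "s \<le> r"
    and eq0: "\<And>z. z \<in> ball a s \<Longrightarrow> magic \<omega> (f z) = disc_aut (- magic \<omega> (f a)) (c * disc_aut a z)"
    by (rule magic_automorphism_at_center[OF f a fa p0 r]) (rule that)
  define \<beta> where "\<beta> = magic \<omega> (f a)"
  define \<tau> where "\<tau> = (\<lambda>z. disc_aut (- \<beta>) (c * disc_aut a z))"
  have \<beta>: "cmod (- \<beta>) < 1" unfolding \<beta>_def using magic_less_1[OF fD(3)[OF a] \<omega>] by simp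
  have cd: "cmod (c * disc_aut a z) < 1" if "cmod z < 1" for z
    using disc_aut_less_1[OF fD(2)[OF a] that] c by (simp add: norm_mult)
  have \<tau>iso: "cmod (disc_aut (\<tau> y) (\<tau> z)) = cmod (disc_aut y z)" if "cmod y < 1" "cmod z < 1" for y z
    unfolding \<tau>_def cmod_disc_aut_invariant[OF \<beta> cd[OF that(2)] cd[OF that(1)]] cmod_disc_aut_rotate[OF c]
    by (rule cmod_disc_aut_invariant[OF fD(2)[OF a] that(2,1)])
  have \<tau>inj: "y = z" if "\<tau> y = \<tau> z" "cmod y < 1" "cmod z < 1" for y z
  proof -
    have "disc_aut y z = 0" using \<tau>iso[OF that(2,3)] that(1) by simp
    then show ?thesis using one_minus_cnj_nonzero[OF that(2,3)] by (simp add: disc_aut_def)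
  qed
  have \<tau>hol: "\<tau> holomorphic_on unit_disc"
  proof -
    have "(\<lambda>z. c * disc_aut a z) holomorphic_on unit_disc"
      by (intro holomorphic_intros disc_aut_holomorphic[OF fD(2)[OF a]])
    then have "(disc_aut (- \<beta>) \<circ> (\<lambda>z. c * disc_aut a z)) holomorphic_on unit_disc"
      by (rule holomorphic_on_compose_gen[OF _ disc_aut_holomorphic[OF \<beta>]]) (use cd in auto)
    then show ?thesis by (simp only: \<tau>_def comp_def)
  qed
  \<comment> \<open>The union V of this family is the largest open subset of U on which f is
    holomorphic; C is its component of a.\<close>
  define \<B> where "\<B> = {B. open B \<and> B \<subseteq> U \<and> holomorphic_map_on f B}"
  define V where "V = (\<Union>B\<in>\<B>. B)"
  have V: "open V" "V \<subseteq> U" by (auto simp: V_def \<B>_def)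
  have holV: "holomorphic_map_on f V"
    unfolding holomorphic_map_on_def V_def
    by (intro conjI holomorphic_on_UN_open) (simp_all add: \<B>_def holomorphic_map_on_def)
  have VI: "x \<in> V" if "x \<in> B" "open B" "B \<subseteq> U" "holomorphic_map_on f B" for x B
    using that by (auto simp: V_def \<B>_def)
  define C where "C = connected_component_set V a"
  have aV: "a \<in> V" by (rule VI[of a "ball a r"]) (use r in auto)
  have C: "open C" "connected C" "C \<subseteq> V" "a \<in> C"
    using V(1) aV by (simp_all add: C_def open_connected_component connected_component_subset)
  have CU: "C \<subseteq> U" using C(3) V(2) by blast
  have holC: "holomorphic_map_on f C" using holV C(3) unfolding holomorphic_map_on_def by (auto elim: holomorphic_on_subset)
  have rC: "ball a r \<subseteq> C"
  proof -
    have "ball a r \<subseteq> V" using VI[of _ "ball a r"] r by auto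
    then show ?thesis unfolding C_def using r(1) by (intro connected_component_maximal) auto
  qed
  define g where "g = (\<lambda>z. magic \<omega> (f z))"
  have gC: "g z = \<tau> z" if "z \<in> C" for z
  proof (rule analytic_continuation_open[of "ball a s" C g \<tau>])
    show "ball a s \<subseteq> C" using rC s(2) by auto
    show "g holomorphic_on C" unfolding g_def by (rule magic_holomorphic[OF holC _ \<omega>]) (use CU fD(3) in blast)
    show "\<tau> holomorphic_on C" by (rule holomorphic_on_subset[OF \<tau>hol]) (use CU fD(2) in auto)
    show "g z = \<tau> z" if "z \<in> ball a s" for z unfolding g_def \<tau>_def \<beta>_def by (rule eq0[OF that])
  qed (use C s(1) that in auto)
  have g1: "cmod (g z) < 1" if "z \<in> U" for z unfolding g_def by (rule magic_less_1[OF fD(3)[OF that] \<omega>])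
  \<comment> \<open>The component of V at e would be an open set meeting C, hence equal to C, and an
    open set contains none of its frontier points.\<close>
  have notV: "e \<notin> V" if "e \<in> frontier C" for e
  proof
    assume "e \<in> V"
    let ?C' = "connected_component_set V e"
    have "open ?C'" "e \<in> ?C'" using V(1) \<open>e \<in> V\<close> by (simp_all add: open_connected_component)
    moreover have "e \<in> closure C" using that by (simp add: frontier_def)
    ultimately have "?C' \<inter> C \<noteq> {}" by (metis open_Int_closure_eq_empty disjoint_iff)
    then have "?C' = C" unfolding C_def by (metis connected_component_nonoverlap)
    then have "e \<in> C" using \<open>e \<in> ?C'\<close> by blast
    then show False using that C(1) by (simp add: frontier_def interior_open)
  qed
  have fr: "(fst (f e))\<^sup>2 = 4 * snd (f e)" "g e = \<tau> e" if e: "e \<in> U" "e \<in> frontier C" for e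
  proof -
    show "(fst (f e))\<^sup>2 = 4 * snd (f e)"
    proof (rule frontier_point_royal[OF f C(1) CU holC e])
      show "\<not> holomorphic_map_on f (ball e s)" if "s > 0" "ball e s \<subseteq> U" for s
        using VI[of e "ball e s"] notV[OF e(2)] that by auto
    qed
    have "e \<in> closure C" using e(2) by (simp add: frontier_def)
    then obtain x where x: "\<And>n. x n \<in> C" "x \<longlonglongrightarrow> e" unfolding closure_sequential by blast
    have "isCont f e" using cont fD(1) e(1) by (simp add: continuous_on_eq_continuous_at)
    then have fx: "(\<lambda>n. f (x n)) \<longlonglongrightarrow> f e" using x(2) by (rule isCont_tendsto_compose)
    have "(\<lambda>n. g (x n)) \<longlonglongrightarrow> g e"
      unfolding g_def magic_def using magic_denominator[OF fD(3)[OF e(1)] \<omega>] by (intro tendsto_intros fx)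
    moreover have "isCont \<tau> e"
      using holomorphic_on_imp_continuous_on[OF \<tau>hol] fD(2)[OF e(1)] by (simp add: continuous_on_eq_continuous_at)
    then have "(\<lambda>n. \<tau> (x n)) \<longlonglongrightarrow> \<tau> e" using x(2) by (rule isCont_tendsto_compose)
    ultimately show "g e = \<tau> e" unfolding gC[OF x(1)] by (rule LIMSEQ_unique)
  qed
  have "isCont f a" using cont fD(1) a by (simp add: continuous_on_eq_continuous_at)
  then have "isCont (\<lambda>z. (fst (f z))\<^sup>2 - 4 * snd (f z)) a" by (intro continuous_intros)
  moreover have "(fst (f a))\<^sup>2 - 4 * snd (f a) \<noteq> 0" using p0 by (simp add: fa)
  ultimately obtain s1 where s1: "s1 > 0" "\<And>z. z \<in> ball a s1 \<Longrightarrow> (fst (f z))\<^sup>2 - 4 * snd (f z) \<noteq> 0"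
    using continuous_at_avoid[of a "\<lambda>z. (fst (f z))\<^sup>2 - 4 * snd (f z)" 0] by (auto simp: dist_commute)
  \<comment> \<open>A ball around a inside C without royal values, on which the stationarity
    conditions of all frontier points hold together.\<close>
  define S where "S = ball a (min s1 r)"
  have S: "open S" "connected S" "S \<noteq> {}" "S \<subseteq> C" using s1(1) r(1) rC by (auto simp: S_def)
  have SU: "z \<in> U" if "z \<in> S" for z using that S(4) CU by blast
  have nr: "(fst (f z))\<^sup>2 \<noteq> 4 * snd (f z)" if "z \<in> S" for z using s1(2)[of z] that by (simp add: S_def)
  define Q where "Q = (\<lambda>z. \<i> * \<omega> * (4 * snd (f z) - (fst (f z))\<^sup>2) / (2 - \<omega> * fst (f z))\<^sup>2)"
  have Q0: "Q z \<noteq> 0" if "z \<in> S" for z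
    using magic_denominator[OF fD(3)[OF SU[OF that]] \<omega>] nr[OF that] \<omega> by (auto simp: Q_def)
  have stat: "g z \<noteq> g e" "Re (Q z / ((g z - g e) * (1 - cnj (g e) * g z))) = 0"
    if "e \<in> U" "e \<in> frontier C" "z \<in> S" for e z
  proof -
    have "cmod (disc_aut (magic \<omega> (f e)) (magic \<omega> (f z))) = cmod (disc_aut e z)"
      using \<tau>iso[OF fD(2)[OF that(1)] fD(2)[OF SU[OF that(3)]]] fr(2)[OF that(1,2)] gC[of z] S(4) that(3)
      by (auto simp: g_def)
    note m = magic_stationary_royal[OF f SU[OF that(3)] nr[OF that(3)] that(1) fr(1)[OF that(1,2)] \<omega> this]
    show "g z \<noteq> g e" unfolding g_def by (rule m(1))
    show "Re (Q z / ((g z - g e) * (1 - cnj (g e) * g z))) = 0" unfolding g_def Q_def by (rule m(2))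
  qed
  have uniq: "e1 = e2" if e1: "e1 \<in> U" "e1 \<in> frontier C" and e2: "e2 \<in> U" "e2 \<in> frontier C" for e1 e2
  proof -
    have "g e1 = g e2"
    proof (rule stationary_parameter_unique[OF S(1-3) _ _ _ Q0 g1[OF e1(1)] g1[OF e2(1)]
          stat(1)[OF e1] stat(1)[OF e2] stat(2)[OF e1] stat(2)[OF e2]])
      have "g z = \<tau> z" if "z \<in> S" for z using gC that S(4) by blast
      moreover have "\<tau> holomorphic_on S" by (rule holomorphic_on_subset[OF \<tau>hol]) (use SU fD(2) in auto)
      ultimately show "g holomorphic_on S" by (simp cong: holomorphic_cong)
      show "inj_on g S"
        using \<open>\<And>z. z \<in> S \<Longrightarrow> g z = \<tau> z\<close> \<tau>inj SU fD(2) by (intro inj_onI) simp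
      show "cmod (g z) < 1" if "z \<in> S" for z by (rule g1[OF SU[OF that]])
    qed
    then show ?thesis using fr(2)[OF e1] fr(2)[OF e2] \<tau>inj fD(2)[OF e1(1)] fD(2)[OF e2(1)] by simp
  qed
  define K where "K = U \<inter> frontier C"
  have K: "finite K"
  proof (cases "K = {}")
    case False
    then obtain e where "e \<in> U" "e \<in> frontier C" by (auto simp: K_def)
    then have "K \<subseteq> {e}" using uniq by (auto simp: K_def)
    then show ?thesis using finite_subset by blast
  qed simp
  \<comment> \<open>Removing finitely many points keeps U connected. What remains meets C but not
    its frontier, so it lies in C, and the points of K are removable by continuity.\<close>
  have "connected (U - K)" using fD(1) conn K by (intro connected_open_delete_finite) auto
  moreover have "(U - K) \<inter> C \<noteq> {}" using a C(1,4) by (auto simp: K_def frontier_def interior_open)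
  moreover have "(U - K) \<inter> frontier C = {}" by (auto simp: K_def)
  ultimately have "U - K \<subseteq> C" using connected_Int_frontier by blast
  then have "holomorphic_map_on f (U - K)" using holC unfolding holomorphic_map_on_def by (auto elim: holomorphic_on_subset)
  then show ?thesis unfolding holomorphic_map_on_def using K cont fD(1)
    by (auto intro!: no_isolated_singularity[where K = K] continuous_intros)
qed

lemma holomorphic_extension:
  assumes f: "kobayashi_isometry_on f U" and conn: "connected U" and a: "a \<in> U" and nr: "(fst (f a))\<^sup>2 \<noteq> 4 * snd (f a)"
    and r: "r > 0" "ball a r \<subseteq> U" "holomorphic_map_on f (ball a r)"
  shows "holomorphic_map_on f U"
proof -
  note fD = kobayashi_isometry_onD[OF f]
  obtain \<alpha> where \<alpha>: "cmod \<alpha> < 1" "fst (G2_aut \<alpha> (f a)) = 0" by (rule G2_center_exists[OF fD(3)[OF a]])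
  have m\<alpha>: "cmod (- \<alpha>) < 1" using \<alpha>(1) by simp
  have fU: "f ` U \<subseteq> G2" using fD(3) by blast
  have "holomorphic_map_on (\<lambda>z. G2_aut \<alpha> (f z)) U"
  proof (rule holomorphic_extension_at_center[OF kobayashi_isometry_on_G2_aut[OF f \<alpha>(1)] conn a _ _ r(1,2)])
    show "G2_aut \<alpha> (f a) = (0, snd (G2_aut \<alpha> (f a)))" using \<alpha>(2) by (simp add: prod_eq_iff)
    show "snd (G2_aut \<alpha> (f a)) \<noteq> 0" using G2_aut_royal_iff[OF \<alpha>(1) fD(3)[OF a]] nr \<alpha>(2) by simp
    show "holomorphic_map_on (\<lambda>z. G2_aut \<alpha> (f z)) (ball a r)"
      by (rule G2_aut_holomorphic[OF \<alpha>(1) r(3)]) (use r(2) fU in blast)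
  qed
  then have "holomorphic_map_on (\<lambda>z. G2_aut (- \<alpha>) (G2_aut \<alpha> (f z))) U"
    by (rule G2_aut_holomorphic[OF m\<alpha>]) (use G2_aut_in[OF \<alpha>(1)] fD(3) in blast)
  moreover have "G2_aut (- \<alpha>) (G2_aut \<alpha> (f z)) = f z" if "z \<in> U" for z
    by (rule G2_aut_inverse[OF \<alpha>(1) fD(3)[OF that]])
  ultimately show ?thesis unfolding holomorphic_map_on_def by (simp cong: holomorphic_cong)
qed

section \<open>Antiholomorphic maps by reflection of the variable\<close>

lemma cnj_disc_aut: "cnj (disc_aut a z) = disc_aut (cnj a) (cnj z)"
  by (simp add: disc_aut_def)

lemma kobayashi_isometry_on_cnj:
  assumes f: "kobayashi_isometry_on f U"
  shows "kobayashi_isometry_on (\<lambda>z. f (cnj z)) (cnj ` U)"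
proof -
  note fD = kobayashi_isometry_onD[OF f]
  have "open (cnj ` U)"
    unfolding image_cnj_conv_vimage_cnj using fD(1) by (intro open_vimage) (auto intro: continuous_intros)
  moreover have "poincare_dist (cnj a) (cnj b) = poincare_dist a b" for a b
    unfolding poincare_dist_disc_aut cnj_disc_aut[symmetric] complex_mod_cnj ..
  ultimately show ?thesis using fD(2-4) by (auto simp: kobayashi_isometry_on_def)
qed

lemma antiholomorphic_map_on_iff_cnj:
  assumes "open S"
  shows "antiholomorphic_map_on f S \<longleftrightarrow> holomorphic_map_on (\<lambda>z. f (cnj z)) (cnj ` S)"
proof -
  have op: "open (cnj ` S)"
    unfolding image_cnj_conv_vimage_cnj using assms by (intro open_vimage) (auto intro: continuous_intros)
  have "(\<lambda>z. cnj (h z)) holomorphic_on S \<longleftrightarrow> (\<lambda>z. h (cnj z)) holomorphic_on cnj ` S" for h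
  proof
    assume "(\<lambda>z. cnj (h z)) holomorphic_on S"
    then have "cnj \<circ> (\<lambda>z. cnj (h z)) \<circ> cnj holomorphic_on cnj ` S"
      using op by (intro holomorphic_on_compose_cnj_cnj) (simp_all add: image_image)
    then show "(\<lambda>z. h (cnj z)) holomorphic_on cnj ` S" by (simp add: comp_def)
  next
    assume "(\<lambda>z. h (cnj z)) holomorphic_on cnj ` S"
    then have "cnj \<circ> (\<lambda>z. h (cnj z)) \<circ> cnj holomorphic_on S"
      using assms by (intro holomorphic_on_compose_cnj_cnj)
    then show "(\<lambda>z. cnj (h z)) holomorphic_on S" by (simp add: comp_def)
  qed
  then show ?thesis by (simp add: antiholomorphic_map_on_def holomorphic_map_on_def)
qed

lemma antiholomorphic_extension:
  assumes f: "kobayashi_isometry_on f U" and conn: "connected U" and a: "a \<in> U" and nr: "(fst (f a))\<^sup>2 \<noteq> 4 * snd (f a)"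
    and r: "r > 0" "ball a r \<subseteq> U" "antiholomorphic_map_on f (ball a r)"
  shows "antiholomorphic_map_on f U"
proof -
  note fD = kobayashi_isometry_onD[OF f]
  have b: "cnj ` ball a r = ball (cnj a) r"
  proof -
    have "dist (cnj a) z = dist a (cnj z)" for z
      by (metis complex_cnj_cnj complex_cnj_diff complex_mod_cnj dist_norm)
    then show ?thesis unfolding image_cnj_conv_vimage_cnj by auto
  qed
  have "holomorphic_map_on (\<lambda>z. f (cnj z)) (cnj ` U)"
  proof (rule holomorphic_extension[OF kobayashi_isometry_on_cnj[OF f] _ _ _ r(1)])
    show "connected (cnj ` U)" using conn by (intro connected_continuous_image) (auto intro: continuous_intros)
    show "cnj a \<in> cnj ` U" using a by blast
    show "(fst (f (cnj (cnj a))))\<^sup>2 \<noteq> 4 * snd (f (cnj (cnj a)))" using nr by simp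
    show "ball (cnj a) r \<subseteq> cnj ` U" using r(2) b by blast
    show "holomorphic_map_on (\<lambda>z. f (cnj z)) (ball (cnj a) r)"
      using r(3) unfolding b[symmetric] by (subst (asm) antiholomorphic_map_on_iff_cnj) simp_all
  qed
  then show ?thesis using antiholomorphic_map_on_iff_cnj[OF fD(1)] by blast
qed

section \<open>Isometries into the royal variety\<close>

text \<open>Modulus and real part leave only X z = Y z or its conjugate, separately for each z. The
  products of imaginary parts at two points exclude a mixture of the two choices.\<close>

lemma planar_rigidity:
  assumes n: "\<And>z. z \<in> U \<Longrightarrow> cmod (X z) = cmod (Y z)" and re: "\<And>z. z \<in> U \<Longrightarrow> Re (X z) = Re (Y z)"
    and ip: "\<And>y z. y \<in> U \<Longrightarrow> z \<in> U \<Longrightarrow> Re (X z * cnj (X y)) = Re (Y z * cnj (Y y))"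
  shows "(\<forall>z\<in>U. X z = Y z) \<or> (\<forall>z\<in>U. X z = cnj (Y z))"
proof (rule ccontr)
  assume "\<not> ?thesis"
  then obtain y z where yz: "y \<in> U" "z \<in> U" "X y \<noteq> cnj (Y y)" "X z \<noteq> Y z" by blast
  have im: "Im (X z) = Im (Y z) \<or> Im (X z) = - Im (Y z)" if "z \<in> U" for z
    using n[OF that] re[OF that] by (simp add: cmod_def power2_eq_iff)
  have "Im (X z) = - Im (Y z)" "Im (X z) \<noteq> Im (Y z)" "Im (X y) = Im (Y y)" "Im (X y) \<noteq> - Im (Y y)"
    using im[OF yz(1)] im[OF yz(2)] re[OF yz(1)] re[OF yz(2)] yz(3,4) by (auto simp: complex_eq_iff)
  moreover have "Im (X z) * Im (X y) = Im (Y z) * Im (Y y)" using ip[OF yz(1,2)] re yz(1,2) by simp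
  ultimately show False by simp
qed

text \<open>With equal moduli, \<open>disc_aut_identity\<close> recovers |1 -
  \<open>cnj v' * v\<close>| from the pseudohyperbolic distance, and therefore |v - v'| and the real
  inner product.\<close>

lemma inner_product_if_disc_isometry:
  assumes d: "cmod v < 1" "cmod v' < 1" "cmod w < 1" "cmod w' < 1" and n: "cmod v = cmod w" "cmod v' = cmod w'"
    and eq: "cmod (disc_aut v' v) = cmod (disc_aut w' w)"
  shows "Re (v * cnj v') = Re (w * cnj w')"
proof -
  define N where "N = (1 - (cmod w')\<^sup>2) * (1 - (cmod w)\<^sup>2)"
  have N: "N > 0" using d by (simp add: N_def abs_square_less_1)
  have nz: "1 - cnj v' * v \<noteq> 0" "1 - cnj w' * w \<noteq> 0" using one_minus_cnj_nonzero d by blast+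
  have "N / (cmod (1 - cnj v' * v))\<^sup>2 = N / (cmod (1 - cnj w' * w))\<^sup>2"
    using trans[OF sym[OF disc_aut_identity[OF d(2,1)], unfolded eq n] disc_aut_identity[OF d(4,3)]] unfolding N_def .
  then have "(cmod (1 - cnj v' * v))\<^sup>2 = (cmod (1 - cnj w' * w))\<^sup>2" using N nz by (simp add: frac_eq_eq)
  then have c: "cmod (1 - cnj v' * v) = cmod (1 - cnj w' * w)" by simp
  then have "cmod (v - v') = cmod (w - w')" using eq nz by (simp add: disc_aut_def norm_divide)
  then show ?thesis using cmod_diff_power2[of v v'] cmod_diff_power2[of w w'] n by simp
qed

text \<open>With a and u a both moved to 0, a hyperbolic isometry preserves moduli and real inner
  products, so planar Euclidean rigidity applies.\<close>

lemma disc_isometry_linear: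
  assumes U: "open U" "U \<subseteq> unit_disc" "a \<in> U" and u: "\<And>z. z \<in> U \<Longrightarrow> cmod (u z) < 1"
    and iso: "\<And>y z. y \<in> U \<Longrightarrow> z \<in> U \<Longrightarrow> cmod (disc_aut (u y) (u z)) = cmod (disc_aut y z)"
  obtains \<kappa> where "(\<forall>z\<in>U. disc_aut (u a) (u z) = \<kappa> * disc_aut a z) \<or> (\<forall>z\<in>U. disc_aut (u a) (u z) = \<kappa> * cnj (disc_aut a z))"
proof -
  have U1: "cmod z < 1" if "z \<in> U" for z using U(2) that by auto
  define v where "v = (\<lambda>z. disc_aut (u a) (u z))"
  define w where "w = (\<lambda>z. disc_aut a z)"
  have v1: "cmod (v z) < 1" and w1: "cmod (w z) < 1" if "z \<in> U" for z
    unfolding v_def w_def using disc_aut_less_1 u U1 U(3) that by simp_all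
  have n: "cmod (v z) = cmod (w z)" if "z \<in> U" for z unfolding v_def w_def by (rule iso[OF U(3) that])
  have ip: "Re (v z * cnj (v y)) = Re (w z * cnj (w y))" if "y \<in> U" "z \<in> U" for y z
  proof (rule inner_product_if_disc_isometry[OF v1[OF that(2)] v1[OF that(1)] w1[OF that(2)] w1[OF that(1)] n[OF that(2)] n[OF that(1)]])
    show "cmod (disc_aut (v y) (v z)) = cmod (disc_aut (w y) (w z))"
      unfolding v_def w_def cmod_disc_aut_invariant[OF u[OF U(3)] u[OF that(2)] u[OF that(1)]]
        cmod_disc_aut_invariant[OF U1[OF U(3)] U1[OF that(2)] U1[OF that(1)]] by (rule iso[OF that])
  qed
  have "infinite U" using U(1,3) finite_imp_not_open by blast
  then obtain b where b: "b \<in> U" "b \<noteq> a" by (metis finite.emptyI finite_insert insertI1 subsetI finite_subset)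
  have wb: "w b \<noteq> 0" using b one_minus_cnj_nonzero[OF U1[OF U(3)] U1[OF b(1)]] by (simp add: w_def disc_aut_def)
  then have vb: "v b \<noteq> 0" using n[OF b(1)] by auto
  \<comment> \<open>The factors \<open>cnj (v b)\<close> and \<open>cnj (w b)\<close> turn the
    reference point b into the same positive real number on both sides, so that inner products with
    it become real parts.\<close>
  have "(\<forall>z\<in>U. v z * cnj (v b) = w z * cnj (w b)) \<or> (\<forall>z\<in>U. v z * cnj (v b) = cnj (w z * cnj (w b)))"
  proof (rule planar_rigidity)
    show "cmod (v z * cnj (v b)) = cmod (w z * cnj (w b))" if "z \<in> U" for z
      using n[OF that] n[OF b(1)] by (simp add: norm_mult)
    show "Re (v z * cnj (v b)) = Re (w z * cnj (w b))" if "z \<in> U" for z by (rule ip[OF b(1) that])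
    show "Re (v z * cnj (v b) * cnj (v y * cnj (v b))) = Re (w z * cnj (w b) * cnj (w y * cnj (w b)))"
      if "y \<in> U" "z \<in> U" for y z
    proof -
      have e: "x * cnj p * cnj (x' * cnj p) = of_real ((cmod p)\<^sup>2) * (x * cnj x')" for x x' p
        unfolding of_real_cmod_power2 by (simp add: mult_ac)
      show ?thesis unfolding e Re_Im_complex_of_real_mult ip[OF that] n[OF b(1)] ..
    qed
  qed
  then have "(\<forall>z\<in>U. v z = cnj (w b) / cnj (v b) * w z) \<or> (\<forall>z\<in>U. v z = w b / cnj (v b) * cnj (w z))"
    using vb by (simp add: field_simps)
  then show ?thesis
    unfolding v_def w_def by (elim disjE) (rule that, erule disjI1, rule that, erule disjI2)
qed

lemma holomorphic_on_if_disc_aut_linear: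
  assumes "U \<subseteq> unit_disc" "a \<in> U" "cmod b < 1"
    and u: "\<And>z. z \<in> U \<Longrightarrow> cmod (u z) < 1" "\<And>z. z \<in> U \<Longrightarrow> disc_aut b (u z) = \<kappa> * disc_aut a z"
  shows "u holomorphic_on U"
proof -
  have a: "cmod a < 1" using assms(1,2) by auto
  have b: "cmod (- b) < 1" using assms(3) by simp
  have "(\<lambda>z. \<kappa> * disc_aut a z) holomorphic_on U"
    by (intro holomorphic_intros holomorphic_on_subset[OF disc_aut_holomorphic[OF a]] assms(1))
  then have "(disc_aut (- b) \<circ> (\<lambda>z. \<kappa> * disc_aut a z)) holomorphic_on U"
    by (rule holomorphic_on_compose_gen[OF _ disc_aut_holomorphic[OF b]])
      (use u disc_aut_less_1[OF assms(3)] in \<open>force simp flip: u(2)\<close>)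
  moreover have "(disc_aut (- b) \<circ> (\<lambda>z. \<kappa> * disc_aut a z)) z = u z" if "z \<in> U" for z
    using disc_aut_inverse[OF assms(3) u(1)[OF that]] by (simp flip: u(2)[OF that])
  ultimately show ?thesis by (simp cong: holomorphic_cong)
qed

text \<open>The disc t \<mapsto> (2 t, t^2) parametrizes the royal variety and
  \<open>fst x / 2\<close> inverts it. The first bounds the Kobayashi distance from above, the
  second from below, so on the variety it is the Poincare distance and u is an isometry of the
  disc.\<close>

lemma royal_isometry:
  assumes f: "kobayashi_isometry_on f U" and royal: "\<And>z. z \<in> U \<Longrightarrow> (fst (f z))\<^sup>2 = 4 * snd (f z)"
  shows "holomorphic_map_on f U \<or> antiholomorphic_map_on f U"
proof (cases "U = {}")
  case False
  then obtain a where a: "a \<in> U" by blast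
  note fD = kobayashi_isometry_onD[OF f]
  define u where "u = (\<lambda>z. fst (f z) / 2)"
  have half: "cmod (fst x / 2) < 1" if "x \<in> G2" for x
    using G2_bounds(2)[of "fst x" "snd x"] that by (simp add: norm_divide)
  have u1: "cmod (u z) < 1" if "z \<in> U" for z unfolding u_def by (rule half[OF fD(3)[OF that]])
  have fu: "f z = (2 * u z, (u z)\<^sup>2)" if "z \<in> U" for z
    using royal[OF that] by (simp add: u_def prod_eq_iff power_divide)
  have iso: "cmod (disc_aut (u y) (u z)) = cmod (disc_aut y z)" if "y \<in> U" "z \<in> U" for y z
  proof (rule antisym)
    show "cmod (disc_aut (u y) (u z)) \<le> cmod (disc_aut y z)"
      unfolding u_def
      by (rule kobayashi_isometry_contracts[OF f that(2,1), of "\<lambda>x. fst x / 2", OF half])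
        (auto simp: holomorphic_map_on_def intro!: holomorphic_intros)
    define \<phi> :: "complex \<Rightarrow> complex \<times> complex" where "\<phi> = (\<lambda>t. (2 * t, t\<^sup>2))"
    have "holomorphic_map_on \<phi> unit_disc" by (auto simp: holomorphic_map_on_def \<phi>_def intro!: holomorphic_intros)
    moreover have "\<phi> t \<in> G2" if "cmod t < 1" for t
      using G2_pairI[OF that that] unfolding \<phi>_def power2_eq_square mult_2 .
    then have "\<phi> ` unit_disc \<subseteq> G2" by (simp add: image_subset_iff)
    ultimately have "kobayashi_dist G2 (\<phi> (u z)) (\<phi> (u y)) \<le> poincare_dist (u z) (u y)"
      by (rule kobayashi_upper_bound[OF _ _ u1[OF that(2)] u1[OF that(1)]])
    then have "poincare_dist z y \<le> poincare_dist (u z) (u y)"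
      unfolding \<phi>_def fu[OF that(1), symmetric] fu[OF that(2), symmetric] fD(4)[OF that(2,1)] .
    then show "cmod (disc_aut y z) \<le> cmod (disc_aut (u y) (u z))"
      by (subst (asm) poincare_dist_le_iff) (simp_all add: fD u1 that)
  qed
  have Ud: "U \<subseteq> unit_disc" using fD(2) by auto
  obtain \<kappa> where "(\<forall>z\<in>U. disc_aut (u a) (u z) = \<kappa> * disc_aut a z) \<or> (\<forall>z\<in>U. disc_aut (u a) (u z) = \<kappa> * cnj (disc_aut a z))"
    by (rule disc_isometry_linear[OF fD(1) Ud a u1 iso])
  then show ?thesis
  proof
    assume "\<forall>z\<in>U. disc_aut (u a) (u z) = \<kappa> * disc_aut a z"
    then have "u holomorphic_on U" using u1 by (intro holomorphic_on_if_disc_aut_linear[OF Ud a u1[OF a]]) auto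
    then have "(\<lambda>z. 2 * u z) holomorphic_on U" "(\<lambda>z. (u z)\<^sup>2) holomorphic_on U" by (auto intro!: holomorphic_intros)
    then have "holomorphic_map_on f U" unfolding holomorphic_map_on_def by (simp add: fu cong: holomorphic_cong)
    then show ?thesis ..
  next
    assume k: "\<forall>z\<in>U. disc_aut (u a) (u z) = \<kappa> * cnj (disc_aut a z)"
    have "disc_aut (cnj (u a)) (cnj (u z)) = cnj \<kappa> * disc_aut a z" if "z \<in> U" for z
    proof -
      have "cnj (disc_aut (u a) (u z)) = cnj \<kappa> * disc_aut a z" using k that by simp
      then show ?thesis by (simp only: cnj_disc_aut)
    qed
    then have "(\<lambda>z. cnj (u z)) holomorphic_on U"
      using u1 a by (intro holomorphic_on_if_disc_aut_linear[OF Ud a, of "cnj (u a)"]) auto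
    then have "(\<lambda>z. 2 * cnj (u z)) holomorphic_on U" "(\<lambda>z. (cnj (u z))\<^sup>2) holomorphic_on U" by (auto intro!: holomorphic_intros)
    then have "antiholomorphic_map_on f U" unfolding antiholomorphic_map_on_def by (simp add: fu cong: holomorphic_cong)
    then show ?thesis ..
  qed
qed (simp add: holomorphic_map_on_def holomorphic_on_def)

theorem theorem1:
  fixes U :: "complex set" and f :: "complex \<Rightarrow> complex \<times> complex"
  assumes "U \<subseteq> unit_disc" and "open U" and "connected U"
    and "f ` U \<subseteq> symmetrized_bidisc"
    and "\<And>a b. a \<in> U \<Longrightarrow> b \<in> U \<Longrightarrow>
           kobayashi_dist symmetrized_bidisc (f a) (f b) = poincare_dist a b"
  shows "holomorphic_map_on f U \<or> antiholomorphic_map_on f U"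
proof -
  have f: "kobayashi_isometry_on f U" using assms by (simp add: kobayashi_isometry_on_def)
  show ?thesis
  proof (cases "\<forall>z\<in>U. (fst (f z))\<^sup>2 = 4 * snd (f z)")
    case True
    then show ?thesis using royal_isometry[OF f] by blast
  next
    case False
    then obtain a where a: "a \<in> U" "(fst (f a))\<^sup>2 \<noteq> 4 * snd (f a)" by blast
    obtain r where r: "r > 0" "ball a r \<subseteq> U" "holomorphic_map_on f (ball a r) \<or> antiholomorphic_map_on f (ball a r)"
      by (rule locally_holomorphic_or_antiholomorphic[OF f a])
    then show ?thesis
      using holomorphic_extension[OF f assms(3) a r(1,2)] antiholomorphic_extension[OF f assms(3) a r(1,2)] by blast
  qed
qed

end
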